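(* Let $\mathcal{G}$ be a series-parallel-like closed class, and let $Y_n$ be the size of the 2-connected core in a uniformly random vertex-rooted connected graph from $\mathcal{G}$ with core and $n$ vertices. Then $\mathbf{P}(Y_n=k)$ tends to a limit $q_k$ as $n\to\infty$, and the probability generating function $q(u)=\sum_kq_ku^k$ is $q(u)=\tau uB''(u\tau)$. With $X=\sqrt{1-x/R}$: (a) if $B(x)=B_0+B_2X^2+B_3X^3+O(X^4)$, then $q_k\sim\frac{3B_3}{4R\sqrt\pi}k^{-1/2}(\tau/R)^k$; (b) if $B(x)=B_0+B_2X^2+B_4X^4+B_5X^5+O(X^6)$, then $q_k\sim-\frac{5B_5}{2R\sqrt\pi}k^{-3/2}(\tau/R)^k$. Finally, the probability that a random vertex-rooted connected graph from $\mathcal{G}$ is coreless tends to $1-\rho/\tau$.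
   Context: Graphs are labelled. A class $\mathcal{G}$ (closed under isomorphism) is closed if a graph is in $\mathcal{G}$ iff its connected components, blocks and 3-connected components all are; its 3-connected members' generating function $T(x,z)$ satisfies: for fixed $x$ a unique dominant singularity $r(x)$ with an expansion $\sum_{n\ge n_0}T_n(x)(1-z/r(x))^{n/\kappa}$, $r,T_n$ analytic. $B(x),C(x)$ are the exponential generating functions of 2-connected and connected graphs in $\mathcal{G}$, $xC'(x)=x\exp(B'(xC'(x)))$, $R$ is the radius of convergence of $B$ and $\rho$ that of $C$. $\mathcal{G}$ is series-parallel-like if $RB''(R)>1$; then $\tau\in(0,R)$ is the unique solution of $\tau B''(\tau)=1$ and $\rho=\tau e^{-B'(\tau)}$. Vertex-rooted connected graphs have an unlabelled root vertex (generating function $C'(x)$). If the root is not a cut vertex, the core is the unique block containing the root, and its size is its number of non-root vertices; if the root is a cut vertex the graph is coreless.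
   Formalization: In (b) the constant is −15B_5/(8R√π): the printed −5B_5/(2R√π) contradicts q(u)=τuB''(uτ) by a factor 3/4. The expansions of B are taken in a dented domain at R, with B_3, B_5 nonzero. *)

theory Defs
  imports "HOL-Probability.Probability" "HOL-Library.Landau_Symbols"
begin

section \<open>Finite simple graphs\<close>

type_synonym graph = "nat set \<times> nat set set"

abbreviation verts :: "graph \<Rightarrow> nat set" where "verts \<equiv> fst"
abbreviation edges :: "graph \<Rightarrow> nat set set" where "edges \<equiv> snd"

definition simple_graph :: "graph \<Rightarrow> bool" where
  "simple_graph G \<longleftrightarrow> finite (verts G) \<and> edges G \<subseteq> {e. e \<subseteq> verts G \<and> card e = 2}"

definition graph_iso :: "graph \<Rightarrow> graph \<Rightarrow> bool" where
  "graph_iso G H \<longleftrightarrow>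
     (\<exists>f. bij_betw f (verts G) (verts H) \<and> edges H = (\<lambda>e. f ` e) ` edges G)"

definition subgraph :: "graph \<Rightarrow> graph \<Rightarrow> bool" where
  "subgraph H G \<longleftrightarrow> simple_graph H \<and> verts H \<subseteq> verts G \<and> edges H \<subseteq> edges G"

definition del_verts :: "graph \<Rightarrow> nat set \<Rightarrow> graph" where
  "del_verts G S = (verts G - S, {e \<in> edges G. e \<inter> S = {}})"

definition reachable :: "graph \<Rightarrow> nat \<Rightarrow> nat \<Rightarrow> bool" where
  "reachable G u v \<longleftrightarrow> (u, v) \<in> {(x, y). {x, y} \<in> edges G}\<^sup>*"

definition connected_graph :: "graph \<Rightarrow> bool" where
  "connected_graph G \<longleftrightarrow>
     simple_graph G \<and> verts G \<noteq> {} \<and> (\<forall>u\<in>verts G. \<forall>v\<in>verts G. reachable G u v)"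

definition cut_vertex :: "graph \<Rightarrow> nat \<Rightarrow> bool" where
  "cut_vertex G v \<longleftrightarrow> v \<in> verts G \<and>
     (\<exists>x \<in> verts G - {v}. \<exists>y \<in> verts G - {v}.
        reachable G x y \<and> \<not> reachable (del_verts G {v}) x y)"

text \<open>As usual in the enumeration of graphs by blocks, a single edge is 2-connected
  and a single vertex is not; the first term of the series of 2-connected graphs is
  \<open>x\<^sup>2/2\<close>. This is the convention under which \<open>x C'(x) = x exp (B'(x C'(x)))\<close>.\<close>

definition two_connected :: "graph \<Rightarrow> bool" where
  "two_connected G \<longleftrightarrow>
     connected_graph G \<and> 2 \<le> card (verts G) \<and> (\<forall>v. \<not> cut_vertex G v)"

definition three_connected :: "graph \<Rightarrow> bool" where
  "three_connected G \<longleftrightarrow> simple_graph G \<and> 4 \<le> card (verts G) \<and>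
     (\<forall>S \<subseteq> verts G. card S < 3 \<longrightarrow> connected_graph (del_verts G S))"

definition maximal_subgraph :: "(graph \<Rightarrow> bool) \<Rightarrow> graph \<Rightarrow> graph \<Rightarrow> bool" where
  "maximal_subgraph P H G \<longleftrightarrow> subgraph H G \<and> P H \<and>
     (\<forall>K. subgraph K G \<and> P K \<and> subgraph H K \<longrightarrow> K = H)"

abbreviation component_of :: "graph \<Rightarrow> graph \<Rightarrow> bool" where
  "component_of \<equiv> maximal_subgraph connected_graph"

abbreviation block_of :: "graph \<Rightarrow> graph \<Rightarrow> bool" where
  "block_of \<equiv> maximal_subgraph two_connected"

text \<open>Decomposition of a 2-connected graph at 2-separators: \<open>G\<close> is split along a
  separator \<open>A \<inter> B\<close> into its parts on \<open>A\<close> and on \<open>B\<close>, each completed by the (virtual)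
  edge \<open>A \<inter> B\<close>. Multiple edges are merged, which only discards the bonds of the Tutte
  decomposition; the 3-connected graphs that arise are its 3-connected components (the
  remaining parts come from cycles). The separation is symmetric in \<open>A\<close> and \<open>B\<close>, so
  one rule yields both parts.\<close>

definition two_separation :: "graph \<Rightarrow> nat set \<Rightarrow> nat set \<Rightarrow> bool" where
  "two_separation G A B \<longleftrightarrow> A \<union> B = verts G \<and> card (A \<inter> B) = 2 \<and>
     A - B \<noteq> {} \<and> B - A \<noteq> {} \<and> (\<forall>e\<in>edges G. e \<subseteq> A \<or> e \<subseteq> B)"

inductive tutte_part :: "graph \<Rightarrow> graph \<Rightarrow> bool" where
  refl: "tutte_part G G"
| split: "two_separation G A B \<Longrightarrow>
    tutte_part (A, insert (A \<inter> B) {e \<in> edges G. e \<subseteq> A}) H \<Longrightarrow> tutte_part G H"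

definition three_component_of :: "graph \<Rightarrow> graph \<Rightarrow> bool" where
  "three_component_of H G \<longleftrightarrow>
     three_connected H \<and> (\<exists>K. block_of K G \<and> tutte_part K H)"

text \<open>Each of the three kinds of components must determine membership on its own. Since
  a connected graph is its own connected component, a single equivalence quantifying over
  all three kinds together would be void for connected graphs.\<close>

definition closed_class :: "graph set \<Rightarrow> bool" where
  "closed_class \<G> \<longleftrightarrow>
     (\<forall>G\<in>\<G>. simple_graph G) \<and>
     (\<forall>G H. G \<in> \<G> \<and> simple_graph H \<and> graph_iso G H \<longrightarrow> H \<in> \<G>) \<and>
     (\<forall>G. simple_graph G \<longrightarrow>
        (G \<in> \<G> \<longleftrightarrow> (\<forall>H. component_of H G \<longrightarrow> H \<in> \<G>)) \<and>
        (G \<in> \<G> \<longleftrightarrow> (\<forall>H. block_of H G \<longrightarrow> H \<in> \<G>)) \<and>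
        (G \<in> \<G> \<longleftrightarrow> (\<forall>H. three_component_of H G \<longrightarrow> H \<in> \<G>)))"


section \<open>Generating functions\<close>

definition egf :: "graph set \<Rightarrow> 'a::field_char_0 fps" where
  "egf \<F> = Abs_fps (\<lambda>n. of_nat (card {G \<in> \<F>. verts G = {..<n}}) / fact n)"

definition B_fps :: "graph set \<Rightarrow> 'a::field_char_0 fps" where
  "B_fps \<G> = egf {G \<in> \<G>. two_connected G}"

definition C_fps :: "graph set \<Rightarrow> 'a::field_char_0 fps" where
  "C_fps \<G> = egf {G \<in> \<G>. connected_graph G}"

text \<open>\<open>T(x,z)\<close> for fixed \<open>x\<close>, as a power series in the edge variable \<open>z\<close>. A 3-connected
  graph has at least as many edges as vertices, so the coefficient sum is complete.\<close>

definition T_fps :: "graph set \<Rightarrow> 'a::field_char_0 \<Rightarrow> 'a fps" where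
  "T_fps \<G> x = Abs_fps (\<lambda>m. \<Sum>n\<le>m. of_nat (card {G \<in> \<G>. three_connected G \<and>
     verts G = {..<n} \<and> card (edges G) = m}) / fact n * x ^ n)"

definition extends_at :: "complex fps \<Rightarrow> complex \<Rightarrow> bool" where
  "extends_at f w \<longleftrightarrow> (\<exists>\<epsilon>>0. \<exists>g. g holomorphic_on ball w \<epsilon> \<and>
     (\<forall>z \<in> ball w \<epsilon> \<inter> eball 0 (fps_conv_radius f). g z = eval_fps f z))"

definition unique_dominant_singularity :: "complex fps \<Rightarrow> complex \<Rightarrow> bool" where
  "unique_dominant_singularity f r \<longleftrightarrow> r \<noteq> 0 \<and> fps_conv_radius f = ereal (norm r) \<and>
     (\<forall>w. norm w = norm r \<longrightarrow> (extends_at f w \<longleftrightarrow> w \<noteq> r))"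

text \<open>On the disc of convergence \<open>1 - z / r\<close> has positive real part, so \<open>powr\<close> is the
  usual branch of the fractional power.\<close>

definition regular_three_connected :: "graph set \<Rightarrow> bool" where
  "regular_three_connected \<G> \<longleftrightarrow>
     (\<exists>(r :: complex \<Rightarrow> complex) (t :: int \<Rightarrow> complex \<Rightarrow> complex) (n0 :: int) (\<kappa> :: nat).
        \<kappa> > 0 \<and>
        r analytic_on (of_real ` {0::real<..}) \<and>
        (\<forall>n\<ge>n0. t n analytic_on (of_real ` {0::real<..})) \<and>
        (\<forall>x \<in> of_real ` {0::real<..}.
           unique_dominant_singularity (T_fps \<G> x) (r x) \<and>
           (\<exists>\<delta>>0. \<forall>z \<in> ball (r x) \<delta> \<inter> ball 0 (norm (r x)).
              (\<lambda>j. t (n0 + int j) x *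
                   (1 - z / r x) powr (of_int (n0 + int j) / of_nat \<kappa>))
              sums eval_fps (T_fps \<G> x) z)))"

definition R_of :: "graph set \<Rightarrow> real" where
  "R_of \<G> = real_of_ereal (fps_conv_radius (B_fps \<G> :: real fps))"

definition rho_of :: "graph set \<Rightarrow> real" where
  "rho_of \<G> = real_of_ereal (fps_conv_radius (C_fps \<G> :: real fps))"

definition B'' :: "graph set \<Rightarrow> 'a::field_char_0 fps" where
  "B'' \<G> = fps_deriv (fps_deriv (B_fps \<G>))"

text \<open>\<open>B''(R)\<close> may be infinite. If \<open>B\<close> has radius of convergence \<open>0\<close> or \<open>\<infinity>\<close> then
  \<open>R_of \<G> = 0\<close> and the predicate is false.\<close>

definition series_parallel_like :: "graph set \<Rightarrow> bool" where
  "series_parallel_like \<G> \<longleftrightarrow>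
     ereal (R_of \<G>) * (\<Sum>k. ereal (fps_nth (B'' \<G>) k * R_of \<G> ^ k)) > 1"

definition tau_of :: "graph set \<Rightarrow> real" where
  "tau_of \<G> = (THE t. 0 < t \<and> t < R_of \<G> \<and> t * eval_fps (B'' \<G>) t = 1)"

definition dented_domain :: "real \<Rightarrow> real \<Rightarrow> real \<Rightarrow> complex set" where
  "dented_domain R R' \<phi> =
     {z. norm z < R' \<and> z \<noteq> of_real R \<and> \<phi> < \<bar>Arg (z - of_real R)\<bar>}"

text \<open>The singular expansion \<open>f(x) = P(X) + O(X\<^sup>N)\<close> with \<open>X = \<surd>(1 - x/R)\<close>, understood as
  usual in singularity analysis: \<open>f\<close> continues analytically to a dented domain at \<open>R\<close> and
  the expansion holds as \<open>x \<rightarrow> R\<close> inside it.\<close>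

definition singular_expansion ::
    "complex fps \<Rightarrow> real \<Rightarrow> (complex \<Rightarrow> complex) \<Rightarrow> nat \<Rightarrow> bool" where
  "singular_expansion f R P N \<longleftrightarrow>
     (\<exists>R' \<phi> F. R < R' \<and> 0 < \<phi> \<and> \<phi> < pi / 2 \<and>
        F holomorphic_on dented_domain R R' \<phi> \<and>
        (\<forall>x \<in> ball 0 R. F x = eval_fps f x) \<and>
        (\<lambda>x. F x - P (csqrt (1 - x / of_real R)))
          \<in> O[at (of_real R) within dented_domain R R' \<phi>](
             \<lambda>x. csqrt (1 - x / of_real R) ^ N))"


section \<open>Random vertex-rooted connected graphs\<close>

text \<open>The root is the vertex \<open>0\<close>; it is unlabelled in the sense that it does not take part
  in the labelling of the other vertices by \<open>1, \<dots>, n - 1\<close>. Thus there are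
  \<open>(n - 1)! [x\<^sup>n\<^sup>-\<^sup>1] C'(x)\<close> such graphs on \<open>n\<close> vertices.\<close>

definition rooted_graphs :: "graph set \<Rightarrow> nat \<Rightarrow> graph set" where
  "rooted_graphs \<G> n = {G \<in> \<G>. connected_graph G \<and> verts G = {..<n}}"

definition coreless :: "graph \<Rightarrow> bool" where
  "coreless G \<longleftrightarrow> cut_vertex G 0"

definition core :: "graph \<Rightarrow> graph" where
  "core G = (THE H. block_of H G \<and> 0 \<in> verts H)"

definition core_size :: "graph \<Rightarrow> nat" where
  "core_size G = card (verts (core G) - {0})"

definition random_rooted :: "graph set \<Rightarrow> nat \<Rightarrow> graph pmf" where
  "random_rooted \<G> n = pmf_of_set (rooted_graphs \<G> n)"

definition random_rooted_with_core :: "graph set \<Rightarrow> nat \<Rightarrow> graph pmf" where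
  "random_rooted_with_core \<G> n = pmf_of_set {G \<in> rooted_graphs \<G> n. \<not> coreless G}"

end

(*
  Write F = x C'(x). A connected graph rooted at r without r being a cut vertex consists of its
  core, a block containing r, with a vertex-rooted connected graph hanging off every other core
  vertex; so such graphs with a core of size k are counted by [x^k]B' times F^k. Splitting an
  arbitrary rooted connected graph at the root gives C' = exp(B'(F)), i.e. F = x phi(F) with
  phi = exp(B').

  By Lagrange inversion n [x^n] H(F) = [y^(n-1)] H'(y) phi(y)^n. If tau < R and tau B''(tau) = 1,
  then phi(tau y) / phi(tau) is the probability generating function of an aperiodic distribution
  of mean 1, and a local limit theorem yields [x^n] H(F) / [x^n] F -> H'(tau) for every H analytic
  beyond tau. With H = y^k and H = B' this gives q_k = k tau^k [x^k]B', and, together with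
  [x^n]F / [x^(n+1)]F -> rho = tau / phi(tau), the probability of having a core.

  The tail of q is that of the coefficients of B. An error term O((1 - x/R)^M) on a dented domain
  contributes O(n^(-M-1)) R^(-n): by Cauchy's estimates its derivative of order M + 2 is
  O(|1 - x/R|^(-2)) on the disc, and the mean of that over circles is a Poisson integral.
*)

theory Submission
  imports Defs "HOL-Complex_Analysis.Complex_Analysis"
begin

text \<open>The series \<open>C\<close> is never continued beyond its disc: Lagrange inversion moves
  every question about \<open>F\<close> to the circle of radius \<tau>, strictly inside the disc of
  convergence of \<open>B'\<close>. The step law is compound Poisson, so its characteristic function
  has an explicit logarithm. The single edge belongs to every closed class, which makes the law
  aperiodic; the Gaussian constant cancels from all quotients.

  On the graph side the obstacle is to get the core without a block tree. It is taken as a maximal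
  vertex set that contains the root and induces a 2-connected graph. A path outside it between two
  of its vertices would enlarge it, so the remaining edges form pieces with exactly one core vertex
  each. Membership in the class passes between whole and parts because every 2-connected subgraph
  lies in one part.

  The functional equation is reached in differentiated form, by splitting off the part at the root
  that contains one marked vertex. There is then no unordered set of parts to count, and exp(B')
  enters only through its linear differential equation.\<close>

unbundle no vec_syntax

section \<open>Lagrange inversion\<close>

text \<open>As \<open>b\<close> has no constant term, \<open>b ^ k\<close> starts in degree
  \<open>k\<close>. All inner coefficients can therefore be summed over the common range
  \<open>k \<le> n\<close>, and the two sums exchanged.\<close>

lemma fps_compose_mult_nth:
  fixes a b c :: "'a::comm_ring_1 fps"
  assumes "b $ 0 = 0"
  shows "((a oo b) * c) $ n = (\<Sum>k\<le>n. a $ k * (b ^ k * c) $ n)"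
proof -
  have "((a oo b) * c) $ n = (\<Sum>i\<le>n. (\<Sum>k\<le>n. a $ k * (b ^ k) $ i) * c $ (n - i))"
  proof -
    have "(a oo b) $ i = (\<Sum>k\<le>n. a $ k * (b ^ k) $ i)" if "i \<le> n" for i
      unfolding fps_compose_nth atMost_atLeast0 using that assms startsby_zero_power_prefix[OF assms]
      by (intro sum.mono_neutral_left) auto
    then show ?thesis
      unfolding fps_mult_nth atMost_atLeast0 by (intro sum.cong) (auto simp: atMost_atLeast0)
  qed
  also have "\<dots> = (\<Sum>i\<le>n. \<Sum>k\<le>n. a $ k * ((b ^ k) $ i * c $ (n - i)))"
    by (simp add: sum_distrib_right mult.assoc)
  also have "\<dots> = (\<Sum>k\<le>n. \<Sum>i\<le>n. a $ k * ((b ^ k) $ i * c $ (n - i)))"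
    by (rule sum.swap)
  also have "\<dots> = (\<Sum>k\<le>n. a $ k * (b ^ k * c) $ n)"
    by (simp add: fps_mult_nth sum_distrib_left atMost_atLeast0)
  finally show ?thesis .
qed

text \<open>The formal residue of \<open>\<psi>\<^bsup>k-n-1\<^esup> \<psi>'\<close> for \<open>\<psi> = y / \<phi>(y)\<close>, multiplied out so that no
  negative powers occur.\<close>
lemma lagrange_residue:
  fixes \<phi> :: "'a::field_char_0 fps"
  assumes \<phi>0: "\<phi> $ 0 \<noteq> 0" and k: "k < n"
  defines "\<psi> \<equiv> fps_X * inverse \<phi>"
  shows "(\<psi> ^ k * (fps_deriv \<psi> * \<phi> ^ n)) $ (n - 1) = (if Suc k = n then 1 else 0)"
proof -
  obtain m where n: "n = Suc k + m" using k less_iff_Suc_add by auto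
  have inv: "inverse \<phi> * \<phi> = 1" using \<phi>0 by (rule inverse_mult_eq_1)
  have d\<psi>: "fps_deriv \<psi> = inverse \<phi> - fps_X * (fps_deriv \<phi> * inverse \<phi> * inverse \<phi>)"
    using \<phi>0 by (simp add: \<psi>_def fps_inverse_deriv power2_eq_square algebra_simps)
  have pw: "inverse \<phi> ^ j * \<phi> ^ (j + i) = \<phi> ^ i" for i j
    using inv by (simp add: power_add flip: mult.assoc power_mult_distrib)
  have "\<psi> ^ k * (fps_deriv \<psi> * \<phi> ^ n) =
      fps_X ^ k * (inverse \<phi> ^ Suc k * \<phi> ^ n)
      - fps_X ^ Suc k * (fps_deriv \<phi> * (inverse \<phi> ^ Suc (Suc k) * \<phi> ^ n))"
    unfolding d\<psi> by (simp add: \<psi>_def power_mult_distrib algebra_simps)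
  also have "inverse \<phi> ^ Suc k * \<phi> ^ n = \<phi> ^ m"
    unfolding n by (rule pw)
  finally have eq: "\<psi> ^ k * (fps_deriv \<psi> * \<phi> ^ n) = fps_X ^ k * \<phi> ^ m
      - fps_X ^ Suc k * (fps_deriv \<phi> * (inverse \<phi> ^ Suc (Suc k) * \<phi> ^ n))" .
  show ?thesis
  proof (cases m)
    case 0
    then show ?thesis unfolding eq unfolding n
      by (simp add: fps_X_power_mult_nth del: power_Suc)
  next
    case (Suc l)
    have n': "n = Suc (Suc k) + l" using n Suc by simp
    have "inverse \<phi> ^ Suc (Suc k) * \<phi> ^ n = \<phi> ^ l"
      unfolding n' by (rule pw)
    \<comment> \<open>This makes the residue vanish for \<open>k < n - 1\<close>: up to the factor
      \<open>m\<close>, the series \<open>fps_deriv \<phi> * \<phi> ^ l\<close> is the derivative of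
      \<open>\<phi> ^ m\<close>, so the two terms of \<open>eq\<close> cancel.\<close>
    moreover have "of_nat m * (\<phi> ^ m $ m) = of_nat m * (fps_deriv \<phi> * \<phi> ^ l) $ l"
    proof -
      have "of_nat m * (\<phi> ^ m $ m) = fps_deriv (\<phi> ^ m) $ l"
        unfolding Suc by (simp only: fps_deriv_nth Suc_eq_plus1)
      also have "fps_deriv (\<phi> ^ m) = fps_const (of_nat m) * (fps_deriv \<phi> * \<phi> ^ l)"
        using fps_deriv_power[of \<phi> m] by (simp only: Suc diff_Suc_1 mult.assoc)
      finally show ?thesis by simp
    qed
    then have "\<phi> ^ m $ m = (fps_deriv \<phi> * \<phi> ^ l) $ l"
      using Suc by (simp del: of_nat_Suc)
    ultimately show ?thesis unfolding eq
      using Suc n by (simp add: fps_X_power_mult_nth del: power_Suc)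
  qed
qed

text \<open>Since \<open>\<psi>\<close> is the compositional inverse of \<open>F\<close>, the series
  \<open>H\<close> is \<open>A oo \<psi>\<close> with \<open>A = H oo F\<close>. The chain rule then
  produces the factor \<open>fps_deriv \<psi>\<close>, and the residue formula keeps only the
  coefficient of degree \<open>n - 1\<close> of \<open>fps_deriv A\<close>.\<close>

theorem lagrange_inversion:
  fixes F \<phi> H :: "'a::field_char_0 fps"
  assumes F: "F = fps_X * (\<phi> oo F)" and \<phi>0: "\<phi> $ 0 \<noteq> 0" and n: "n > 0"
  shows "of_nat n * (H oo F) $ n = (fps_deriv H * \<phi> ^ n) $ (n - 1)"
proof -
  define \<psi> where "\<psi> = fps_X * inverse \<phi>"
  have F0: "F $ 0 = 0" by (subst F) simp
  have \<psi>0: "\<psi> $ 0 = 0" and \<psi>1: "\<psi> $ 1 \<noteq> 0" using \<phi>0 by (simp_all add: \<psi>_def)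
  have \<psi>F: "\<psi> oo F = fps_X"
  proof -
    have "(\<phi> oo F) $ 0 \<noteq> 0" using \<phi>0 by simp
    have "\<psi> oo F = F * inverse (\<phi> oo F)"
      unfolding \<psi>_def using F0 \<phi>0 by (simp add: fps_compose_mult_distrib fps_inverse_compose)
    also have "\<dots> = fps_X * ((\<phi> oo F) * inverse (\<phi> oo F))"
      by (subst F) (simp only: mult.assoc)
    also have "\<dots> = fps_X" using \<open>(\<phi> oo F) $ 0 \<noteq> 0\<close> by (simp add: inverse_mult_eq_1')
    finally show ?thesis .
  qed
  have F\<psi>: "F oo \<psi> = fps_X"
  proof -
    have "F = fps_inv \<psi>"
      using \<psi>F fps_inv[OF \<psi>0 \<psi>1] F0 \<psi>0 \<psi>1
      by (metis fps_X_fps_compose_startby0 fps_compose_assoc fps_compose_fps_X fps_inv_right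
          fps_inv_def fps_nth_Abs_fps fps_ginv_def)
    then show ?thesis using fps_inv[OF \<psi>0 \<psi>1] by simp
  qed
  define A where "A = H oo F"
  have "H = A oo \<psi>"
    unfolding A_def using F\<psi> \<psi>0 F0 by (simp flip: fps_compose_assoc)
  then have "fps_deriv H * \<phi> ^ n = (fps_deriv A oo \<psi>) * (fps_deriv \<psi> * \<phi> ^ n)"
    using \<psi>0 by (simp add: fps_compose_deriv mult.assoc)
  then have "(fps_deriv H * \<phi> ^ n) $ (n - 1) =
      (\<Sum>k\<le>n - 1. fps_deriv A $ k * (\<psi> ^ k * (fps_deriv \<psi> * \<phi> ^ n)) $ (n - 1))"
    by (simp only: fps_compose_mult_nth[OF \<psi>0])
  also have "\<dots> = (\<Sum>k\<le>n - 1. if k = n - 1 then fps_deriv A $ k else 0)"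
    unfolding \<psi>_def using n
    by (intro sum.cong HOL.refl, subst lagrange_residue[OF \<phi>0]) auto
  also have "\<dots> = of_nat n * A $ n"
    using n by simp
  finally show ?thesis by (simp add: A_def)
qed

text \<open>The quotient of two solutions is constant.\<close>
lemma fps_linear_ode_unique:
  fixes f g k :: "'a::field_char_0 fps"
  assumes "fps_deriv f = k * f" "fps_deriv g = k * g" "f $ 0 = g $ 0"  "g $ 0 \<noteq> 0"
  shows "f = g"
proof -
  have "fps_deriv (f * inverse g) = 0"
    using assms(4) by (simp add: fps_inverse_deriv assms(1,2) power2_eq_square)
      (simp add: inverse_mult_eq_1' mult.assoc mult.left_commute mult.commute)
  then have "f * inverse g = fps_const ((f * inverse g) $ 0)"
    by (simp only: fps_deriv_eq_0_iff)
  also have "(f * inverse g) $ 0 = 1" using assms(3,4) by simp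
  finally have "f * inverse g * g = g" by simp
  then show ?thesis using assms(4) by (simp add: mult.assoc inverse_mult_eq_1)
qed

section \<open>A local limit theorem for coefficients of large powers\<close>

lemma integral_cis_period:
  fixes m n :: nat
  shows "(LINT t|lborel. indicator {-pi..pi} t *\<^sub>R (cis (real m * t) * cis (- (real n * t)))) =
    (if m = n then 2 * of_real pi else 0)"
proof (cases "m = n")
  case True
  then show ?thesis by (simp add: cis_mult scaleR_conv_of_real)
next
  case False
  define k where "k = real m - real n"
  have k0: "k \<noteq> 0" using False by (simp add: k_def)
  have cis_k: "cis (k * pi) = cis (k * - pi)"
  proof -
    have "sin (k * pi) = 0" unfolding k_def by (simp add: sin_diff algebra_simps)
    then show ?thesis by (simp add: complex_eq_iff)
  qed
  define G where "G = (\<lambda>t. cis (k * t) / (\<i> * of_real k))"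
  have "(G has_vector_derivative cis (k * t)) (at t within A)" for t A
  proof -
    have "((\<lambda>t. exp (\<i> * of_real k * of_real t) / (\<i> * of_real k)) has_vector_derivative
       exp (\<i> * of_real k * of_real t)) (at t within A)"
      using k0 by (auto intro!: derivative_eq_intros has_vector_derivative_real_field)
    then show ?thesis by (simp add: G_def cis_conv_exp mult.assoc)
  qed
  then have "(LINT t|lborel. indicator {-pi..pi} t *\<^sub>R cis (k * t)) = G pi - G (-pi)"
    by (intro integral_FTC_Icc continuous_intros) auto
  also have "\<dots> = 0" using cis_k by (simp add: G_def)
  finally show ?thesis using False by (simp add: cis_mult k_def algebra_simps)
qed

text \<open>Cauchy's coefficient formula, by orthogonality of the characters term by term. It is
  phrased as a Lebesgue integral over the line with an indicator, so that the variable can later be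
  rescaled and dominated convergence applied.\<close>

lemma fps_nth_integral:
  fixes f :: "complex fps"
  assumes r: "0 \<le> r" "ereal r < fps_conv_radius f"
  shows "(LINT t|lborel. indicator {-pi..pi} t *\<^sub>R
            (eval_fps f (of_real r * cis t) * cis (- (real n * t)))) =
         2 * of_real pi * (f $ n * of_real r ^ n)"
proof -
  define a where "a m t = indicator {-pi..pi} t *\<^sub>R
      (f $ m * of_real r ^ m * (cis (real m * t) * cis (- (real n * t))))" for m and t :: real
  have sumf: "summable (\<lambda>m. norm (f $ m * of_real r ^ m))"
    using r by (intro norm_summable_fps) auto
  have na: "norm (a m t) = indicator {-pi..pi} t * norm (f $ m * of_real r ^ m)" for m t
    by (simp add: a_def norm_mult norm_power indicator_def)
  have int_a: "integrable lborel (a m)" for m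
    unfolding a_def by (intro borel_integrable_compact continuous_intros compact_Icc)
  have int_na: "(LINT t|lborel. norm (a m t)) = 2 * pi * norm (f $ m * of_real r ^ m)" for m
    unfolding na by simp
  have sum_a: "(\<Sum>m. a m t) = indicator {-pi..pi} t *\<^sub>R
      (eval_fps f (of_real r * cis t) * cis (- (real n * t)))" for t
  proof -
    have "(\<lambda>m. f $ m * (of_real r * cis t) ^ m) sums eval_fps f (of_real r * cis t)"
      using r by (intro sums_eval_fps) (simp add: norm_mult)
    then have "(\<lambda>m. indicator {-pi..pi} t *\<^sub>R (f $ m * (of_real r * cis t) ^ m * cis (- (real n * t)))) sums
       (indicator {-pi..pi} t *\<^sub>R (eval_fps f (of_real r * cis t) * cis (- (real n * t))))"
      by (intro sums_scaleR_right sums_mult2)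
    then show ?thesis
      by (intro sums_unique[symmetric]) (simp add: a_def power_mult_distrib Complex.DeMoivre mult.assoc)
  qed
  have "(LINT t|lborel. (\<Sum>m. a m t)) = (\<Sum>m. LINT t|lborel. a m t)"
  proof (rule integral_suminf)
    show "AE t in lborel. summable (\<lambda>m. norm (a m t))"
      unfolding na using sumf by (intro AE_I2 summable_mult)
    show "summable (\<lambda>m. LINT t|lborel. norm (a m t))"
      unfolding int_na using sumf by (intro summable_mult)
  qed (rule int_a)
  also have "(\<lambda>m. LINT t|lborel. a m t) =
      (\<lambda>m. if m = n then 2 * of_real pi * (f $ n * of_real r ^ n) else 0)"
  proof
    fix m
    have "(LINT t|lborel. a m t) = (f $ m * of_real r ^ m) *
        (LINT t|lborel. indicator {-pi..pi} t *\<^sub>R (cis (real m * t) * cis (- (real n * t))))"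
      unfolding a_def by (subst integral_mult_right_zero[symmetric]) simp
    then show "(LINT t|lborel. a m t) = (if m = n then 2 * of_real pi * (f $ n * of_real r ^ n) else 0)"
      unfolding integral_cis_period by simp
  qed
  also have "(\<Sum>m. if m = n then 2 * of_real pi * (f $ n * of_real r ^ n) else 0) =
      2 * of_real pi * (f $ n * of_real r ^ n)"
    by (subst suminf_finite[of "{n}"]) auto
  finally show ?thesis by (simp only: sum_a)
qed

text \<open>A quadratic bound on the whole period gives one Gaussian majorant for all
  \<open>n\<close>. For \<open>\<bar>t\<bar> \<le> 3\<close> the fourth-order Taylor bound gives
  1/8, because t^4/24 is at most 3 t^2/8. Beyond 3 the cosine is already nonpositive, and the weaker
  constant 1/16 keeps the right-hand side nonnegative up to 4, hence up to \<pi>.\<close>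

lemma cos_le_quadratic:
  assumes "\<bar>t\<bar> \<le> pi"
  shows "cos t \<le> 1 - t\<^sup>2 / 16"
proof -
  have small: "cos x \<le> 1 - x\<^sup>2 / 8" if "\<bar>x\<bar> \<le> 3" for x :: real
  proof -
    obtain s where s: "cos x = (\<Sum>m<4. cos_coeff m * x ^ m) + cos (s + 1/2 * real 4 * pi) / fact 4 * x ^ 4"
      using Maclaurin_cos_expansion[of x 4] by blast
    have "cos (s + 1/2 * real 4 * pi) / fact 4 * x ^ 4 \<le> 1 / fact 4 * x ^ 4"
      by (intro mult_right_mono divide_right_mono) auto
    moreover have "(\<Sum>m<4. cos_coeff m * x ^ m) = 1 - x\<^sup>2 / 2"
      by (simp add: eval_nat_numeral cos_coeff_Suc sin_coeff_Suc)
    moreover have "x ^ 4 \<le> 9 * x\<^sup>2"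
    proof -
      have "x\<^sup>2 \<le> 3\<^sup>2" using that abs_le_square_iff[of x 3] by simp
      then have "x\<^sup>2 * x\<^sup>2 \<le> 9 * x\<^sup>2" by (intro mult_right_mono) auto
      then show ?thesis by (simp add: eval_nat_numeral algebra_simps)
    qed
    ultimately show ?thesis using s by (simp add: fact_numeral)
  qed
  show ?thesis
  proof (cases "\<bar>t\<bar> \<le> 3")
    case True
    then show ?thesis using small[of t] zero_le_power2[of t] by linarith
  next
    case False
    have "cos t = cos \<bar>t\<bar>" by simp
    also have "\<dots> \<le> cos 3" using False assms by (intro cos_monotone_0_pi_le) auto
    also have "\<dots> \<le> 0" using small[of 3] by simp
    also have "0 \<le> 1 - t\<^sup>2 / 16"
    proof -
      have "\<bar>t\<bar> \<le> \<bar>4\<bar>" using assms pi_less_4 by linarith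
      then have "t\<^sup>2 \<le> 4\<^sup>2" by (simp only: abs_le_square_iff)
      then show ?thesis by simp
    qed
    finally show ?thesis .
  qed
qed

text \<open>Here \<open>\<beta>\<close> stands for the coefficients of B', so that
  \<open>critical\<close> reads \<tau> B''(\<tau>) = 1: the step has mean 1. The condition
  \<open>\<beta> 1 > 0\<close> gives aperiodicity.\<close>

locale critical_series =
  fixes \<beta> :: "nat \<Rightarrow> real" and \<tau> :: real
  assumes \<beta>_nonneg: "\<beta> k \<ge> 0" and \<beta>1: "\<beta> 1 > 0" and \<tau>_pos: "\<tau> > 0"
    and radius: "ereal \<tau> < conv_radius \<beta>"
    and critical: "(\<lambda>k. real k * \<beta> k * \<tau> ^ k) sums 1"
begin

section \<open>The characteristic function of the step\<close>

definition step_series :: "complex fps" where "step_series = Abs_fps (\<lambda>k. of_real (\<beta> k))"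

lemma radius_step_series: "ereal \<tau> < fps_conv_radius step_series"
proof -
  have "fps_conv_radius step_series = conv_radius \<beta>"
    unfolding fps_conv_radius_def conv_radius_def step_series_def by simp
  then show ?thesis using radius by simp
qed

text \<open>The logarithm of the characteristic function of the step minus its mean 1. It is written
  down directly from the exponent B', so no branch of the complex logarithm has to be
  chosen.\<close>

definition L :: "real \<Rightarrow> complex" where
  "L t = eval_fps step_series (of_real \<tau> * cis t) - eval_fps step_series (of_real \<tau>) - \<i> * of_real t"

lemma summable_\<beta>: "summable (\<lambda>k. \<beta> k * \<tau> ^ k)"
  using radius \<tau>_pos by (intro summable_in_conv_radius) auto

lemma summable_\<beta>2: "summable (\<lambda>k. (real k)\<^sup>2 * (\<beta> k * \<tau> ^ k))"
proof -
  define f where "f = fps_X * fps_deriv (fps_X * fps_deriv (Abs_fps \<beta>))"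
  have "fps_conv_radius (Abs_fps \<beta>) \<le> fps_conv_radius f"
    unfolding f_def
    by (intro order.trans[OF _ fps_conv_radius_mult_ge] order.trans[OF _ fps_conv_radius_deriv]) auto
  moreover have "ereal \<tau> < fps_conv_radius (Abs_fps \<beta>)"
    using radius by (simp add: fps_conv_radius_def)
  ultimately have "summable (\<lambda>k. f $ k * \<tau> ^ k)"
    using \<tau>_pos by (intro summable_fps) auto
  also have "(\<lambda>k. f $ k * \<tau> ^ k) = (\<lambda>k. (real k)\<^sup>2 * (\<beta> k * \<tau> ^ k))"
  proof
    fix k show "f $ k * \<tau> ^ k = (real k)\<^sup>2 * (\<beta> k * \<tau> ^ k)"
      by (cases k) (simp_all add: f_def power2_eq_square algebra_simps)
  qed
  finally show ?thesis .
qed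

text \<open>By \<open>critical\<close> the linear term can be distributed over the summands. Each of
  them becomes a second-order Taylor remainder, for which quadratic estimates hold one by
  one.\<close>

lemma L_sums: "(\<lambda>k. of_real (\<beta> k * \<tau> ^ k) * (cis (real k * t) - 1 - \<i> * of_real (real k * t))) sums L t"
proof -
  have "(\<lambda>k. step_series $ k * (of_real \<tau> * cis t) ^ k) sums eval_fps step_series (of_real \<tau> * cis t)"
    "(\<lambda>k. step_series $ k * (of_real \<tau>) ^ k) sums eval_fps step_series (of_real \<tau>)"
    using radius_step_series \<tau>_pos by (intro sums_eval_fps; simp add: norm_mult)+
  moreover have "(\<lambda>k. \<i> * of_real t * of_real (real k * \<beta> k * \<tau> ^ k)) sums (\<i> * of_real t * of_real 1)"
    by (intro sums_mult sums_of_real critical)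
  ultimately have "(\<lambda>k. step_series $ k * (of_real \<tau> * cis t) ^ k - step_series $ k * (of_real \<tau>) ^ k -
      \<i> * of_real t * of_real (real k * \<beta> k * \<tau> ^ k)) sums L t"
    unfolding L_def by (intro sums_diff) simp_all
  then show ?thesis
    by (simp add: step_series_def power_mult_distrib Complex.DeMoivre algebra_simps)
qed

text \<open>All summands have nonpositive real part, so the one with \<open>k = 1\<close> alone
  forces decay, and it does so on the whole period: this is aperiodicity in quantitative
  form.\<close>

lemma Re_L_le:
  assumes "\<bar>t\<bar> \<le> pi"
  shows "Re (L t) \<le> - (\<beta> 1 * \<tau> / 16) * t\<^sup>2"
proof -
  have "(\<lambda>k. Re (of_real (\<beta> k * \<tau> ^ k) * (cis (real k * t) - 1 - \<i> * of_real (real k * t)))) sums Re (L t)"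
    by (rule sums_Re[OF L_sums])
  then have s: "(\<lambda>k. - (\<beta> k * \<tau> ^ k * (cos (real k * t) - 1))) sums (- Re (L t))"
    by (intro sums_minus) simp
  have nn: "0 \<le> - (\<beta> k * \<tau> ^ k * (cos (real k * t) - 1))" for k
    using \<beta>_nonneg[of k] \<tau>_pos by (simp add: mult_nonneg_nonpos)
  have "(\<Sum>k\<in>{1}. - (\<beta> k * \<tau> ^ k * (cos (real k * t) - 1))) \<le> - Re (L t)"
    using s nn sum_le_suminf[of "\<lambda>k. - (\<beta> k * \<tau> ^ k * (cos (real k * t) - 1))" "{1}"]
    by (auto simp: sums_iff)
  then have "Re (L t) \<le> \<beta> 1 * \<tau> * (cos t - 1)" by simp
  also have "\<dots> \<le> \<beta> 1 * \<tau> * (- t\<^sup>2 / 16)"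
    using cos_le_quadratic[OF assms] \<beta>1 \<tau>_pos by (intro mult_left_mono) auto
  finally show ?thesis by simp
qed

text \<open>A compound Poisson law with intensities \<beta>_k \<tau>^k has the second moment of the
  intensities as its variance; no squared mean is subtracted.\<close>

definition variance :: real where "variance = (\<Sum>k. (real k)\<^sup>2 * (\<beta> k * \<tau> ^ k))"

lemma variance_pos: "variance > 0"
  unfolding variance_def
  using \<beta>_nonneg \<beta>1 \<tau>_pos by (intro suminf_pos2[where i = 1] summable_\<beta>2) auto

lemma cis_second_order:
  "((\<lambda>t. (cis (a * t) - 1 - \<i> * of_real (a * t)) / of_real (t\<^sup>2)) \<longlongrightarrow> of_real (- a\<^sup>2 / 2)) (at 0)"
proof -
  have "((\<lambda>t. (cos (a * t) - 1) / t\<^sup>2) \<longlongrightarrow> - a\<^sup>2 / 2) (at 0)"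
    "((\<lambda>t. (sin (a * t) - a * t) / t\<^sup>2) \<longlongrightarrow> 0) (at 0)"
    by (real_asymp simp: power2_eq_square)+
  then show ?thesis
    by (simp add: tendsto_complex_iff Re_divide_of_real Im_divide_of_real del: of_real_power)
qed

text \<open>Tannery's theorem allows the limit under the sum: |e^(ix) - 1 - ix| \<le> x^2/2
  dominates the quotients by the summands of the variance, uniformly in \<open>t\<close>.\<close>

lemma L_second_order: "((\<lambda>t. L t / of_real (t\<^sup>2)) \<longlongrightarrow> of_real (- variance / 2)) (at 0)"
proof -
  define a where "a k t = of_real (\<beta> k * \<tau> ^ k) *
      ((cis (real k * t) - 1 - \<i> * of_real (real k * t)) / of_real (t\<^sup>2))" for k t
  define c where "c k = complex_of_real (\<beta> k * \<tau> ^ k) * of_real (- (real k)\<^sup>2 / 2)" for k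
  have "((\<lambda>t. \<Sum>k. a k t) \<longlongrightarrow> (\<Sum>k. c k)) (at 0)"
  proof (rule tannerys_theorem[THEN conjunct2, THEN conjunct2])
    show "((\<lambda>t. a k t) \<longlongrightarrow> c k) (at 0)" for k
      unfolding a_def c_def by (intro tendsto_mult tendsto_const cis_second_order)
    show "summable (\<lambda>k. (real k)\<^sup>2 * (\<beta> k * \<tau> ^ k))" by (rule summable_\<beta>2)
    have "norm (a k t) \<le> (real k)\<^sup>2 * (\<beta> k * \<tau> ^ k)" for k t
    proof (cases "t = 0")
      case False
      have "norm (cis (real k * t) - 1 - \<i> * of_real (real k * t)) \<le> (real k * t)\<^sup>2 / 2"
        using iexp_approx1[of "real k * t" 1] by (simp add: cis_conv_exp diff_diff_eq numeral_2_eq_2)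
      then have "norm (cis (real k * t) - 1 - \<i> * of_real (real k * t)) / t\<^sup>2 \<le> (real k * t)\<^sup>2 / 2 / t\<^sup>2"
        by (rule divide_right_mono) simp
      then have "norm (a k t) \<le> \<beta> k * \<tau> ^ k * ((real k * t)\<^sup>2 / 2 / t\<^sup>2)"
        unfolding a_def norm_mult norm_divide using \<beta>_nonneg[of k] \<tau>_pos
        by (intro mult_mono) (auto simp: norm_mult norm_power simp flip: of_real_power)
      also have "\<dots> = (real k)\<^sup>2 * (\<beta> k * \<tau> ^ k) / 2"
        using False by (simp add: power_mult_distrib)
      also have "\<dots> \<le> (real k)\<^sup>2 * (\<beta> k * \<tau> ^ k)"
        using \<beta>_nonneg[of k] \<tau>_pos by simp
      finally show ?thesis .
    qed (use \<beta>_nonneg[of k] \<tau>_pos in \<open>simp add: a_def\<close>)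
    then show "\<forall>\<^sub>F (k, t) in at_top \<times>\<^sub>F at 0. norm (a k t) \<le> (real k)\<^sup>2 * (\<beta> k * \<tau> ^ k)"
      by (intro always_eventually) auto
  qed simp
  moreover have "(\<lambda>k. a k t) sums (L t / of_real (t\<^sup>2))" for t
    using sums_divide[OF L_sums[of t], of "of_real (t\<^sup>2)"] by (simp add: a_def)
  then have "(\<lambda>t. \<Sum>k. a k t) = (\<lambda>t. L t / of_real (t\<^sup>2))"
    by (intro ext sums_unique[symmetric])
  moreover have "c sums of_real (- variance / 2)"
  proof -
    have "(\<lambda>k. of_real (- 1 / 2 * ((real k)\<^sup>2 * (\<beta> k * \<tau> ^ k)))) sums (of_real (- 1 / 2 * variance) :: complex)"
      unfolding variance_def by (intro sums_of_real sums_mult summable_sums summable_\<beta>2)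
    also have "(\<lambda>k. of_real (- 1 / 2 * ((real k)\<^sup>2 * (\<beta> k * \<tau> ^ k)))) = c"
      by (simp add: c_def fun_eq_iff)
    finally show ?thesis by simp
  qed
  then have "(\<Sum>k. c k) = of_real (- variance / 2)" by (intro sums_unique[symmetric])
  ultimately show ?thesis by simp
qed

lemma L_scaled: "(\<lambda>n. of_nat n * L (s / sqrt (real n))) \<longlonglongrightarrow> of_real (- variance / 2 * s\<^sup>2)"
proof (cases "s = 0")
  case True
  have "L 0 = 0" by (simp add: L_def)
  then show ?thesis using True by simp
next
  case False
  have "filterlim (\<lambda>n. s / sqrt (real n)) (at 0) sequentially"
    unfolding filterlim_at using False
    by (intro conjI eventually_mono[OF eventually_gt_at_top[of 0]]) (simp_all, real_asymp)
  from filterlim_compose[OF L_second_order this]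
  have "(\<lambda>n. of_real (s\<^sup>2) * (L (s / sqrt (real n)) / of_real ((s / sqrt (real n))\<^sup>2)))
     \<longlonglongrightarrow> of_real (s\<^sup>2) * of_real (- variance / 2)"
    by (intro tendsto_mult tendsto_const)
  moreover have "\<forall>\<^sub>F n in sequentially. of_real (s\<^sup>2) * (L (s / sqrt (real n)) / of_real ((s / sqrt (real n))\<^sup>2))
      = of_nat n * L (s / sqrt (real n))"
    using eventually_gt_at_top[of 0]
    by eventually_elim (use False in \<open>simp add: power_divide flip: of_real_power\<close>)
  ultimately show ?thesis
    by (subst (asm) tendsto_cong) (auto simp: mult_ac)
qed

text \<open>Equal to 1 / sqrt (2 \<pi> variance), the value at its centre of the limiting normal
  density. Only its positivity matters, since it cancels from quotients of coefficients.\<close>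

definition gauss_const :: real where
  "gauss_const = (LINT s|lborel. exp (- variance / 2 * s\<^sup>2)) / (2 * pi)"

lemma integrable_gauss:
  assumes "c > 0"
  shows "integrable lborel (\<lambda>s::real. exp (- c * s\<^sup>2))"
    and "(LINT s|lborel. exp (- c * s\<^sup>2)) = sqrt (pi / c)"
proof -
  define \<sigma> where "\<sigma> = sqrt (1 / (2 * c))"
  have \<sigma>: "\<sigma> > 0" "\<sigma>\<^sup>2 = 1 / (2 * c)" using assms by (simp_all add: \<sigma>_def)
  have eq: "exp (- c * s\<^sup>2) = sqrt (pi / c) * normal_density 0 \<sigma> s" for s
    unfolding normal_density_def \<sigma>(2) using assms by (simp add: field_simps real_sqrt_divide)
  show "integrable lborel (\<lambda>s::real. exp (- c * s\<^sup>2))"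
    unfolding eq using \<sigma>(1) by simp
  show "(LINT s|lborel. exp (- c * s\<^sup>2)) = sqrt (pi / c)"
    unfolding eq using \<sigma>(1) by simp
qed

lemma gauss_const_pos: "gauss_const > 0"
  unfolding gauss_const_def using integrable_gauss(2)[of "variance / 2"] variance_pos by simp

text \<open>A local limit theorem in disguise: \<open>\<phi>(\<tau>z) / \<phi>(\<tau>)\<close> is the probability generating
  function of a step of mean 1, and the left-hand side is a weighted average of the point
  probabilities near \<open>n - 1\<close> of the sum of \<open>n\<close> steps.\<close>
theorem power_coeff_asymptotics:
  fixes \<phi> g :: "complex fps"
  assumes \<phi>: "ereal \<tau> < fps_conv_radius \<phi>"
    "\<And>z. norm z \<le> \<tau> \<Longrightarrow> eval_fps \<phi> z = exp (eval_fps step_series z)"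
    and g: "ereal \<tau> < fps_conv_radius g"
  shows "(\<lambda>n. of_real (sqrt (real n)) * ((g * \<phi> ^ n) $ (n - 1) * of_real \<tau> ^ (n - 1) / exp (eval_fps step_series (of_real \<tau>)) ^ n))
           \<longlonglongrightarrow> eval_fps g (of_real \<tau>) * of_real gauss_const"
proof -
  \<comment> \<open>For \<open>n = 0\<close> the quotient \<open>s / sqrt (real n)\<close> is 0 by
    convention, and \<open>h 0\<close> would contribute a constant function of \<open>s\<close> with
    no integrable majorant. The empty indicator makes it vanish.\<close>
  define h where "h n t = indicator (if n = 0 then {} else {-pi..pi}) t *\<^sub>R
      (eval_fps g (of_real \<tau> * cis t) * cis t * exp (of_nat n * L t))" for n and t :: real
  define M where "M = (\<Sum>k. norm (g $ k) * \<tau> ^ k)"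
  define c where "c = \<beta> 1 * \<tau> / 16"
  have c_pos: "c > 0" using \<beta>1 \<tau>_pos by (simp add: c_def)
  have norm_cis: "norm (of_real \<tau> * cis t) = \<tau>" for t
    using \<tau>_pos by (simp add: norm_mult)
  have M: "norm (eval_fps g (of_real \<tau> * cis t)) \<le> M" for t
  proof -
    have s: "summable (\<lambda>k. norm (g $ k * (of_real \<tau> * cis t) ^ k))"
      using g norm_cis by (intro norm_summable_fps) simp
    have "norm (eval_fps g (of_real \<tau> * cis t)) \<le> (\<Sum>k. norm (g $ k * (of_real \<tau> * cis t) ^ k))"
      unfolding eval_fps_def by (rule summable_norm[OF s])
    also have "\<dots> = M" using norm_cis by (simp add: M_def norm_mult norm_power flip: power_mult_distrib)
    finally show ?thesis .
  qed
  have coeff: "of_real (sqrt (real n)) * ((g * \<phi> ^ n) $ (n - 1) * of_real \<tau> ^ (n - 1) / exp (eval_fps step_series (of_real \<tau>)) ^ n)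
      = (LINT s|lborel. h n (s / sqrt (real n))) / of_real (2 * pi)" if n: "n > 0" for n
  proof -
    have r\<phi>: "ereal \<tau> < fps_conv_radius (\<phi> ^ n)"
      by (rule less_le_trans[OF \<phi>(1) fps_conv_radius_power])
    have rg: "ereal \<tau> < fps_conv_radius (g * \<phi> ^ n)"
      by (rule less_le_trans[OF _ fps_conv_radius_mult]) (use g r\<phi> in auto)
    \<comment> \<open>The index \<open>n - 1\<close> in place of \<open>n\<close> leaves the extra
      factor \<open>cis t\<close>, which tends to 1 after rescaling. The mean 1 of the step cancels
      the remaining oscillation into \<open>L\<close>.\<close>
    have eval: "eval_fps (g * \<phi> ^ n) (of_real \<tau> * cis t) * cis (- (real (n - 1) * t))
      = exp (eval_fps step_series (of_real \<tau>)) ^ n *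
        (eval_fps g (of_real \<tau> * cis t) * cis t * exp (of_nat n * L t))" for t
    proof -
      have "eval_fps (g * \<phi> ^ n) (of_real \<tau> * cis t) =
          eval_fps g (of_real \<tau> * cis t) * exp (eval_fps step_series (of_real \<tau> * cis t)) ^ n"
        using g r\<phi> \<phi> norm_cis \<tau>_pos by (simp add: eval_fps_mult eval_fps_power)
      moreover have "exp (eval_fps step_series (of_real \<tau> * cis t)) ^ n * cis (- (real (n - 1) * t)) =
          exp (eval_fps step_series (of_real \<tau>)) ^ n * (cis t * exp (of_nat n * L t))"
        using n unfolding L_def cis_conv_exp
        by (simp add: of_nat_diff algebra_simps flip: exp_add exp_of_nat_mult)
      ultimately show ?thesis by (simp add: mult_ac)
    qed
    have "2 * of_real pi * ((g * \<phi> ^ n) $ (n - 1) * of_real \<tau> ^ (n - 1)) =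
       (LINT t|lborel. exp (eval_fps step_series (of_real \<tau>)) ^ n * h n t)"
      using fps_nth_integral[OF _ rg, of "n - 1"] \<tau>_pos n unfolding eval h_def by simp
    also have "\<dots> = exp (eval_fps step_series (of_real \<tau>)) ^ n * (LINT t|lborel. h n t)"
      by (rule integral_mult_right_zero)
    also have "(LINT t|lborel. h n t) = (LINT s|lborel. h n (s / sqrt (real n))) / of_real (sqrt (real n))"
      using lborel_integral_real_affine[of "1 / sqrt (real n)" "h n" 0] n
      by (simp add: scaleR_conv_of_real divide_simps mult.commute)
    finally show ?thesis using n by (simp add: field_simps)
  qed
  have "(\<lambda>n. LINT s|lborel. h n (s / sqrt (real n))) \<longlonglongrightarrow>
      (LINT s|lborel. eval_fps g (of_real \<tau>) * of_real (exp (- variance / 2 * s\<^sup>2)))"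
  proof (rule integral_dominated_convergence)
    show "integrable lborel (\<lambda>s::real. M * exp (- c * s\<^sup>2))"
      by (intro integrable_mult_right integrable_gauss c_pos)
    show "(\<lambda>s. eval_fps g (of_real \<tau>) * of_real (exp (- variance / 2 * s\<^sup>2))) \<in> borel_measurable lborel"
      by simp
    have contL: "continuous_on UNIV L"
      unfolding L_def using radius_step_series norm_cis by (intro continuous_intros) auto
    have "continuous_on UNIV (\<lambda>t. eval_fps g (of_real \<tau> * cis t))"
      using g norm_cis by (intro continuous_intros) auto
    note [measurable] = borel_measurable_continuous_onI[OF contL] borel_measurable_continuous_onI[OF this]
      borel_measurable_continuous_onI[OF continuous_on_cis[OF continuous_on_id]]
    have [measurable]: "h n \<in> borel_measurable borel" for n
      unfolding h_def by measurable
    show "(\<lambda>s. h n (s / sqrt (real n))) \<in> borel_measurable lborel" for n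
      by measurable
    show "AE s in lborel. (\<lambda>n. h n (s / sqrt (real n))) \<longlonglongrightarrow>
        eval_fps g (of_real \<tau>) * of_real (exp (- variance / 2 * s\<^sup>2))"
    proof (rule AE_I2)
      fix s :: real
      have t: "(\<lambda>n. s / sqrt (real n)) \<longlonglongrightarrow> 0" by real_asymp
      have "(\<lambda>n. eval_fps g (of_real \<tau> * cis (s / sqrt (real n))) * cis (s / sqrt (real n)) *
          exp (of_nat n * L (s / sqrt (real n)))) \<longlonglongrightarrow>
          eval_fps g (of_real \<tau> * cis 0) * cis 0 * exp (of_real (- variance / 2 * s\<^sup>2))"
      proof (intro tendsto_mult tendsto_exp L_scaled)
        have "isCont (\<lambda>t. eval_fps g (of_real \<tau> * cis t)) 0"
          using \<open>continuous_on UNIV (\<lambda>t. eval_fps g (of_real \<tau> * cis t))\<close>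
          by (simp add: continuous_on_eq_continuous_at)
        from isCont_tendsto_compose[OF this t]
        show "(\<lambda>n. eval_fps g (of_real \<tau> * cis (s / sqrt (real n)))) \<longlonglongrightarrow> eval_fps g (of_real \<tau> * cis 0)" .
        show "(\<lambda>n. cis (s / sqrt (real n))) \<longlonglongrightarrow> cis 0"
          by (intro tendsto_cis t)
      qed
      moreover have "\<forall>\<^sub>F n in sequentially. - pi < s / sqrt (real n) \<and> s / sqrt (real n) < pi"
        using order_tendstoD(1)[OF t, of "-pi"] order_tendstoD(2)[OF t, of pi] by (auto intro: eventually_conj)
      then have "\<forall>\<^sub>F n in sequentially. eval_fps g (of_real \<tau> * cis (s / sqrt (real n))) * cis (s / sqrt (real n)) *
          exp (of_nat n * L (s / sqrt (real n))) = h n (s / sqrt (real n))"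
        using eventually_gt_at_top[of 0]
        by eventually_elim (auto simp: h_def indicator_def)
      ultimately show "(\<lambda>n. h n (s / sqrt (real n))) \<longlonglongrightarrow>
        eval_fps g (of_real \<tau>) * of_real (exp (- variance / 2 * s\<^sup>2))"
        by (subst (asm) tendsto_cong) (auto simp flip: exp_of_real)
    qed
    show "AE s in lborel. norm (h n (s / sqrt (real n))) \<le> M * exp (- c * s\<^sup>2)" for n
    proof (rule AE_I2)
      fix s :: real
      have M0: "M \<ge> 0" using M[of 0] norm_ge_zero order.trans by blast
      show "norm (h n (s / sqrt (real n))) \<le> M * exp (- c * s\<^sup>2)"
      proof (cases "\<bar>s / sqrt (real n)\<bar> \<le> pi \<and> n > 0")
        case True
        define t where "t = s / sqrt (real n)"
        have "real n * Re (L t) \<le> real n * (- c * t\<^sup>2)"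
          using Re_L_le[of t] True by (intro mult_left_mono) (auto simp: t_def c_def)
        also have "\<dots> = - c * s\<^sup>2" using True by (simp add: t_def power_divide)
        finally have "exp (real n * Re (L t)) \<le> exp (- c * s\<^sup>2)" by simp
        then have "norm (eval_fps g (of_real \<tau> * cis t)) * exp (real n * Re (L t)) \<le> M * exp (- c * s\<^sup>2)"
          by (intro mult_mono M M0) auto
        then show ?thesis using True M0
          by (auto simp: h_def t_def norm_mult indicator_def)
      next
        case False
        then have "h n (s / sqrt (real n)) = 0" by (auto simp: h_def indicator_def abs_le_iff)
        then show ?thesis using M0 by simp
      qed
    qed
  qed
  then have "(\<lambda>n. (LINT s|lborel. h n (s / sqrt (real n))) / of_real (2 * pi)) \<longlonglongrightarrow>
      (LINT s|lborel. eval_fps g (of_real \<tau>) * of_real (exp (- variance / 2 * s\<^sup>2))) / of_real (2 * pi)"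
    by (intro tendsto_divide tendsto_const) auto
  also have "(LINT s|lborel. eval_fps g (of_real \<tau>) * complex_of_real (exp (- variance / 2 * s\<^sup>2))) / of_real (2 * pi) =
      eval_fps g (of_real \<tau>) * of_real gauss_const"
    by (simp add: gauss_const_def integral_complex_of_real)
  finally show ?thesis
    by (rule Lim_transform_eventually)
      (use eventually_gt_at_top[of 0] in \<open>eventually_elim, use coeff in simp\<close>)
qed

end

section \<open>Transfer from dented domains\<close>

text \<open>This trades the discontinuous \<open>Arg\<close> for continuous functions, which yields
  openness and elementary estimates. The vertex needs no separate exclusion: both sides of the
  strict inequality are 0 there.\<close>

lemma dented_domain_eq:
  assumes "0 < \<phi>" "\<phi> < pi / 2"
  shows "dented_domain R R' \<phi> =
    {z. norm z < R' \<and> Re (z - of_real R) < cos \<phi> * norm (z - of_real R)}"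
proof -
  have "z \<noteq> of_real R \<and> \<phi> < \<bar>Arg (z - of_real R)\<bar> \<longleftrightarrow>
      Re (z - of_real R) < cos \<phi> * norm (z - of_real R)" for z
  proof (cases "z = of_real R")
    case False
    define u where "u = z - of_real R"
    have u: "u \<noteq> 0" using False by (simp add: u_def)
    have "Re u = norm u * cos (Arg u)"
      using u by (metis Re_rcis rcis_cmod_Arg)
    then have "Re u < cos \<phi> * norm u \<longleftrightarrow> cos \<bar>Arg u\<bar> < cos \<phi>"
      using u by (simp add: mult.commute)
    also have "\<dots> \<longleftrightarrow> \<phi> < \<bar>Arg u\<bar>"
      using assms Arg_le_pi[of u] mpi_less_Arg[of u] by (intro cos_mono_less_eq) auto
    finally show ?thesis using False by (simp add: u_def)
  qed simp
  then show ?thesis by (auto simp: dented_domain_def)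
qed

lemma open_dented_domain:
  assumes "0 < \<phi>" "\<phi> < pi / 2"
  shows "open (dented_domain R R' \<phi>)"
  unfolding dented_domain_eq[OF assms]
  by (intro open_Collect_conj open_Collect_less continuous_intros)

lemma norm_le_imp_in_dented_domain:
  assumes "0 < \<phi>" "\<phi> < pi / 2" "R < R'" "norm z \<le> R" "z \<noteq> of_real R"
  shows "z \<in> dented_domain R R' \<phi>"
proof -
  have "Re z \<le> R" using assms(4) complex_Re_le_cmod order.trans by blast
  moreover have "0 < cos \<phi> * norm (z - of_real R)"
    using assms by (intro mult_pos_pos cos_gt_zero) auto
  ultimately show ?thesis using assms by (auto simp: dented_domain_eq)
qed

text \<open>Let d be the distance of \<open>z\<close> to R. In the closed disc the real part of z -
  R is nonpositive, so within the small ball the real part of w - R is at most cos \<phi> d/3, while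
  |w - R| is at least 2d/3. This is the reason for the factor 1/3. The bound on 2d keeps |w| below
  \<open>R'\<close>.\<close>

lemma cball_subset_dented_domain:
  assumes \<phi>: "0 < \<phi>" "\<phi> < pi / 2" and z: "norm z \<le> R" "z \<noteq> of_real R" "2 * norm (z - of_real R) < R' - R"
  shows "cball z (cos \<phi> / 3 * norm (z - of_real R)) \<subseteq> dented_domain R R' \<phi>"
proof
  fix w assume w: "w \<in> cball z (cos \<phi> / 3 * norm (z - of_real R))"
  define d where "d = norm (z - of_real R)"
  have d: "d > 0" using z by (simp add: d_def)
  have c: "0 < cos \<phi>" "cos \<phi> \<le> 1" using \<phi> by (auto intro: cos_gt_zero)
  have wz: "norm (w - z) \<le> cos \<phi> / 3 * d" using w by (simp add: d_def dist_norm norm_minus_commute)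
  also have "\<dots> \<le> 1 / 3 * d" using c d by (intro mult_right_mono) auto
  finally have wz': "norm (w - z) \<le> d / 3" by simp
  have "Re (w - of_real R) = Re (z - of_real R) + Re (w - z)" by simp
  also have "Re (z - of_real R) \<le> 0"
    using z(1) complex_Re_le_cmod[of z] by simp
  also have "Re (w - z) \<le> cos \<phi> / 3 * d" using wz complex_Re_le_cmod order.trans by blast
  also have "0 + cos \<phi> / 3 * d < cos \<phi> * (2 / 3 * d)" using c d by simp
  also have "\<dots> \<le> cos \<phi> * norm (w - of_real R)"
  proof (intro mult_left_mono)
    have "d \<le> norm (w - of_real R) + norm (w - z)"
      unfolding d_def by norm
    then show "2 / 3 * d \<le> norm (w - of_real R)" using wz' by simp
  qed (use c in simp)
  finally have "Re (w - of_real R) < cos \<phi> * norm (w - of_real R)" by simp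
  moreover have "norm w < R'"
  proof -
    have "norm w \<le> norm z + norm (w - z)" by norm
    then show ?thesis using wz' z d unfolding d_def by linarith
  qed
  ultimately show "w \<in> dented_domain R R' \<phi>" using \<phi> by (simp add: dented_domain_eq)
qed

text \<open>Cauchy's estimates on discs of radius proportional to the distance to the singularity.\<close>
lemma higher_deriv_bound_dented_domain:
  fixes G :: "complex \<Rightarrow> complex"
  assumes R: "0 < R" "R < R'" and \<phi>: "0 < \<phi>" "\<phi> < pi / 2"
    and holo: "G holomorphic_on dented_domain R R' \<phi>"
    and bigo: "G \<in> O[at (of_real R) within dented_domain R R' \<phi>](\<lambda>x. (1 - x / of_real R) ^ M)"
  obtains K where "\<And>z. norm z < R \<Longrightarrow> norm ((deriv ^^ (M + 2)) G z) \<le> K / norm (1 - z / of_real R) ^ 2"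
proof -
  define D where "D = dented_domain R R' \<phi>"
  have opD: "open D" unfolding D_def by (rule open_dented_domain[OF \<phi>])
  have nrm: "norm (1 - z / of_real R) = norm (z - of_real R) / R" for z :: complex
  proof -
    have "1 - z / of_real R = - (z - of_real R) / of_real R" using R by (simp add: field_simps)
    then show ?thesis using R by (simp only: norm_divide norm_minus_cancel) simp
  qed
  obtain C where C: "C > 0" "\<forall>\<^sub>F x in at (of_real R) within D. norm (G x) \<le> C * norm ((1 - x / of_real R) ^ M)"
    using bigo unfolding D_def by (auto elim: landau_o.bigE)
  then obtain \<delta> where \<delta>: "\<delta> > 0" "\<And>x. x \<in> D \<Longrightarrow> x \<noteq> of_real R \<Longrightarrow> dist x (of_real R) < \<delta> \<Longrightarrow>
      norm (G x) \<le> C * norm ((1 - x / of_real R) ^ M)"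
    unfolding eventually_at by blast
  define \<epsilon> where "\<epsilon> = min (\<delta> / 2) ((R' - R) / 2)"
  have \<epsilon>: "\<epsilon> > 0" using \<delta> R by (simp add: \<epsilon>_def)
  define c where "c = cos \<phi> / 3"
  have c: "0 < c" "c \<le> 1 / 3" using \<phi> cos_gt_zero[of \<phi>] by (auto simp: c_def)
  \<comment> \<open>In Cauchy's estimate the values contribute (2d/R)^M and the radius contributes
    (c d)^(-M-2). What remains is d^(-2), and passing from d to |1 - z/R| = d/R gives the last
    factor.\<close>
  define K1 where "K1 = fact (M + 2) * (C * (2 / R) ^ M) / (c ^ (M + 2)) / R\<^sup>2"
  have near: "norm ((deriv ^^ (M + 2)) G z) \<le> K1 / norm (1 - z / of_real R) ^ 2"
    if z: "norm z < R" "norm (z - of_real R) < \<epsilon>" for z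
  proof -
    define d where "d = norm (z - of_real R)"
    have d: "d > 0" using z by (auto simp: d_def)
    have sub: "cball z (c * d) \<subseteq> D"
      unfolding c_def d_def D_def using z by (intro cball_subset_dented_domain \<phi>) (auto simp: \<epsilon>_def)
    have "norm ((deriv ^^ (M + 2)) G z) \<le> fact (M + 2) * (C * (2 * d / R) ^ M) / (c * d) ^ (M + 2)"
    proof (rule Cauchy_inequality)
      show "G holomorphic_on ball z (c * d)"
        using holo sub ball_subset_cball unfolding D_def by (blast intro: holomorphic_on_subset)
      show "continuous_on (cball z (c * d)) G"
        using holo sub unfolding D_def by (blast intro: holomorphic_on_imp_continuous_on holomorphic_on_subset)
      show "0 < c * d" using c d by simp
      fix w assume w: "norm (z - w) = c * d"
      have "w \<in> D" using sub w by (auto simp: dist_norm)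
      have "c * d \<le> 1 / 3 * d" using c d by (intro mult_right_mono) auto
      moreover have "norm (w - of_real R) \<le> d + norm (z - w)" unfolding d_def by norm
      moreover have "d \<le> norm (w - of_real R) + norm (z - w)" unfolding d_def by norm
      ultimately have wR: "norm (w - of_real R) \<le> 2 * d" "norm (w - of_real R) > 0"
        using w d by linarith+
      have "norm (G w) \<le> C * norm ((1 - w / of_real R) ^ M)"
      proof (rule \<delta>(2)[OF \<open>w \<in> D\<close>])
        show "w \<noteq> of_real R" using wR by auto
        show "dist w (of_real R) < \<delta>" using wR z(2) by (simp add: dist_norm d_def \<epsilon>_def)
      qed
      also have "\<dots> \<le> C * (2 * d / R) ^ M"
        unfolding norm_power nrm using C R wR by (intro mult_left_mono power_mono divide_right_mono) auto
      finally show "norm (G w) \<le> C * (2 * d / R) ^ M" .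
    qed
    also have "\<dots> = K1 / norm (1 - z / of_real R) ^ 2"
      unfolding nrm K1_def using d R c unfolding d_def[symmetric]
      by (simp add: power_mult_distrib power_divide power_add power2_eq_square field_simps del: fact_Suc)
    finally show ?thesis .
  qed
  \<comment> \<open>Away from R the derivative is bounded by compactness, because the closed disc
    without a neighbourhood of R lies in the open domain. As |1 - z/R| \<le> 2 on the disc, the
    factor 4 brings this bound into the required form.\<close>
  define E where "E = cball 0 R - ball (of_real R :: complex) \<epsilon>"
  have "compact E" unfolding E_def by (intro compact_diff) auto
  moreover have "E \<subseteq> D"
    unfolding E_def D_def using \<epsilon> by (auto intro!: norm_le_imp_in_dented_domain \<phi> R)
  then have "continuous_on E ((deriv ^^ (M + 2)) G)"
    using holomorphic_higher_deriv[OF holo[folded D_def] opD]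
    by (blast intro: holomorphic_on_imp_continuous_on holomorphic_on_subset)
  ultimately have "bounded ((deriv ^^ (M + 2)) G ` E)"
    by (intro compact_imp_bounded compact_continuous_image)
  then obtain K2 where K2: "\<And>z. z \<in> E \<Longrightarrow> norm ((deriv ^^ (M + 2)) G z) \<le> K2" "K2 > 0"
    unfolding bounded_pos by auto
  show thesis
  proof (rule that)
    fix z :: complex assume z: "norm z < R"
    have pos: "norm (z - of_real R) > 0" using z by auto
    show "norm ((deriv ^^ (M + 2)) G z) \<le> max K1 (4 * K2) / norm (1 - z / of_real R) ^ 2"
    proof (cases "norm (z - of_real R) < \<epsilon>")
      case True
      have "K1 / norm (1 - z / of_real R) ^ 2 \<le> max K1 (4 * K2) / norm (1 - z / of_real R) ^ 2"
        by (intro divide_right_mono) auto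
      then show ?thesis using near[OF z True] by linarith
    next
      case False
      have "norm ((deriv ^^ (M + 2)) G z) \<le> K2"
        using False z by (intro K2) (auto simp: E_def dist_norm norm_minus_commute)
      also have "\<dots> \<le> 4 * K2 / norm (1 - z / of_real R) ^ 2"
      proof -
        have "norm (z - of_real R) \<le> norm z + norm (of_real R :: complex)" by (rule norm_triangle_ineq4)
        then have "norm (1 - z / of_real R) \<le> 2" unfolding nrm using R z by (simp add: field_simps)
        then have "norm (1 - z / of_real R) ^ 2 \<le> 2 ^ 2" by (intro power_mono) auto
        moreover have "norm (1 - z / of_real R) ^ 2 > 0" unfolding nrm using pos R by simp
        ultimately show ?thesis using K2 by (simp add: field_simps)
      qed
      also have "\<dots> \<le> max K1 (4 * K2) / norm (1 - z / of_real R) ^ 2"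
        by (intro divide_right_mono) auto
      finally show ?thesis .
    qed
  qed
qed

section \<open>From bounds on derivatives to bounds on coefficients\<close>

lemma higher_deriv_eval_fps:
  fixes f :: "complex fps"
  assumes "ereal (norm z) < fps_conv_radius f"
  shows "(deriv ^^ m) (eval_fps f) z = eval_fps ((fps_deriv ^^ m) f) z"
  using assms
proof (induction m arbitrary: f)
  case (Suc m)
  have "\<forall>\<^sub>F w in nhds z. w \<in> eball 0 (fps_conv_radius f)"
    using Suc.prems by (intro eventually_nhds_in_open) auto
  then have "\<forall>\<^sub>F w in nhds z. deriv (eval_fps f) w = eval_fps (fps_deriv f) w"
    by eventually_elim (simp add: eval_fps_deriv)
  then have "(deriv ^^ m) (deriv (eval_fps f)) z = (deriv ^^ m) (eval_fps (fps_deriv f)) z"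
    by (rule higher_deriv_cong_ev) simp
  also have "\<dots> = eval_fps ((fps_deriv ^^ m) (fps_deriv f)) z"
    using Suc.prems fps_conv_radius_deriv[of f] by (intro Suc.IH) auto
  finally show ?case by (simp only: funpow_Suc_right o_apply)
qed simp

lemma fps_conv_radius_higher_deriv:
  "fps_conv_radius f \<le> fps_conv_radius ((fps_deriv ^^ m) (f :: complex fps))"
  by (induction m) (auto intro: order.trans fps_conv_radius_deriv)

text \<open>Differentiating \<open>m\<close> times multiplies the coefficient by (j+1)...(j+m),
  which is at least (j+1)^m. The crude bound has the right order in j.\<close>

lemma norm_higher_fps_deriv_ge:
  fixes f :: "complex fps"
  shows "norm (f $ (j + m)) * real (Suc j) ^ m \<le> norm ((fps_deriv ^^ m) f $ j)"
proof (induction m arbitrary: f)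
  case (Suc m)
  have "norm (f $ (j + Suc m)) * real (Suc j) ^ Suc m
      = norm (f $ (j + Suc m)) * real (Suc j) * real (Suc j) ^ m" by simp
  also have "\<dots> \<le> norm (f $ (j + Suc m)) * real (j + m + 1) * real (Suc j) ^ m"
    by (intro mult_right_mono mult_left_mono) auto
  also have "norm (f $ (j + Suc m)) * real (j + m + 1) = norm (fps_deriv f $ (j + m))"
  proof -
    have "norm (of_nat (j + m + 1) :: complex) = real (j + m + 1)" by (rule norm_of_nat)
    then show ?thesis by (simp add: norm_mult del: norm_of_nat)
  qed
  also have "norm (fps_deriv f $ (j + m)) * real (Suc j) ^ m \<le> norm ((fps_deriv ^^ m) (fps_deriv f) $ j)"
    by (rule Suc.IH)
  finally show ?case by (simp only: funpow_Suc_right o_apply)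
qed simp

text \<open>The integrand is the Poisson kernel up to the factor 1 - x^2, that is, the real part of
  (1 + w)/(1 - w) = 1 + 2w + 2w^2 + ... at \<open>w = of_real x * cis t\<close>. Its mean over the
  circle is the constant coefficient 1.\<close>

lemma poisson_integral:
  assumes x: "0 \<le> x" "x < 1"
  shows "(LINT t|lborel. indicator {-pi..pi} t *\<^sub>R (1 / norm (1 - of_real x * cis t) ^ 2)) =
    2 * pi / (1 - x\<^sup>2)"
proof -
  define f :: "complex fps" where "f = Abs_fps (\<lambda>n. if n = 0 then 1 else 2)"
  have f_sums: "(\<lambda>n. f $ n * w ^ n) sums (2 / (1 - w) - 1)" if "norm w < 1" for w
  proof -
    have "(\<lambda>n. 2 * w ^ n) sums (2 * (1 / (1 - w)))"
      using that by (intro sums_mult geometric_sums)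
    then have "(\<lambda>n. 2 * w ^ n - (if n = 0 then 1 else 0)) sums (2 * (1 / (1 - w)) - 1)"
      using sums_single[of 0 "\<lambda>_. 1::complex"] by (intro sums_diff) auto
    moreover have "(\<lambda>n. 2 * w ^ n - (if n = 0 then 1 else 0)) = (\<lambda>n. f $ n * w ^ n)"
      by (auto simp: f_def fun_eq_iff)
    ultimately show ?thesis by simp
  qed
  have "1 \<le> fps_conv_radius f"
    unfolding fps_conv_radius_def
  proof (rule conv_radius_geI_ex')
    fix r :: real assume "0 < r" "ereal r < 1"
    then show "summable (\<lambda>n. f $ n * of_real r ^ n)"
      by (intro sums_summable[OF f_sums]) simp
  qed
  then have r: "ereal x < fps_conv_radius f" using x by (auto intro: less_le_trans[of _ 1])
  have eval: "Re (eval_fps f (of_real x * cis t)) = (1 - x\<^sup>2) * (1 / norm (1 - of_real x * cis t) ^ 2)" for t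
  proof -
    define w where "w = of_real x * cis t"
    have w: "norm w = x" using x by (simp add: w_def norm_mult)
    then have "w \<noteq> 1" using x by auto
    have "eval_fps f w = 2 / (1 - w) - 1"
      using f_sums[of w] w x sums_unique unfolding eval_fps_def by metis
    also have "\<dots> = (1 + w) / (1 - w)" using \<open>w \<noteq> 1\<close> by (simp add: field_simps)
    also have "Re \<dots> = (1 - norm w ^ 2) / norm (1 - w) ^ 2"
      unfolding Re_divide cmod_power2 by (simp add: field_simps power2_eq_square)
    finally show ?thesis by (simp add: w) (simp add: w_def)
  qed
  have int: "integrable lborel (\<lambda>t. indicator {-pi..pi} t *\<^sub>R (eval_fps f (of_real x * cis t)))"
    using r x by (intro borel_integrable_compact continuous_intros compact_Icc) (auto simp: norm_mult)
  have "(LINT t|lborel. indicator {-pi..pi} t *\<^sub>R ((1 - x\<^sup>2) * (1 / norm (1 - of_real x * cis t) ^ 2)))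
      = Re (LINT t|lborel. indicator {-pi..pi} t *\<^sub>R (eval_fps f (of_real x * cis t)))"
    unfolding eval[symmetric] by (subst integral_Re[OF int, symmetric]) simp
  also have "(LINT t|lborel. indicator {-pi..pi} t *\<^sub>R (eval_fps f (of_real x * cis t))) = 2 * of_real pi"
    using fps_nth_integral[OF x(1) r, of 0] by (simp add: f_def)
  finally have "(1 - x\<^sup>2) * (LINT t|lborel. indicator {-pi..pi} t *\<^sub>R (1 / norm (1 - of_real x * cis t) ^ 2)) = 2 * pi"
    by (subst integral_mult_right_zero[symmetric]) (simp add: mult_ac)
  moreover have "x\<^sup>2 < 1" using x by (simp add: power_less_one_iff abs_square_less_1)
  ultimately show ?thesis by (simp add: field_simps)
qed

text \<open>Averaging over a circle of radius \<open>R * x\<close> costs only 1/(1 - x), whereas the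
  supremum of the bound there is of order 1/(1 - x)^2. The power of j saved in this way is what the
  transfer theorem lives on.\<close>

lemma coeff_bound_double_pole:
  fixes h :: "complex fps"
  assumes R: "0 < R" "ereal R \<le> fps_conv_radius h"
    and bound: "\<And>z. norm z < R \<Longrightarrow> norm (eval_fps h z) \<le> K / norm (1 - z / of_real R) ^ 2"
  shows "norm (h $ j) * R ^ j \<le> 3 * K * real (j + 2)"
proof -
  have K: "K \<ge> 0" using bound[of 0] R norm_ge_zero[of "eval_fps h 0"]
    by (simp del: norm_ge_zero)
  \<comment> \<open>The usual choice of a relative distance of order 1/j to the boundary: the cost
    1/(1 - x) is j + 2, while \<open>x ^ j\<close> stays above 1/e and so above 1/3. The shift by 2
    keeps \<open>x\<close> positive at \<open>j = 0\<close>.\<close>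
  define x where "x = 1 - 1 / real (j + 2)"
  have x: "0 < x" "x < 1" by (auto simp: x_def field_simps)
  have Rx: "ereal (R * x) < fps_conv_radius h"
    using R x by (intro less_le_trans[OF _ R(2)]) simp
  have nz: "1 - of_real x * cis t \<noteq> 0" for t
  proof
    assume "1 - of_real x * cis t = 0"
    then have "norm (of_real x * cis t) = 1" by simp
    then show False using x by (simp add: norm_mult)
  qed
  define p where "p t = indicator {-pi..pi} t *\<^sub>R (1 / norm (1 - of_real x * cis t) ^ 2)" for t
  define e where "e t = indicator {-pi..pi} t *\<^sub>R
      (eval_fps h (of_real (R * x) * cis t) * cis (- (real j * t)))" for t
  have le: "norm (e t) \<le> K * p t" for t
    using bound[of "of_real (R * x) * cis t"] R x by (auto simp: norm_mult indicator_def e_def p_def)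
  have "continuous_on {-pi..pi} (\<lambda>t. eval_fps h (of_real (R * x) * cis t) * cis (- (real j * t)))"
    using Rx R x by (intro continuous_intros) (auto simp: norm_mult)
  then have int_e: "integrable lborel e"
    unfolding e_def by (rule borel_integrable_compact[OF compact_Icc])
  have "continuous_on {-pi..pi} (\<lambda>t. 1 / norm (1 - of_real x * cis t) ^ 2)"
    using nz by (intro continuous_intros) auto
  then have int_p: "integrable lborel p"
    unfolding p_def by (rule borel_integrable_compact[OF compact_Icc])
  have "2 * pi * (norm (h $ j) * (R * x) ^ j) = norm (integral\<^sup>L lborel e)"
  proof -
    have "integral\<^sup>L lborel e = 2 * of_real pi * (h $ j * of_real (R * x) ^ j)"
      unfolding e_def using R x by (intro fps_nth_integral[OF _ Rx]) simp
    then show ?thesis using R x by (simp add: norm_mult norm_power)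
  qed
  also have "\<dots> \<le> (LINT t|lborel. norm (e t))"
    by (rule integral_norm_bound)
  also have "\<dots> \<le> (LINT t|lborel. K * p t)"
    using int_e int_p le by (intro integral_mono) auto
  also have "\<dots> = K * (2 * pi / (1 - x\<^sup>2))"
    using poisson_integral[of x] x unfolding p_def[symmetric] by simp
  finally have "2 * pi * (norm (h $ j) * (R * x) ^ j) \<le> 2 * pi * (K / (1 - x\<^sup>2))"
    by (simp add: mult_ac)
  then have "norm (h $ j) * (R * x) ^ j \<le> K / (1 - x\<^sup>2)"
    by (subst (asm) mult_le_cancel_left_pos) simp_all
  also have "\<dots> \<le> K / (1 - x)"
  proof -
    have "x\<^sup>2 \<le> x" using x by (simp add: power2_eq_square mult_left_le)
    then show ?thesis using x K by (intro divide_left_mono mult_pos_pos) auto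
  qed
  also have "\<dots> = K * real (j + 2)" by (simp add: x_def)
  finally have main: "norm (h $ j) * R ^ j * x ^ j \<le> K * real (j + 2)"
    by (simp add: power_mult_distrib mult_ac)
  have "1 \<le> 3 * x ^ j"
  proof -
    have inv: "inverse x = 1 + 1 / real (j + 1)" by (simp add: x_def field_simps)
    have "inverse x ^ j \<le> exp (1 / real (j + 1)) ^ j"
      unfolding inv using exp_ge_add_one_self[of "1 / real (j + 1)"] by (intro power_mono) simp_all
    also have "\<dots> = exp (real j / real (j + 1))" by (simp flip: exp_of_nat_mult)
    also have "\<dots> \<le> exp 1" by simp
    also have "\<dots> \<le> 3" by (rule exp_le)
    finally show ?thesis using x by (simp add: field_simps)
  qed
  then have "norm (h $ j) * R ^ j * 1 \<le> norm (h $ j) * R ^ j * (3 * x ^ j)"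
    using R by (intro mult_left_mono) auto
  then show ?thesis using main by simp
qed

text \<open>The bound has order n^(-M-1), just below the order n^(-M-1/2) of the coefficients of (1
  - x/R)^(M-1/2), the last term kept in the expansions. A supremum estimate in place of the Poisson
  mean would yield n^(-M), which is too weak.\<close>

theorem transfer_big_o:
  fixes a :: "nat \<Rightarrow> complex"
  assumes R: "0 < R" "R < R'" and \<phi>: "0 < \<phi>" "\<phi> < pi / 2"
    and holo: "G holomorphic_on dented_domain R R' \<phi>"
    and bigo: "G \<in> O[at (of_real R) within dented_domain R R' \<phi>](\<lambda>x. (1 - x / of_real R) ^ M)"
    and sums: "\<And>x. norm x < R \<Longrightarrow> (\<lambda>n. a n * x ^ n) sums G x"
  obtains K where "\<And>n. n \<ge> M + 2 \<Longrightarrow> norm (a n) * R ^ n \<le> K * real (n - M) / real (n - M - 1) ^ (M + 2)"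
proof -
  define f where "f = Abs_fps a"
  have Rf: "ereal R \<le> fps_conv_radius f"
    unfolding fps_conv_radius_def
  proof (rule conv_radius_geI_ex')
    fix r :: real assume "0 < r" "ereal r < ereal R"
    then show "summable (\<lambda>n. f $ n * of_real r ^ n)"
      using sums[of "of_real r"] by (auto simp: f_def sums_iff)
  qed
  obtain K where K: "\<And>z. norm z < R \<Longrightarrow> norm ((deriv ^^ (M + 2)) G z) \<le> K / norm (1 - z / of_real R) ^ 2"
    using higher_deriv_bound_dented_domain[OF R \<phi> holo bigo] by blast
  define h where "h = (fps_deriv ^^ (M + 2)) f"
  have bound: "norm (eval_fps h z) \<le> K / norm (1 - z / of_real R) ^ 2" if z: "norm z < R" for z
  proof -
    have "\<forall>\<^sub>F w in nhds z. w \<in> ball 0 R"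
      using z by (intro eventually_nhds_in_open) auto
    then have "\<forall>\<^sub>F w in nhds z. eval_fps f w = G w"
      by eventually_elim (use sums in \<open>auto simp: eval_fps_def f_def sums_iff\<close>)
    then have "(deriv ^^ (M + 2)) (eval_fps f) z = (deriv ^^ (M + 2)) G z"
      by (rule higher_deriv_cong_ev) simp
    moreover have "(deriv ^^ (M + 2)) (eval_fps f) z = eval_fps h z"
      unfolding h_def using z Rf by (intro higher_deriv_eval_fps) (auto intro: less_le_trans[of _ "ereal R"])
    ultimately show ?thesis using K[OF z] by simp
  qed
  have Rh: "ereal R \<le> fps_conv_radius h"
    unfolding h_def using Rf fps_conv_radius_higher_deriv order.trans by blast
  show thesis
  proof (rule that)
    fix n assume n: "n \<ge> M + 2"
    define j where "j = n - (M + 2)"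
    have nj: "n = j + (M + 2)" using n by (simp add: j_def)
    have "norm (a n) * real (Suc j) ^ (M + 2) * R ^ j \<le> norm (h $ j) * R ^ j"
      using norm_higher_fps_deriv_ge[of f j "M + 2"] R
      by (intro mult_right_mono) (auto simp: f_def h_def nj)
    also have "\<dots> \<le> 3 * K * real (j + 2)"
      by (rule coeff_bound_double_pole[OF R(1) Rh bound])
    finally have "norm (a n) * R ^ j \<le> 3 * K * real (j + 2) / real (Suc j) ^ (M + 2)"
      by (subst pos_le_divide_eq) (simp_all add: mult_ac)
    then have "norm (a n) * R ^ j * R ^ (M + 2) \<le> 3 * K * real (j + 2) / real (Suc j) ^ (M + 2) * R ^ (M + 2)"
      using R by (intro mult_right_mono) auto
    then show "norm (a n) * R ^ n \<le> (3 * K * R ^ (M + 2)) * real (n - M) / real (n - M - 1) ^ (M + 2)"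
      unfolding nj by (simp add: power_add mult_ac distrib_left)
  qed
qed

section \<open>Coefficients of half-integer powers and singular expansions\<close>

lemma gbinomial_coeff_asymptotic:
  fixes a :: complex
  shows "(\<lambda>n. (a gchoose n) * (- 1) ^ n * exp ((a + 1) * of_real (ln (real n)))) \<longlonglongrightarrow> inverse (Gamma (- a))"
proof -
  have "(a gchoose n) / ((- 1) ^ n / exp ((a + 1) * of_real (ln (real n)))) =
      (a gchoose n) * (- 1) ^ n * exp ((a + 1) * of_real (ln (real n)))" for n
    by (cases "even n") (simp_all add: field_simps)
  then show ?thesis using gbinomial_asymptotic[of a] by simp
qed

lemma csqrt_power_sums:
  assumes R: "0 < R" "norm x < R"
  shows "(\<lambda>n. ((of_nat k / 2) gchoose n) * (- 1 / of_real R) ^ n * x ^ n) sums (csqrt (1 - x / of_real R) ^ k)"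
proof -
  have n: "norm (- x / of_real R) < 1" using R by (simp add: norm_divide)
  have nz: "1 - x / of_real R \<noteq> 0" using R by (auto simp: field_simps)
  have "csqrt (1 - x / of_real R) ^ k = (1 - x / of_real R) powr (of_nat k / 2)"
  proof (cases "k = 0")
    case False
    have "csqrt w ^ k = w powr (of_nat k / 2)" if "w \<noteq> 0" for w
      using that by (simp add: csqrt_conv_powr powr_def flip: exp_of_nat_mult)
    then show ?thesis using nz by blast
  qed (use nz in simp)
  with gen_binomial_complex[OF n, of "of_nat k / 2"]
  have "(\<lambda>n. ((of_nat k / 2) gchoose n) * (- x / of_real R) ^ n) sums (csqrt (1 - x / of_real R) ^ k)"
    by simp
  also have "(\<lambda>n. ((of_nat k / 2) gchoose n) * (- x / of_real R) ^ n) =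
      (\<lambda>n. ((of_nat k / 2) gchoose n) * (- 1 / of_real R) ^ n * x ^ n)"
    by (simp add: mult.assoc fun_eq_iff flip: power_mult_distrib)
  finally show ?thesis .
qed

text \<open>A value of 1 - x/R on the branch cut would place \<open>x\<close> on the real ray from R
  outwards, where real part and norm of x - R coincide; the dent removes this ray.\<close>

lemma holomorphic_on_csqrt_dented_domain:
  assumes R: "0 < R" and \<phi>: "0 < \<phi>" "\<phi> < pi / 2"
  shows "(\<lambda>x. csqrt (1 - x / of_real R)) holomorphic_on dented_domain R R' \<phi>"
proof (intro holomorphic_intros)
  fix x assume x: "x \<in> dented_domain R R' \<phi>"
  show "1 - x / of_real R \<notin> \<real>\<^sub>\<le>\<^sub>0"
  proof
    assume "1 - x / of_real R \<in> \<real>\<^sub>\<le>\<^sub>0"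
    then obtain t where t: "1 - x / of_real R = of_real t" "t \<le> 0"
      by (elim nonpos_Reals_cases)
    then have "x - of_real R = of_real (- t * R)" using R by (simp add: field_simps)
    moreover have "0 \<le> - t * R" using t R by (simp add: mult_nonpos_nonneg)
    moreover have "cos \<phi> * (- t * R) \<le> 1 * (- t * R)"
      using \<open>0 \<le> - t * R\<close> by (intro mult_right_mono) auto
    ultimately have "Re (x - of_real R) = - t * R" "norm (x - of_real R) = - t * R"
      by (simp_all only: Re_complex_of_real norm_of_real abs_of_nonneg)
    then show False using x \<open>cos \<phi> * (- t * R) \<le> 1 * (- t * R)\<close>
      by (simp only: dented_domain_eq[OF \<phi>] mem_Collect_eq) simp
  qed
qed (use R in auto)

text \<open>Even powers of X are polynomials in x and contribute to finitely many coefficients only.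
  Odd powers below \<open>2 * M - 1\<close> are absent by assumption, so X^(2M-1) dominates. The
  remainder, an O((1 - x/R)^M), loses a factor n^(-1/2) against it.\<close>

theorem singular_expansion_coeff:
  fixes f :: "complex fps" and c :: "nat \<Rightarrow> complex"
  assumes R: "0 < R" "ereal R \<le> fps_conv_radius f" and M: "M > 0"
    and exp: "singular_expansion f R (\<lambda>X. \<Sum>k<2 * M. c k * X ^ k) (2 * M)"
    and c: "\<And>k. odd k \<Longrightarrow> k < 2 * M - 1 \<Longrightarrow> c k = 0"
  shows "(\<lambda>n. f $ n * of_real (R ^ n * real n powr (real M + 1 / 2)))
           \<longlonglongrightarrow> c (2 * M - 1) * inverse (Gamma (1 / 2 - of_nat M))"
proof -
  obtain R' \<phi> F where R': "R < R'" and \<phi>: "0 < \<phi>" "\<phi> < pi / 2"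
    and holF: "F holomorphic_on dented_domain R R' \<phi>"
    and Ff: "\<And>x. x \<in> ball 0 R \<Longrightarrow> F x = eval_fps f x"
    and bigo: "(\<lambda>x. F x - (\<Sum>k<2 * M. c k * csqrt (1 - x / of_real R) ^ k))
          \<in> O[at (of_real R) within dented_domain R R' \<phi>](\<lambda>x. csqrt (1 - x / of_real R) ^ (2 * M))"
    using exp unfolding singular_expansion_def by blast
  define S :: "nat \<Rightarrow> nat \<Rightarrow> complex" where "S k n = ((of_nat k / 2) gchoose n) * (- 1 / of_real R) ^ n" for k n
  define a where "a n = f $ n - (\<Sum>k<2 * M. c k * S k n)" for n
  define G where "G x = F x - (\<Sum>k<2 * M. c k * csqrt (1 - x / of_real R) ^ k)" for x
  have sums: "(\<lambda>n. a n * x ^ n) sums G x" if x: "norm x < R" for x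
  proof -
    have "(\<lambda>n. f $ n * x ^ n) sums eval_fps f x"
      using x R by (intro sums_eval_fps) (auto intro: less_le_trans[of _ "ereal R"])
    then have "(\<lambda>n. f $ n * x ^ n - (\<Sum>k<2 * M. c k * (S k n * x ^ n))) sums G x"
      unfolding G_def S_def using x R Ff[of x]
      by (intro sums_diff sums_sum sums_mult csqrt_power_sums) auto
    then show ?thesis by (simp add: a_def left_diff_distrib sum_distrib_right mult.assoc)
  qed
  have holG: "G holomorphic_on dented_domain R R' \<phi>"
    unfolding G_def
    by (intro holomorphic_intros holF holomorphic_on_csqrt_dented_domain R \<phi>)
  have "G \<in> O[at (of_real R) within dented_domain R R' \<phi>](\<lambda>x. (1 - x / of_real R) ^ M)"
    using bigo unfolding G_def by (simp add: power_mult)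
  then obtain K where K: "\<And>n. n \<ge> M + 2 \<Longrightarrow> norm (a n) * R ^ n \<le> K * real (n - M) / real (n - M - 1) ^ (M + 2)"
    using transfer_big_o[OF R(1) R' \<phi> holG _ sums] by blast
  have lim_a: "(\<lambda>n. a n * of_real (R ^ n * real n powr (real M + 1 / 2))) \<longlonglongrightarrow> 0"
  proof (rule Lim_null_comparison)
    show "(\<lambda>n. \<bar>K\<bar> * 2 ^ (M + 2) * real n powr (- 1 / 2)) \<longlonglongrightarrow> 0" by real_asymp
    show "\<forall>\<^sub>F n in sequentially. norm (a n * of_real (R ^ n * real n powr (real M + 1 / 2)))
        \<le> \<bar>K\<bar> * 2 ^ (M + 2) * real n powr (- 1 / 2)"
      \<comment> \<open>From this index on, \<open>n - M - 1\<close> is at least n/2.\<close>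
      using eventually_ge_at_top[of "2 * M + 2"]
    proof eventually_elim
      case (elim n)
      define j where "j = n - M - 1"
      have j: "real n / 2 \<le> real j" "real (n - M) \<le> real n" using elim M by (auto simp: j_def)
      have n0: "real n > 0" using elim by auto
      have "norm (a n) * R ^ n \<le> K * real (n - M) / real j ^ (M + 2)"
        unfolding j_def using elim M by (intro K) auto
      also have "\<dots> \<le> \<bar>K\<bar> * real n / real j ^ (M + 2)"
        using j by (intro divide_right_mono mult_mono) auto
      also have "\<dots> \<le> \<bar>K\<bar> * real n / (real n / 2) ^ (M + 2)"
        using j n0 by (intro divide_left_mono power_mono mult_pos_pos zero_less_power) auto
      also have "\<dots> = \<bar>K\<bar> * 2 ^ (M + 2) * (real n / real n ^ (M + 2))"
        by (simp add: power_divide)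
      also have "real n / real n ^ (M + 2) = real n powr (- (real M + 1))"
        using n0 by (simp add: powr_minus powr_diff powr_add powr_realpow field_simps)
      finally have "norm (a n) * R ^ n * real n powr (real M + 1 / 2) \<le>
          \<bar>K\<bar> * 2 ^ (M + 2) * real n powr (- (real M + 1)) * real n powr (real M + 1 / 2)"
        by (intro mult_right_mono) auto
      also have "\<dots> = \<bar>K\<bar> * 2 ^ (M + 2) * real n powr (- 1 / 2)"
        by (simp add: mult.assoc flip: powr_add)
      finally show ?case using R by (simp add: norm_mult norm_power mult.assoc)
    qed
  qed
  have lim_S: "(\<lambda>n. c k * S k n * of_real (R ^ n * real n powr (real M + 1 / 2))) \<longlonglongrightarrow>
      (if k = 2 * M - 1 then c k * inverse (Gamma (1 / 2 - of_nat M)) else 0)" if k: "k < 2 * M" for k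
  proof (cases "even k")
    case True
    then obtain j where j: "k = 2 * j" by blast
    have "\<forall>\<^sub>F n in sequentially. 0 = c k * S k n * of_real (R ^ n * real n powr (real M + 1 / 2))"
      using eventually_gt_at_top[of j]
      by eventually_elim (simp add: S_def j flip: binomial_gbinomial)
    then have "(\<lambda>n. c k * S k n * of_real (R ^ n * real n powr (real M + 1 / 2))) \<longlonglongrightarrow> 0"
      by (rule Lim_transform_eventually[OF tendsto_const])
    moreover have "k \<noteq> 2 * M - 1" using j M by presburger
    ultimately show ?thesis by simp
  next
    case odd: False
    show ?thesis
    proof (cases "k = 2 * M - 1")
      case True
      define \<alpha> :: complex where "\<alpha> = of_nat k / 2"
      have \<alpha>: "\<alpha> = of_nat M - 1 / 2" using M by (simp add: \<alpha>_def True of_nat_diff field_simps)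
      have "\<forall>\<^sub>F n in sequentially. c k * ((\<alpha> gchoose n) * (- 1) ^ n * exp ((\<alpha> + 1) * of_real (ln (real n))))
          = c k * S k n * of_real (R ^ n * real n powr (real M + 1 / 2))"
        using eventually_gt_at_top[of 0]
      proof eventually_elim
        case (elim n)
        have "(\<alpha> + 1) * of_real (ln (real n)) = of_real ((real M + 1 / 2) * ln (real n))"
          by (simp add: \<alpha>)
        then have "exp ((\<alpha> + 1) * of_real (ln (real n))) = of_real (real n powr (real M + 1 / 2))"
          using elim by (simp only: exp_of_real powr_def) simp
        moreover have "(- 1 / complex_of_real R) ^ n * of_real (R ^ n) = (- 1) ^ n"
          using R by (simp flip: power_mult_distrib)
        ultimately show ?case unfolding S_def \<alpha>_def[symmetric]
          by (simp add: mult_ac)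
      qed
      from Lim_transform_eventually[OF tendsto_mult[OF tendsto_const gbinomial_coeff_asymptotic] this]
      show ?thesis using True by (simp add: \<alpha>)
    next
      case False
      then show ?thesis using c[OF odd] k by simp
    qed
  qed
  have "(\<lambda>n. a n * of_real (R ^ n * real n powr (real M + 1 / 2)) +
      (\<Sum>k<2 * M. c k * S k n * of_real (R ^ n * real n powr (real M + 1 / 2)))) \<longlonglongrightarrow>
      0 + (\<Sum>k<2 * M. if k = 2 * M - 1 then c k * inverse (Gamma (1 / 2 - of_nat M)) else 0)"
    using lim_S by (intro tendsto_add lim_a tendsto_sum) auto
  also have "(\<lambda>n. a n * of_real (R ^ n * real n powr (real M + 1 / 2)) +
      (\<Sum>k<2 * M. c k * S k n * of_real (R ^ n * real n powr (real M + 1 / 2)))) =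
      (\<lambda>n. f $ n * of_real (R ^ n * real n powr (real M + 1 / 2)))"
    by (simp add: a_def left_diff_distrib sum_distrib_right fun_eq_iff)
  also have "0 + (\<Sum>k<2 * M. if k = 2 * M - 1 then c k * inverse (Gamma (1 / 2 - of_nat M)) else 0)
      = c (2 * M - 1) * inverse (Gamma (1 / 2 - of_nat M))"
    using M by simp
  finally show ?thesis .
qed

lemma Gamma_neg_half:
  "Gamma (- 1 / 2 :: complex) = - 2 * of_real (sqrt pi)"
  "Gamma (- 3 / 2 :: complex) = 4 / 3 * of_real (sqrt pi)"
  "Gamma (- 5 / 2 :: complex) = - 8 / 15 * of_real (sqrt pi)"
proof -
  have ni: "(of_int k / 2 :: complex) \<notin> \<int>\<^sub>\<le>\<^sub>0" if "odd k" for k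
  proof
    assume "(of_int k / 2 :: complex) \<in> \<int>\<^sub>\<le>\<^sub>0"
    then obtain j where "of_int k / 2 = (of_int j :: complex)" by (auto elim: nonpos_Ints_cases)
    then have "(of_int k :: complex) = of_int (2 * j)" by simp
    then show False using that by (simp only: of_int_eq_iff) simp
  qed
  have step: "Gamma (of_int k / 2 :: complex) = Gamma (of_int (k + 2) / 2) / (of_int k / 2)" if "odd k" for k
  proof -
    have "k \<noteq> 0" using that by auto
    then show ?thesis using Gamma_plus1[OF ni[OF that]] by (simp add: add_divide_distrib)
  qed
  show 1: "Gamma (- 1 / 2 :: complex) = - 2 * of_real (sqrt pi)"
    using step[of "-1"] by (simp add: Gamma_one_half_complex)
  show 2: "Gamma (- 3 / 2 :: complex) = 4 / 3 * of_real (sqrt pi)"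
    using step[of "-3"] 1 by (simp add: field_simps)
  show "Gamma (- 5 / 2 :: complex) = - 8 / 15 * of_real (sqrt pi)"
    using step[of "-5"] 2 by (simp add: mult.commute)
qed

section \<open>Blocks and ears\<close>

definition gjoin :: "graph \<Rightarrow> graph \<Rightarrow> graph" where
  "gjoin G H = (verts G \<union> verts H, edges G \<union> edges H)"

definition induced :: "graph \<Rightarrow> nat set \<Rightarrow> graph" where
  "induced G W = (W, {e \<in> edges G. e \<subseteq> W})"

lemma gjoin_simps [simp]:
  "verts (gjoin G H) = verts G \<union> verts H" "edges (gjoin G H) = edges G \<union> edges H"
  by (simp_all add: gjoin_def)

lemma induced_simps [simp]:
  "verts (induced G W) = W" "edges (induced G W) = {e \<in> edges G. e \<subseteq> W}"
  by (simp_all add: induced_def)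

lemma del_verts_simps [simp]:
  "verts (del_verts G S) = verts G - S" "edges (del_verts G S) = {e \<in> edges G. e \<inter> S = {}}"
  by (simp_all add: del_verts_def)

lemma simple_graphD:
  assumes "simple_graph G" "e \<in> edges G"
  shows "e \<subseteq> verts G" "card e = 2"
  using assms by (auto simp: simple_graph_def)

lemma simple_graph_edge:
  assumes "simple_graph G" "{x, y} \<in> edges G"
  shows "x \<in> verts G" "y \<in> verts G" "x \<noteq> y"
  using simple_graphD[OF assms] by auto

lemma simple_graph_edgeE:
  assumes "simple_graph G" "e \<in> edges G"
  obtains x y where "e = {x, y}" "x \<noteq> y" "x \<in> verts G" "y \<in> verts G"
  using simple_graphD[OF assms] by (auto simp: card_2_iff)

lemma simple_gjoin: "simple_graph G \<Longrightarrow> simple_graph H \<Longrightarrow> simple_graph (gjoin G H)"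
  by (auto simp: simple_graph_def)

lemma simple_induced: "simple_graph G \<Longrightarrow> W \<subseteq> verts G \<Longrightarrow> simple_graph (induced G W)"
  by (auto simp: simple_graph_def intro: finite_subset)

lemma subgraph_refl: "simple_graph G \<Longrightarrow> subgraph G G"
  by (simp add: subgraph_def)

lemma subgraph_trans: "subgraph K H \<Longrightarrow> subgraph H G \<Longrightarrow> subgraph K G"
  by (auto simp: subgraph_def)

lemma reachable_refl [simp]: "reachable G x x"
  by (simp add: reachable_def)

lemma reachable_trans: "reachable G x y \<Longrightarrow> reachable G y z \<Longrightarrow> reachable G x z"
  by (auto simp: reachable_def)

lemma reachable_sym:
  assumes "reachable G x y" shows "reachable G y x"
proof -
  have "sym {(x, y). {x, y} \<in> edges G}" by (auto simp: sym_def insert_commute)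
  then show ?thesis using assms unfolding reachable_def by (meson sym_rtrancl symD)
qed

lemma reachable_edge: "{x, y} \<in> edges G \<Longrightarrow> reachable G x y"
  by (auto simp: reachable_def)

lemma reachable_step: "reachable G x y \<Longrightarrow> {y, z} \<in> edges G \<Longrightarrow> reachable G x z"
  by (rule reachable_trans[OF _ reachable_edge])

lemma reachable_mono: "reachable G x y \<Longrightarrow> edges G \<subseteq> edges H \<Longrightarrow> reachable H x y"
  unfolding reachable_def by (erule rtrancl_mono[THEN subsetD, rotated]) auto

lemma reachable_closed:
  assumes "reachable G x y" "x \<in> S" "\<And>u v. u \<in> S \<Longrightarrow> {u, v} \<in> edges G \<Longrightarrow> v \<in> S"
  shows "y \<in> S"
  using assms(1) unfolding reachable_def
  by (induction rule: rtrancl_induct) (use assms in auto)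

lemma reachable_within:
  assumes "reachable G x y" "x \<in> S"
    and "\<And>u v. u \<in> S \<Longrightarrow> {u, v} \<in> edges G \<Longrightarrow> {u, v} \<in> edges H \<and> v \<in> S"
  shows "reachable H x y"
proof -
  have "y \<in> {y \<in> S. reachable H x y}"
    by (rule reachable_closed[OF assms(1)]) (use assms in \<open>auto intro: reachable_step\<close>)
  then show ?thesis by simp
qed

lemma connected_simple: "connected_graph G \<Longrightarrow> simple_graph G"
  by (simp add: connected_graph_def)

lemma two_connected_connected: "two_connected G \<Longrightarrow> connected_graph G"
  by (simp add: two_connected_def)

lemma two_connected_simple: "two_connected G \<Longrightarrow> simple_graph G"
  by (simp add: two_connected_def connected_simple)

lemma connected_reachable: "connected_graph G \<Longrightarrow> x \<in> verts G \<Longrightarrow> y \<in> verts G \<Longrightarrow> reachable G x y"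
  by (simp add: connected_graph_def)

lemma connected_graphI:
  assumes "simple_graph G" "r \<in> verts G" "\<And>x. x \<in> verts G \<Longrightarrow> reachable G r x"
  shows "connected_graph G"
  using assms unfolding connected_graph_def by (blast intro: reachable_trans reachable_sym)

lemma two_connected_del:
  assumes K: "two_connected K" and xy: "x \<in> verts K - {v}" "y \<in> verts K - {v}"
  shows "reachable (del_verts K {v}) x y"
proof (cases "v \<in> verts K")
  case True
  then show ?thesis
    using assms connected_reachable[of K x y] unfolding two_connected_def cut_vertex_def by blast
next
  case False
  have "reachable K x y" using K xy by (simp add: two_connected_connected connected_reachable)
  then show ?thesis
    by (rule reachable_mono) (use False simple_graphD[OF two_connected_simple[OF K]] in auto)
qed

lemma two_connectedI:
  assumes "connected_graph G" "2 \<le> card (verts G)"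
    "\<And>v x y. v \<in> verts G \<Longrightarrow> x \<in> verts G - {v} \<Longrightarrow> y \<in> verts G - {v} \<Longrightarrow> reachable (del_verts G {v}) x y"
  shows "two_connected G"
  using assms unfolding two_connected_def cut_vertex_def by blast

lemma two_connected_edge:
  assumes "two_connected K" shows "edges K \<noteq> {}"
proof
  assume e: "edges K = {}"
  have "finite (verts K)" using two_connected_simple[OF assms] by (simp add: simple_graph_def)
  moreover have "\<not> card (verts K) \<le> Suc 0" using assms by (simp add: two_connected_def)
  ultimately obtain x y where "x \<in> verts K" "y \<in> verts K" "x \<noteq> y"
    by (auto simp: card_le_Suc0_iff_eq)
  then have "reachable K x y" using assms by (simp add: two_connected_connected connected_reachable)
  then have "y \<in> {x}" by (rule reachable_closed) (use e in auto)
  then show False using \<open>x \<noteq> y\<close> by simp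
qed

text \<open>An edge lies on one side, so a walk between vertices strictly on opposite sides must
  visit the common vertex \<open>v\<close>. But 2-connectedness supplies such a walk avoiding
  \<open>v\<close>. If the sides are disjoint, connectedness alone gives the contradiction.\<close>

lemma two_connected_side:
  assumes K: "two_connected K" and V: "verts K \<subseteq> V1 \<union> V2" "V1 \<inter> V2 \<subseteq> {v}"
    and e: "\<And>e. e \<in> edges K \<Longrightarrow> e \<subseteq> V1 \<or> e \<subseteq> V2"
  shows "verts K \<subseteq> V1 \<or> verts K \<subseteq> V2"
proof (rule ccontr)
  assume "\<not> ?thesis"
  then obtain x y where x: "x \<in> verts K" "x \<notin> V1" and y: "y \<in> verts K" "y \<notin> V2" by blast
  show False
  proof (cases "v \<in> V1 \<inter> V2")
    case True
    then have "reachable (del_verts K {v}) x y"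
      using x y by (intro two_connected_del[OF K]) auto
    then have "y \<in> V2 - {v}"
      by (rule reachable_closed) (use x V True e in \<open>auto dest!: e\<close>)
    then show False using y by simp
  next
    case False
    have "reachable K x y" using x y K by (simp add: two_connected_connected connected_reachable)
    then have "y \<in> V2"
      by (rule reachable_closed) (use x V False e in \<open>auto dest!: e\<close>)
    then show False using y by simp
  qed
qed

text \<open>Maximality in a part has to be upgraded to maximality in the whole graph. A larger
  2-connected subgraph lies in one part, and it cannot be the other one: a block has an edge, and
  the parts share none.\<close>

lemma block_of_split:
  assumes sub: "subgraph G1 G" "subgraph G2 G" and dis: "edges G1 \<inter> edges G2 = {}"
    and side: "\<And>K. subgraph K G \<Longrightarrow> two_connected K \<Longrightarrow> subgraph K G1 \<or> subgraph K G2"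
  shows "block_of K G \<longleftrightarrow> block_of K G1 \<or> block_of K G2"
proof
  assume "block_of K G"
  then show "block_of K G1 \<or> block_of K G2"
    using side subgraph_trans[OF _ sub(1)] subgraph_trans[OF _ sub(2)] unfolding maximal_subgraph_def by blast
next
  have aux: "block_of K G" if H: "block_of K H1" "subgraph H1 G" "edges H1 \<inter> edges H2 = {}"
    "\<And>K. subgraph K G \<Longrightarrow> two_connected K \<Longrightarrow> subgraph K H1 \<or> subgraph K H2" for H1 H2
    unfolding maximal_subgraph_def
  proof (intro conjI allI impI)
    show "subgraph K G" "two_connected K"
      using H(1,2) subgraph_trans[of K H1 G] unfolding maximal_subgraph_def by blast+
    fix K' assume K': "subgraph K' G \<and> two_connected K' \<and> subgraph K K'"
    have "\<not> subgraph K' H2"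
      using K' H(1,3) two_connected_edge[of K] unfolding maximal_subgraph_def subgraph_def by blast
    then have "subgraph K' H1" using H(4) K' by blast
    then show "K' = K" using H(1) K' unfolding maximal_subgraph_def by blast
  qed
  assume "block_of K G1 \<or> block_of K G2"
  then show "block_of K G" using aux[of G1 G2] aux[of G2 G1] sub dis side by blast
qed

text \<open>An edge has two ends, so it cannot lie in a common part of at most one vertex. Hence
  both graphs can be read off from the join once their vertex sets are known, which later gives the
  injectivity of decompositions.\<close>

lemma gjoin_one_vertex:
  assumes s: "simple_graph G1" "simple_graph G2" and v: "verts G1 \<inter> verts G2 \<subseteq> {v}"
  shows "edges G1 \<inter> edges G2 = {}"
    and "\<And>K. subgraph K (gjoin G1 G2) \<Longrightarrow> two_connected K \<Longrightarrow> subgraph K G1 \<or> subgraph K G2"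
    and "induced (gjoin G1 G2) (verts G1) = G1"
    and "induced (gjoin G1 G2) (verts G2) = G2"
proof -
  have no: "\<not> e \<subseteq> verts H1"
    if "simple_graph H2" "verts H1 \<inter> verts H2 \<subseteq> {v}" "e \<in> edges H2" for H1 H2 e
  proof
    assume "e \<subseteq> verts H1"
    then have "e \<subseteq> {v}" using simple_graphD(1)[OF that(1,3)] that(2) by blast
    then have "card e \<le> 1" using card_mono[of "{v}" e] by simp
    then show False using simple_graphD(2)[OF that(1,3)] by simp
  qed
  note no1 = no[OF s(2) v] and no2 = no[OF s(1) v[unfolded Int_commute[of "verts G1"]]]
  show "edges G1 \<inter> edges G2 = {}" using no1 simple_graphD(1)[OF s(1)] by blast
  show "induced (gjoin G1 G2) (verts G1) = G1" "induced (gjoin G1 G2) (verts G2) = G2"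
  proof -
    have "(e \<in> edges G1 \<union> edges G2 \<and> e \<subseteq> verts G1) = (e \<in> edges G1)"
      "(e \<in> edges G1 \<union> edges G2 \<and> e \<subseteq> verts G2) = (e \<in> edges G2)" for e
      using no1[of e] no2[of e] simple_graphD(1)[OF s(1), of e] simple_graphD(1)[OF s(2), of e] by auto
    then show "induced (gjoin G1 G2) (verts G1) = G1" "induced (gjoin G1 G2) (verts G2) = G2"
      by (simp_all add: prod_eq_iff)
  qed
  fix K assume K: "subgraph K (gjoin G1 G2)" "two_connected K"
  have "verts K \<subseteq> verts G1 \<or> verts K \<subseteq> verts G2"
  proof (rule two_connected_side[OF K(2) _ v])
    show "verts K \<subseteq> verts G1 \<union> verts G2" using K(1) by (simp add: subgraph_def)
    show "e \<subseteq> verts G1 \<or> e \<subseteq> verts G2" if "e \<in> edges K" for e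
      using K(1) that simple_graphD(1)[OF s(1)] simple_graphD(1)[OF s(2)] unfolding subgraph_def by auto
  qed
  moreover have "e \<subseteq> verts K" if "e \<in> edges K" for e
    using simple_graphD(1)[OF two_connected_simple[OF K(2)] that] .
  moreover have "e \<in> edges G1 \<or> e \<in> edges G2" if "e \<in> edges K" for e
    using K(1) that by (auto simp: subgraph_def)
  ultimately have "(verts K \<subseteq> verts G1 \<and> edges K \<subseteq> edges G1) \<or> (verts K \<subseteq> verts G2 \<and> edges K \<subseteq> edges G2)"
    by (meson no1 no2 order.trans subsetI)
  then show "subgraph K G1 \<or> subgraph K G2"
    using two_connected_simple[OF K(2)] by (simp add: subgraph_def)
qed

text \<open>Adding a shortest such path to \<open>U\<close> keeps it 2-connected: from every vertex of the path
  one can walk along it to one of its two ends while avoiding any other given vertex.\<close>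
lemma ear:
  assumes G: "simple_graph G" and U: "U \<subseteq> verts G" and K: "two_connected (induced G U)"
    and u: "u \<in> U" "u' \<in> U" "u \<noteq> u'"
    and reach: "reachable (verts G, edges G - edges (induced G U)) u u'"
  obtains W where "U \<subset> W" "W \<subseteq> verts G" "two_connected (induced G W)"
proof -
  define R where "R = {(x, y). {x, y} \<in> edges G - edges (induced G U)}"
  have "\<exists>n. (u, u') \<in> R ^^ n"
    using reach unfolding reachable_def R_def by (simp add: rtrancl_power)
  then obtain n where n: "(u, u') \<in> R ^^ n" and least: "\<And>m. m < n \<Longrightarrow> (u, u') \<notin> R ^^ m"
    using exists_least_iff[of "\<lambda>n. (u, u') \<in> R ^^ n"] by blast
  obtain f where f: "f 0 = u" "f n = u'" "\<And>i. i < n \<Longrightarrow> (f i, f (Suc i)) \<in> R"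
    using n unfolding relpow_fun_conv by blast
  have path: "(f i, f (i + d)) \<in> R ^^ d" if "i + d \<le> n" for i d
    using that by (induction d) (auto intro!: relcompI f(3))
  have inj: "f i \<noteq> f j" if ij: "i < j" "j \<le> n" for i j
  proof
    assume eq: "f i = f j"
    have "(u, f i) \<in> R ^^ i" using path[of 0 i] ij f(1) by simp
    moreover have "(f j, u') \<in> R ^^ (n - j)" using path[of j "n - j"] ij f(2) by simp
    ultimately have "(u, u') \<in> R ^^ (i + (n - j))" unfolding eq relpow_add by blast
    moreover have "i + (n - j) < n" using ij by simp
    ultimately show False using least by blast
  qed
  have n0: "n > 0" using f u by (metis gr0I)
  have R_verts: "x \<in> verts G \<and> y \<in> verts G \<and> {x, y} \<in> edges G" if "(x, y) \<in> R" for x y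
    using that simple_graph_edge[OF G, of x y] by (auto simp: R_def)
  define W where "W = U \<union> f ` {..n}"
  have fW: "f i \<in> W" if "i \<le> n" for i using that by (simp add: W_def)
  have fG: "f i \<in> verts G" if "i \<le> n" for i
  proof (cases "i = n")
    case True then show ?thesis using f u U by auto
  next
    case False then show ?thesis using R_verts[OF f(3)[of i]] that by simp
  qed
  have WG: "W \<subseteq> verts G" using fG U by (auto simp: W_def)
  have finW: "finite W" using WG G finite_subset by (auto simp: simple_graph_def)
  have "U \<noteq> W"
  proof
    assume "U = W"
    then have "{f 0, f 1} \<subseteq> U" using fW n0 by auto
    then show False using f(3)[of 0] n0 by (auto simp: R_def)
  qed
  then have UW: "U \<subset> W" by (auto simp: W_def)
  have edge: "{f i, f (Suc i)} \<in> edges (induced G W)" if "i < n" for i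
    using R_verts[OF f(3)[OF that]] fW that by auto
  have KW: "edges (induced G U) \<subseteq> edges (induced G W)" using UW by auto
  have to_U: "\<exists>w\<in>U - {x}. reachable (del_verts (induced G W) {x}) w y" if y: "y \<in> W" "y \<noteq> x" for x y
  proof (cases "y \<in> U")
    case True
    then show ?thesis using y by (intro bexI[of _ y]) auto
  next
    case False
    then obtain i where i: "i \<le> n" "y = f i" using y by (auto simp: W_def)
    have seg: "reachable (del_verts (induced G W) {x}) (f j) (f (j + d))"
      if "j + d \<le> n" "\<And>k. j \<le> k \<Longrightarrow> k \<le> j + d \<Longrightarrow> f k \<noteq> x" for j d
      using that
    proof (induction d)
      case (Suc d)
      have "reachable (del_verts (induced G W) {x}) (f j) (f (j + d))" using Suc by auto
      moreover have "{f (j + d), f (j + Suc d)} \<in> edges (del_verts (induced G W) {x})"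
        using edge[of "j + d"] Suc.prems(1) Suc.prems(2)[of "j + d"] Suc.prems(2)[of "j + Suc d"] by auto
      ultimately show ?case by (rule reachable_step)
    qed simp
    \<comment> \<open>The path is injective, so it meets the deleted vertex \<open>x\<close> at most
      once. If that happens before \<open>y\<close>, continue from \<open>y\<close> forwards to
      \<open>u'\<close>; otherwise the segment from \<open>u\<close> to \<open>y\<close> is
      intact.\<close>
    show ?thesis
    proof (cases "\<exists>j<i. f j = x")
      case True
      then obtain j where j: "j < i" "f j = x" by blast
      have "f k \<noteq> x" if "i \<le> k" "k \<le> n" for k using inj[of j k] j that by auto
      then have "reachable (del_verts (induced G W) {x}) y u'" "u' \<noteq> x"
        using seg[of i "n - i"] i f by auto
      then show ?thesis using u by (intro bexI[of _ u']) (auto intro: reachable_sym)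
    next
      case False
      then have "f k \<noteq> x" if "k \<le> i" for k using that y i by (cases "k = i") auto
      then have "reachable (del_verts (induced G W) {x}) u y" "u \<noteq> x"
        using seg[of 0 i] i f by auto
      then show ?thesis using u by (intro bexI[of _ u]) auto
    qed
  qed
  have inU: "reachable (del_verts (induced G W) {x}) y z" if "y \<in> U - {x}" "z \<in> U - {x}" for x y z
    by (rule reachable_mono[OF two_connected_del[OF K]]) (use that KW in auto)
  have del: "reachable (del_verts (induced G W) {x}) y z" if "y \<in> W - {x}" "z \<in> W - {x}" for x y z
    using to_U[of y x] to_U[of z x] inU that by (blast intro: reachable_trans reachable_sym)
  have "connected_graph (induced G W)"
  proof (rule connected_graphI[of _ u])
    show "simple_graph (induced G W)" by (rule simple_induced[OF G WG])
    show "u \<in> verts (induced G W)" using u UW by auto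
    fix x assume x: "x \<in> verts (induced G W)"
    \<comment> \<open>Deleting a vertex outside \<open>W\<close> changes nothing, so connectedness
      is an instance of \<open>del\<close>.\<close>
    obtain z where z: "z \<notin> W" using ex_new_if_finite[OF infinite_UNIV_nat finW] by blast
    have "reachable (del_verts (induced G W) {z}) u x"
      using x z u UW by (intro del) auto
    then show "reachable (induced G W) u x" by (rule reachable_mono) auto
  qed
  moreover have "2 \<le> card W"
  proof -
    have "2 \<le> card U" using K by (simp add: two_connected_def)
    also have "card U \<le> card W" using UW finW by (intro card_mono) auto
    finally show ?thesis .
  qed
  ultimately have "two_connected (induced G W)"
    using del by (intro two_connectedI) auto
  then show thesis using that UW WG by blast
qed

section \<open>Graph classes and their decompositions\<close>

definition relabel :: "(nat \<Rightarrow> nat) \<Rightarrow> graph \<Rightarrow> graph" where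
  "relabel f G = (f ` verts G, (\<lambda>e. f ` e) ` edges G)"

lemma relabel_simps [simp]:
  "verts (relabel f G) = f ` verts G" "edges (relabel f G) = (\<lambda>e. f ` e) ` edges G"
  by (simp_all add: relabel_def)

lemma simple_relabel:
  assumes "simple_graph G" "inj_on f (verts G)"
  shows "simple_graph (relabel f G)"
proof -
  have "card (f ` e) = 2" if "e \<in> edges G" for e
    using simple_graphD[OF assms(1) that] assms(2) by (metis card_image inj_on_subset)
  then show ?thesis using assms simple_graphD(1)[OF assms(1)]
    by (auto simp: simple_graph_def)
qed

lemma reachable_relabel:
  assumes "reachable G x y" shows "reachable (relabel f G) (f x) (f y)"
proof -
  have "y \<in> {y. reachable (relabel f G) (f x) (f y)}"
    using assms
  proof (rule reachable_closed)
    fix u v assume u: "u \<in> {y. reachable (relabel f G) (f x) (f y)}" and e: "{u, v} \<in> edges G"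
    have "{f u, f v} \<in> edges (relabel f G)" using imageI[OF e, of "(`) f"] by simp
    then show "v \<in> {y. reachable (relabel f G) (f x) (f y)}" using u by (auto intro: reachable_step)
  qed simp
  then show ?thesis by simp
qed

lemma connected_relabel:
  assumes "connected_graph G" "inj_on f (verts G)"
  shows "connected_graph (relabel f G)"
  using assms simple_relabel[of G f] reachable_relabel[of G _ _ f] by (auto simp: connected_graph_def)

lemma two_connected_relabel:
  assumes G: "two_connected G" and f: "inj_on f (verts G)"
  shows "two_connected (relabel f G)"
proof (rule two_connectedI)
  show "connected_graph (relabel f G)"
    using assms by (simp add: two_connected_connected connected_relabel)
  show "2 \<le> card (verts (relabel f G))"
    using G f by (simp add: two_connected_def card_image)
  fix v x y assume "v \<in> verts (relabel f G)" "x \<in> verts (relabel f G) - {v}" "y \<in> verts (relabel f G) - {v}"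
  then obtain v' x' y' where v: "v = f v'" "v' \<in> verts G" and x: "x = f x'" "x' \<in> verts G - {v'}"
    and y: "y = f y'" "y' \<in> verts G - {v'}" by auto
  have "reachable (relabel f (del_verts G {v'})) x y"
    unfolding x y by (intro reachable_relabel two_connected_del G x y)
  moreover have "v \<notin> f ` e" if "e \<in> edges G" "v' \<notin> e" for e
    using that simple_graphD(1)[OF two_connected_simple[OF G] that(1)] f v by (auto simp: inj_on_def)
  ultimately show "reachable (del_verts (relabel f G) {v}) x y"
    by (elim reachable_mono) auto
qed

lemma finite_graphs_on: "finite V \<Longrightarrow> finite {G. simple_graph G \<and> verts G = V}"
  by (rule finite_subset[of _ "{V} \<times> Pow (Pow V)"]) (auto simp: simple_graph_def)

lemma inj_on_relabel:
  assumes "inj_on f V"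
  shows "inj_on (relabel f) {G. simple_graph G \<and> verts G = V}"
proof (rule inj_onI)
  fix G H assume G: "G \<in> {G. simple_graph G \<and> verts G = V}" and H: "H \<in> {G. simple_graph G \<and> verts G = V}"
    and eq: "relabel f G = relabel f H"
  have "edges G \<subseteq> Pow V" "edges H \<subseteq> Pow V" using G H by (auto simp: simple_graph_def)
  moreover have "(`) f ` edges G = (`) f ` edges H" using eq by (simp add: relabel_def)
  ultimately have "edges G = edges H"
    using inj_on_image_eq_iff[OF inj_on_image_Pow[OF assms], of "edges G" "edges H"] by simp
  then show "G = H" using G H by (simp add: prod_eq_iff)
qed

definition invariant :: "(graph \<Rightarrow> bool) \<Rightarrow> bool" where
  "invariant P \<longleftrightarrow> (\<forall>G. P G \<longrightarrow> simple_graph G) \<and>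
     (\<forall>G f. P G \<and> inj_on f (verts G) \<longrightarrow> P (relabel f G))"

text \<open>Generating functions count graphs on {0, ..., n-1}, while decompositions produce
  arbitrary finite label sets. Relabelling injects each of two equally large families into the
  other.\<close>

lemma card_invariant:
  assumes P: "invariant P" and V: "finite V"
  shows "card {G. P G \<and> verts G = V} = card {G. P G \<and> verts G = {..<card V}}"
proof -
  have le: "card {G. P G \<and> verts G = V} \<le> card {G. P G \<and> verts G = W}"
    if fin: "finite V" "finite W" "card V = card W" for V W
  proof -
    obtain f where f: "bij_betw f V W" using finite_same_card_bij[OF fin] by blast
    show ?thesis
    proof (rule card_inj_on_le[of "relabel f"])
      have "{G. P G \<and> verts G = V} \<subseteq> {G. simple_graph G \<and> verts G = V}"
        using P by (auto simp: invariant_def)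
      then show "inj_on (relabel f) {G. P G \<and> verts G = V}"
        using inj_on_relabel f by (meson bij_betw_def inj_on_subset)
      show "relabel f ` {G. P G \<and> verts G = V} \<subseteq> {G. P G \<and> verts G = W}"
        using P f by (auto simp: invariant_def bij_betw_def)
      have "{G. P G \<and> verts G = W} \<subseteq> {G. simple_graph G \<and> verts G = W}"
        using P by (auto simp: invariant_def)
      then show "finite {G. P G \<and> verts G = W}"
        using finite_graphs_on[OF fin(2)] finite_subset by blast
    qed
  qed
  show ?thesis using le[of V "{..<card V}"] le[of "{..<card V}" V] V by auto
qed

section \<open>Closed classes: membership through blocks, counts on arbitrary label sets\<close>

locale graph_class =
  fixes \<G> :: "graph set"
  assumes closed: "closed_class \<G>"
begin

lemma class_simple: "G \<in> \<G> \<Longrightarrow> simple_graph G"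
  using closed by (auto simp: closed_class_def)

lemma class_blocks: "simple_graph G \<Longrightarrow> G \<in> \<G> \<longleftrightarrow> (\<forall>H. block_of H G \<longrightarrow> H \<in> \<G>)"
  using closed unfolding closed_class_def by blast

lemma class_relabel:
  assumes "G \<in> \<G>" "inj_on f (verts G)"
  shows "relabel f G \<in> \<G>"
proof -
  have "graph_iso G (relabel f G)"
    unfolding graph_iso_def using assms(2) by (intro exI[of _ f]) (auto simp: bij_betw_def)
  then show ?thesis
    using closed assms simple_relabel[OF class_simple[OF assms(1)] assms(2)]
    unfolding closed_class_def by blast
qed

lemma class_split:
  assumes "simple_graph G" "subgraph G1 G" "subgraph G2 G" "edges G1 \<inter> edges G2 = {}"
    "\<And>K. subgraph K G \<Longrightarrow> two_connected K \<Longrightarrow> subgraph K G1 \<or> subgraph K G2"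
  shows "G \<in> \<G> \<longleftrightarrow> G1 \<in> \<G> \<and> G2 \<in> \<G>"
  using class_blocks[OF assms(1)] class_blocks[of G1] class_blocks[of G2] block_of_split[OF assms(2-5)]
    assms(2,3) unfolding subgraph_def by blast

lemma subgraph_gjoin:
  assumes "simple_graph G1" "simple_graph G2"
  shows "subgraph G1 (gjoin G1 G2)" "subgraph G2 (gjoin G1 G2)"
  using assms by (auto simp: subgraph_def)

lemma class_gjoin_one_vertex:
  assumes "simple_graph G1" "simple_graph G2" "verts G1 \<inter> verts G2 \<subseteq> {v}"
  shows "gjoin G1 G2 \<in> \<G> \<longleftrightarrow> G1 \<in> \<G> \<and> G2 \<in> \<G>"
  using simple_gjoin[OF assms(1,2)] subgraph_gjoin[OF assms(1,2)] gjoin_one_vertex(1,2)[OF assms]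
  by (rule class_split)

text \<open>Such a graph has no blocks, so the criterion by blocks holds vacuously.\<close>

lemma edgeless_in_class:
  assumes "finite V" shows "(V, {}) \<in> \<G>"
proof -
  have "\<not> block_of H (V, {})" for H
    using two_connected_edge[of H] by (auto simp: maximal_subgraph_def subgraph_def)
  then show ?thesis using assms by (subst class_blocks) (auto simp: simple_graph_def)
qed

definition conn :: "nat set \<Rightarrow> graph set" where
  "conn V = {G. (G \<in> \<G> \<and> connected_graph G) \<and> verts G = V}"

definition bicon :: "nat set \<Rightarrow> graph set" where
  "bicon V = {G. (G \<in> \<G> \<and> two_connected G) \<and> verts G = V}"

definition c :: "nat \<Rightarrow> nat" where "c n = card (conn {..<n})"
definition b :: "nat \<Rightarrow> nat" where "b n = card (bicon {..<n})"

lemma card_conn: "finite V \<Longrightarrow> card (conn V) = c (card V)"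
  unfolding conn_def c_def
  by (rule card_invariant) (auto simp: invariant_def class_simple class_relabel connected_relabel)

lemma card_bicon: "finite V \<Longrightarrow> card (bicon V) = b (card V)"
  unfolding bicon_def b_def
  by (rule card_invariant) (auto simp: invariant_def class_simple class_relabel two_connected_relabel)

lemma finite_class_on:
  assumes "finite V" shows "finite {G \<in> \<G>. verts G = V}"
  by (rule finite_subset[OF _ finite_graphs_on[OF assms]]) (auto simp: class_simple)

lemma finite_conn: "finite V \<Longrightarrow> finite (conn V)"
  by (rule finite_subset[OF _ finite_class_on]) (auto simp: conn_def)

lemma finite_bicon: "finite V \<Longrightarrow> finite (bicon V)"
  by (rule finite_subset[OF _ finite_class_on]) (auto simp: bicon_def)

text \<open>The graphs of the class on \<open>V\<close> each of whose components contains exactly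
  one vertex of \<open>A\<close>, regarded as its root. The components may contain cycles: these are
  the rooted connected graphs that hang off the core vertices in \<open>A\<close>.\<close>

definition forest :: "nat set \<Rightarrow> nat set \<Rightarrow> graph set" where
  "forest A V = {H \<in> \<G>. verts H = V \<and> A \<subseteq> V \<and> (\<forall>x\<in>V. \<exists>!a. a \<in> A \<and> reachable H a x)}"

lemma finite_forest: "finite V \<Longrightarrow> finite (forest A V)"
  by (rule finite_subset[OF _ finite_class_on]) (auto simp: forest_def)

lemma forest_empty: "forest {} V = (if V = {} then {({}, {})} else {})"
proof -
  have "H \<in> \<G> \<and> verts H = {} \<longleftrightarrow> H = ({}, {})" for H
  proof
    assume H: "H \<in> \<G> \<and> verts H = {}"
    then have "edges H = {}" using class_simple[of H] by (auto simp: simple_graph_def)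
    then show "H = ({}, {})" using H by (simp add: prod_eq_iff)
  next
    assume "H = ({}, {})"
    then show "H \<in> \<G> \<and> verts H = {}" using edgeless_in_class[of "{}"] by simp
  qed
  then show ?thesis by (auto simp add: forest_def)
qed

lemma reachable_gjoin_disjoint:
  assumes s: "simple_graph G" "simple_graph H" and d: "verts G \<inter> verts H = {}"
    and x: "x \<in> verts G"
  shows "reachable (gjoin G H) x y \<longleftrightarrow> reachable G x y"
    and "reachable (gjoin G H) x y \<Longrightarrow> y \<in> verts G"
proof -
  have step: "{u, v} \<in> edges G \<and> v \<in> verts G" if "u \<in> verts G" "{u, v} \<in> edges (gjoin G H)" for u v
    using that d simple_graph_edge[OF s(1), of u v] simple_graph_edge[OF s(2), of u v] by auto
  show "reachable (gjoin G H) x y \<longleftrightarrow> reachable G x y"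
    by (auto intro: reachable_within[OF _ x] reachable_mono dest: step)
  show "y \<in> verts G" if "reachable (gjoin G H) x y"
    by (rule reachable_closed[OF that x]) (use step in blast)
qed

lemma gjoin_commute: "gjoin G H = gjoin H G"
  by (auto simp: gjoin_def)

text \<open>Splits off the component of the root \<open>a\<close>, with \<open>S\<close> its
  remaining vertices. In the induction on the number of roots this contributes one factor C'. For
  injectivity, the component is recovered as the set reachable from \<open>a\<close>.\<close>

lemma forest_insert:
  assumes A: "finite A" "a \<notin> A" and M: "finite M" "insert a A \<inter> M = {}"
  shows "bij_betw (\<lambda>(S, G, H). gjoin G H)
    (SIGMA S:Pow M. conn (insert a S) \<times> forest A (A \<union> (M - S)))
    (forest (insert a A) (insert a A \<union> M))"
  (is "bij_betw ?f ?X ?Y")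
proof (rule bij_betwI')
  have X: "connected_graph G" "simple_graph G" "simple_graph H" "verts G = insert a S" "G \<in> \<G>" "H \<in> \<G>"
    "verts H = A \<union> (M - S)" "verts G \<inter> verts H = {}" "S \<subseteq> M"
    "\<And>x. x \<in> A \<union> (M - S) \<Longrightarrow> \<exists>!a. a \<in> A \<and> reachable H a x"
    if "(S, G, H) \<in> ?X" for S G H
    using that A M class_simple by (auto simp: conn_def forest_def)
  have ra: "reachable (gjoin G H) a x \<longleftrightarrow> x \<in> verts G" if "(S, G, H) \<in> ?X" for S G H x
  proof -
    note X = X[OF that]
    have "a \<in> verts G" using X by simp
    then show ?thesis
      using reachable_gjoin_disjoint[OF X(2,3,8), of a x] connected_reachable[OF X(1), of a x] by blast
  qed
  show "(?f p = ?f q) = (p = q)" if "p \<in> ?X" "q \<in> ?X" for p q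
  proof -
    obtain S G H where p: "p = (S, G, H)" by (cases p) auto
    obtain S' G' H' where q: "q = (S', G', H')" by (cases q) auto
    note Xp = X[OF that(1)[unfolded p]] and Xq = X[OF that(2)[unfolded q]]
    have "p = q" if eq: "gjoin G H = gjoin G' H'"
    proof -
      have G: "verts G = verts G'"
        using ra[OF \<open>p \<in> ?X\<close>[unfolded p]] ra[OF \<open>q \<in> ?X\<close>[unfolded q]] eq by auto
      then have S: "S = S'" using Xp(4,9) Xq(4,9) M by auto
      then have H: "verts H = verts H'" using Xp(7) Xq(7) by simp
      have "G = G'" using gjoin_one_vertex(3)[OF Xp(2,3), of a] gjoin_one_vertex(3)[OF Xq(2,3), of a]
          Xp(8) Xq(8) G eq by simp
      moreover have "H = H'" using gjoin_one_vertex(4)[OF Xp(2,3), of a] gjoin_one_vertex(4)[OF Xq(2,3), of a]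
          Xp(8) Xq(8) H eq by simp
      ultimately show ?thesis using S p q by simp
    qed
    then show ?thesis unfolding p q by auto
  qed
  show "?f p \<in> ?Y" if "p \<in> ?X" for p
  proof -
    obtain S G H where p: "p = (S, G, H)" by (cases p) auto
    note X' = X[OF that[unfolded p]]
    have "gjoin G H \<in> \<G>" using class_gjoin_one_vertex[OF X'(2,3), of a] X'(5,6,8) by simp
    moreover have "\<exists>!a'. a' \<in> insert a A \<and> reachable (gjoin G H) a' x" if x: "x \<in> insert a A \<union> M" for x
    proof (cases "x \<in> verts G")
      case True
      show ?thesis
      proof (rule ex1I[of _ a])
        show "a \<in> insert a A \<and> reachable (gjoin G H) a x"
          using True ra[OF \<open>p \<in> ?X\<close>[unfolded p]] by simp
        fix a' assume a': "a' \<in> insert a A \<and> reachable (gjoin G H) a' x"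
        have "a' \<notin> verts H"
          using a' True X'(8) reachable_gjoin_disjoint(2)[OF X'(3,2), of a' x] by (auto simp: gjoin_commute Int_commute)
        then show "a' = a" using a' X'(7) by auto
      qed
    next
      case False
      then have xH: "x \<in> A \<union> (M - S)" using x X'(4) by auto
      have "reachable (gjoin G H) a' x \<longleftrightarrow> reachable H a' x" if "a' \<in> A" for a'
        using reachable_gjoin_disjoint(1)[OF X'(3,2), of a' x] X'(7,8) that by (simp add: gjoin_commute Int_commute)
      moreover have "\<not> reachable (gjoin G H) a x"
        using False ra[OF \<open>p \<in> ?X\<close>[unfolded p]] by simp
      ultimately show ?thesis using X'(10)[OF xH] by blast
    qed
    moreover have "verts (gjoin G H) = insert a A \<union> M" using X'(4,7,9) by auto
    ultimately show ?thesis unfolding p by (auto simp add: forest_def)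
  qed
  show "\<exists>p\<in>?X. K = ?f p" if K: "K \<in> ?Y" for K
  proof -
    define V where "V = insert a A \<union> M"
    have K': "K \<in> \<G>" "verts K = V" "\<And>x. x \<in> V \<Longrightarrow> \<exists>!a'. a' \<in> insert a A \<and> reachable K a' x"
      using K unfolding forest_def V_def mem_Collect_eq by blast+
    have sK: "simple_graph K" by (rule class_simple[OF K'(1)])
    define T where "T = {x \<in> V. reachable K a x}"
    have TA: "T \<inter> A = {}"
    proof (rule ccontr)
      assume "T \<inter> A \<noteq> {}"
      then obtain a' where a': "a' \<in> A" "a' \<in> V" "reachable K a a'" by (auto simp: T_def)
      then have "a = a'" using K'(3)[of a'] by auto
      then show False using a' A by simp
    qed
    define S where "S = T - {a}"
    have SM: "S \<subseteq> M" using TA by (auto simp: S_def T_def V_def)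
    have T: "T = insert a S" by (auto simp: S_def T_def V_def)
    have rest: "V - T = A \<union> (M - S)" using TA M T SM A by (auto simp: V_def)
    define G where "G = induced K T"
    define H where "H = induced K (V - T)"
    have step: "v \<in> T" if "u \<in> T" "{u, v} \<in> edges K" for u v
      using that simple_graph_edge[OF sK that(2)] K'(2) by (auto simp: T_def intro: reachable_step)
    have side: "e \<subseteq> T \<or> e \<subseteq> V - T" if e: "e \<in> edges K" for e
    proof -
      obtain x y where xy: "e = {x, y}" "x \<in> V" "y \<in> V" using simple_graph_edgeE[OF sK e] K'(2) by metis
      have "{y, x} \<in> edges K" "{x, y} \<in> edges K" using e xy by (auto simp: insert_commute)
      then show ?thesis using step xy by blast
    qed
    have KGH: "K = gjoin G H"
      using side K'(2) by (auto simp: G_def H_def prod_eq_iff T_def)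
    have sG: "simple_graph G" and sH: "simple_graph H"
      using sK K'(2) by (auto simp: G_def H_def T_def intro!: simple_induced)
    have dis: "verts G \<inter> verts H = {}" by (auto simp: G_def H_def)
    have GH: "G \<in> \<G>" "H \<in> \<G>"
      using class_gjoin_one_vertex[OF sG sH, of a] dis K'(1) KGH by auto
    have "connected_graph G"
    proof (rule connected_graphI[OF sG])
      show "a \<in> verts G" by (simp add: G_def T)
      fix x assume "x \<in> verts G"
      then have "reachable (gjoin G H) a x" unfolding KGH[symmetric] by (simp add: G_def T_def)
      moreover have "a \<in> verts G" by (simp add: G_def T)
      ultimately show "reachable G a x"
        using reachable_gjoin_disjoint(1)[OF sG sH dis] by blast
    qed
    then have "G \<in> conn (insert a S)" using GH by (simp add: conn_def G_def T)
    moreover have "H \<in> forest A (A \<union> (M - S))"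
    proof -
      have "\<exists>!a'. a' \<in> A \<and> reachable H a' x" if x: "x \<in> V - T" for x
      proof -
        have "reachable K a' x \<longleftrightarrow> reachable H a' x" if "a' \<in> A" for a'
        proof -
          have "a' \<in> verts H" "verts H \<inter> verts G = {}" using that rest dis by (auto simp: H_def)
          then show ?thesis
            using reachable_gjoin_disjoint(1)[OF sH sG, of a' x] KGH[symmetric] gjoin_commute[of H G] by simp
        qed
        moreover have "\<not> reachable K a x" using x by (simp add: T_def)
        ultimately show ?thesis using K'(3)[of x] x by (metis DiffD1 insert_iff)
      qed
      moreover have "verts H = V - T" "A \<subseteq> V - T" using rest by (auto simp: H_def)
      ultimately show ?thesis unfolding rest[symmetric] forest_def using GH(2) by blast
    qed
    ultimately have "(S, G, H) \<in> ?X" using SM by blast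
    moreover have "K = ?f (S, G, H)" using KGH by simp
    ultimately show ?thesis by blast
  qed
qed

section \<open>The core of a graph whose root is not a cut vertex\<close>

definition noncut :: "nat set \<Rightarrow> nat \<Rightarrow> graph set" where
  "noncut V r = {G \<in> conn V. \<not> cut_vertex G r}"

lemma finite_noncut: "finite V \<Longrightarrow> finite (noncut V r)"
  unfolding noncut_def using finite_conn by simp

lemma connD:
  assumes "G \<in> conn V"
  shows "G \<in> \<G>" "connected_graph G" "verts G = V" "simple_graph G"
  using assms by (auto simp: conn_def connected_simple)

lemma biconD:
  assumes "G \<in> bicon V"
  shows "G \<in> \<G>" "two_connected G" "verts G = V" "simple_graph G"
  using assms by (auto simp: bicon_def two_connected_simple)

text \<open>The shape of a \<open>forest\<close> without membership in the class: when a given graph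
  is taken apart, membership of the parts is a conclusion, reached only after the blocks have been
  located.\<close>

definition rooted_forest :: "nat set \<Rightarrow> nat set \<Rightarrow> graph \<Rightarrow> bool" where
  "rooted_forest A V H \<longleftrightarrow> simple_graph H \<and> verts H = V \<and> A \<subseteq> V \<and>
     (\<forall>x\<in>V. \<exists>!a. a \<in> A \<and> reachable H a x)"

lemma forest_iff: "H \<in> forest A V \<longleftrightarrow> H \<in> \<G> \<and> rooted_forest A V H"
  using class_simple unfolding forest_def rooted_forest_def by blast

lemma rooted_forestD:
  assumes "rooted_forest A V H"
  shows "verts H = V" "A \<subseteq> V" "simple_graph H"
    and "\<And>x. x \<in> V \<Longrightarrow> \<exists>a\<in>A. reachable H a x"
    and "\<And>x a a'. x \<in> V \<Longrightarrow> a \<in> A \<Longrightarrow> a' \<in> A \<Longrightarrow> reachable H a x \<Longrightarrow> reachable H a' x \<Longrightarrow> a = a'"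
  using assms unfolding rooted_forest_def by blast+

lemma noncut_del:
  assumes "G \<in> noncut V r" "x \<in> V - {r}" "y \<in> V - {r}"
  shows "reachable (del_verts G {r}) x y"
proof (cases "r \<in> V")
  case True
  then show ?thesis
    using assms connected_reachable[of G x y] unfolding noncut_def conn_def cut_vertex_def by blast
next
  case False
  have G: "G \<in> conn V" using assms by (simp add: noncut_def)
  have "reachable G x y" using connected_reachable[OF connD(2)[OF G]] connD(3)[OF G] assms by simp
  moreover have "edges G \<subseteq> edges (del_verts G {r})"
    using False simple_graphD(1)[OF connD(4)[OF G]] connD(3)[OF G] by auto
  ultimately show ?thesis by (rule reachable_mono)
qed

text \<open>The ends of such an edge would be two roots in the same component.\<close>

lemma core_forest_no_edge:
  assumes H: "rooted_forest (U - {r}) (V - {r}) H" and e: "e \<in> edges H"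
  shows "\<not> e \<subseteq> U"
proof
  assume eU: "e \<subseteq> U"
  obtain x y where xy: "e = {x, y}" "x \<noteq> y" "x \<in> V - {r}" "y \<in> V - {r}"
    using simple_graph_edgeE[OF rooted_forestD(3)[OF H] e] rooted_forestD(1)[OF H] by metis
  then show False
    using rooted_forestD(5)[OF H xy(4), of x y] reachable_edge[of x y H] e eU by auto
qed

text \<open>A 2-connected subgraph with a vertex outside the core stays in the tree containing it,
  because the root of that tree separates it from the rest.\<close>
lemma core_forest_side:
  assumes K: "simple_graph K" "verts K = U" and H: "rooted_forest (U - {r}) (V - {r}) H"
    and r: "r \<in> U" and L: "subgraph L (gjoin K H)" "two_connected L"
  shows "subgraph L K \<or> subgraph L H"
proof (cases "verts L \<subseteq> U")
  case True
  have "edges L \<subseteq> edges K"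
  proof
    fix e assume e: "e \<in> edges L"
    then have "e \<subseteq> U" using True simple_graphD(1)[OF two_connected_simple[OF L(2)]] by blast
    then show "e \<in> edges K" using L(1) e core_forest_no_edge[OF H] by (auto simp: subgraph_def)
  qed
  then show ?thesis using True K two_connected_simple[OF L(2)] by (simp add: subgraph_def)
next
  case False
  have UV: "U - {r} \<subseteq> V - {r}" by (rule rooted_forestD(2)[OF H])
  obtain x where x: "x \<in> verts L" "x \<notin> U" using False by blast
  then have xV: "x \<in> V - {r}" using L(1) K rooted_forestD(1)[OF H] by (auto simp: subgraph_def)
  obtain a where a: "a \<in> U - {r}" "reachable H a x" using rooted_forestD(4)[OF H xV] by blast
  define S where "S = {y \<in> V - {r}. reachable H a y}"
  have SU: "S \<inter> U = {a}"
    using a UV rooted_forestD(5)[OF H, of _ _ a] by (auto simp: S_def)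
  have xS: "x \<in> S" using a xV by (simp add: S_def)
  have eH: "e \<subseteq> S \<or> e \<inter> S = {}" if eH': "e \<in> edges H" for e
  proof -
    obtain y z where yz: "e = {y, z}" "y \<in> V - {r}" "z \<in> V - {r}"
      using simple_graph_edgeE[OF rooted_forestD(3)[OF H] eH'] rooted_forestD(1)[OF H] by metis
    moreover have "{z, y} \<in> edges H" "{y, z} \<in> edges H" using eH' yz by (auto simp: insert_commute)
    ultimately show ?thesis unfolding S_def using reachable_step[of H a] by blast
  qed
  have eK: "e \<subseteq> U" "card e = 2" if "e \<in> edges K" for e using simple_graphD[OF K(1) that] K(2) by auto
  have "verts L \<subseteq> S \<or> verts L \<subseteq> (V \<union> U) - (S - {a})"
  proof (rule two_connected_side[OF L(2)])
    show "verts L \<subseteq> S \<union> ((V \<union> U) - (S - {a}))"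
      using L(1) K rooted_forestD(1)[OF H] by (auto simp: subgraph_def)
    show "S \<inter> ((V \<union> U) - (S - {a})) \<subseteq> {a}" by auto
    fix e assume "e \<in> edges L"
    then consider "e \<in> edges K" | "e \<in> edges H" using L(1) by (auto simp: subgraph_def)
    then show "e \<subseteq> S \<or> e \<subseteq> (V \<union> U) - (S - {a})"
    proof cases
      case 1
      then have "e \<subseteq> U" by (rule eK)
      moreover have "U \<inter> (S - {a}) = {}" using SU by blast
      ultimately show ?thesis by blast
    next
      case 2
      then have "e \<subseteq> V - {r}" using simple_graphD(1)[OF rooted_forestD(3)[OF H]] rooted_forestD(1)[OF H] by blast
      then show ?thesis using eH[OF 2] by blast
    qed
  qed
  moreover have "x \<in> S - {a}" using xS x a by auto
  ultimately have LS: "verts L \<subseteq> S" using x(1) by blast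
  have "edges L \<subseteq> edges H"
  proof
    fix e assume e: "e \<in> edges L"
    have "e \<notin> edges K"
    proof
      assume eK': "e \<in> edges K"
      have "e \<subseteq> S" using LS simple_graphD(1)[OF two_connected_simple[OF L(2)] e] by blast
      then have "e \<subseteq> {a}" using eK(1)[OF eK'] SU by blast
      then have "card e \<le> 1" using card_mono[of "{a}" e] by simp
      then show False using eK(2)[OF eK'] by simp
    qed
    then show "e \<in> edges H" using e L(1) by (auto simp: subgraph_def)
  qed
  moreover have "verts L \<subseteq> verts H" using LS rooted_forestD(1)[OF H] by (auto simp: S_def)
  ultimately show ?thesis using two_connected_simple[OF L(2)] by (simp add: subgraph_def)
qed

lemma core_forest_class:
  assumes K: "simple_graph K" "verts K = U" and H: "rooted_forest (U - {r}) (V - {r}) H" and r: "r \<in> U"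
  shows "edges K \<inter> edges H = {}"
    and "block_of L (gjoin K H) \<longleftrightarrow> block_of L K \<or> block_of L H"
    and "gjoin K H \<in> \<G> \<longleftrightarrow> K \<in> \<G> \<and> H \<in> \<G>"
proof -
  show dis: "edges K \<inter> edges H = {}"
    using core_forest_no_edge[OF H] simple_graphD(1)[OF K(1)] K(2) by blast
  note sub = subgraph_gjoin[OF K(1) rooted_forestD(3)[OF H]]
  show "block_of L (gjoin K H) \<longleftrightarrow> block_of L K \<or> block_of L H"
    by (rule block_of_split[OF sub dis core_forest_side[OF K H r]])
  show "gjoin K H \<in> \<G> \<longleftrightarrow> K \<in> \<G> \<and> H \<in> \<G>"
    using class_split[OF simple_gjoin[OF K(1) rooted_forestD(3)[OF H]] sub dis core_forest_side[OF K H r]] .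
qed

lemma block_of_two_connected:
  assumes K: "two_connected K" shows "block_of L K \<longleftrightarrow> L = K"
proof
  assume "block_of L K"
  then show "L = K" using subgraph_refl[OF two_connected_simple[OF K]] K unfolding maximal_subgraph_def by blast
next
  assume "L = K"
  moreover have "block_of K K"
    using subgraph_refl[OF two_connected_simple[OF K]] K
    by (auto simp: maximal_subgraph_def subgraph_def prod_eq_iff)
  ultimately show "block_of L K" by simp
qed

text \<open>Every vertex other than \<open>r\<close> reaches the core within its own tree, which
  avoids \<open>r\<close>, and the core without \<open>r\<close> is still connected; so
  \<open>r\<close> does not separate. Blocks of the join are \<open>K\<close> and the blocks of
  \<open>H\<close>, and \<open>r\<close> is not a vertex of \<open>H\<close>.\<close>

lemma core_forest_noncut:
  assumes U: "r \<in> U" "U \<subseteq> V" and K: "K \<in> bicon U" and H: "H \<in> forest (U - {r}) (V - {r})"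
  shows "gjoin K H \<in> noncut V r"
    and "block_of L (gjoin K H) \<and> r \<in> verts L \<longleftrightarrow> L = K"
proof -
  note K' = biconD[OF K]
  have rf: "H \<in> \<G>" "rooted_forest (U - {r}) (V - {r}) H" using H by (simp_all add: forest_iff)
  note cf = core_forest_class[OF K'(4,3) rf(2) U(1)]
  have to_root: "\<exists>a\<in>U - {r}. reachable (del_verts (gjoin K H) {r}) a x" if x: "x \<in> V - {r}" for x
  proof -
    obtain a where a: "a \<in> U - {r}" "reachable H a x" using rooted_forestD(4)[OF rf(2) x] by blast
    have "edges H \<subseteq> edges (del_verts (gjoin K H) {r})"
      using simple_graphD(1)[OF rooted_forestD(3)[OF rf(2)]] rooted_forestD(1)[OF rf(2)] by auto
    then show ?thesis using a reachable_mono by blast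
  qed
  have core: "reachable (del_verts (gjoin K H) {r}) a a'" if "a \<in> U - {r}" "a' \<in> U - {r}" for a a'
    by (rule reachable_mono[OF two_connected_del[OF K'(2)]]) (use that K'(3) in auto)
  have V: "verts (gjoin K H) = V" using K'(3) rooted_forestD(1)[OF rf(2)] U by auto
  have "connected_graph (gjoin K H)"
  proof (rule connected_graphI)
    show "simple_graph (gjoin K H)" by (rule simple_gjoin[OF K'(4) rooted_forestD(3)[OF rf(2)]])
    show "r \<in> verts (gjoin K H)" using K'(3) U by simp
    fix x assume "x \<in> verts (gjoin K H)"
    show "reachable (gjoin K H) r x"
    proof (cases "x = r")
      case False
      then obtain a where a: "a \<in> U - {r}" "reachable (del_verts (gjoin K H) {r}) a x"
        using to_root[of x] \<open>x \<in> verts (gjoin K H)\<close> V by auto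
      have "reachable K r a" using connected_reachable[OF two_connected_connected[OF K'(2)]] K'(3) U a by simp
      then have "reachable (gjoin K H) r a" by (rule reachable_mono) simp
      moreover have "reachable (gjoin K H) a x" using a(2) by (rule reachable_mono) auto
      ultimately show ?thesis by (rule reachable_trans)
    qed simp
  qed
  moreover have "gjoin K H \<in> \<G>" using cf(3) K'(1) rf(1) by simp
  moreover have "\<not> cut_vertex (gjoin K H) r"
    unfolding cut_vertex_def V using to_root core by (meson reachable_sym reachable_trans)
  ultimately show "gjoin K H \<in> noncut V r" using V by (simp add: noncut_def conn_def)
  have "\<not> (block_of L H \<and> r \<in> verts L)"
    using rooted_forestD(1)[OF rf(2)] by (auto simp: maximal_subgraph_def subgraph_def)
  then show "block_of L (gjoin K H) \<and> r \<in> verts L \<longleftrightarrow> L = K"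
    unfolding cf(2) block_of_two_connected[OF K'(2)] using K'(3) U(1) by blast
qed

lemma two_connected_single_edge:
  assumes G: "simple_graph G" "{x, y} \<in> edges G"
  shows "two_connected (induced G {x, y})"
proof (rule two_connectedI)
  note xy = simple_graph_edge[OF G]
  have e: "{x, y} \<in> edges (induced G {x, y})" using G by simp
  show "connected_graph (induced G {x, y})"
  proof (rule connected_graphI[of _ x])
    show "simple_graph (induced G {x, y})" using G xy by (intro simple_induced) auto
    show "reachable (induced G {x, y}) x z" if "z \<in> verts (induced G {x, y})" for z
      using that reachable_edge[OF e] by auto
  qed simp
  show "2 \<le> card (verts (induced G {x, y}))" using xy by simp
qed (use simple_graph_edge[OF G] in auto)

text \<open>The core is induced by a maximal \<open>U\<close> in the family below, which is nonempty
  because some edge at \<open>r\<close> exists. By \<open>ear\<close>, the edges outside the core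
  join no two vertices of \<open>U\<close>. Hence every component they form has exactly one vertex
  of \<open>U\<close>, and the component of \<open>r\<close> is trivial because \<open>r\<close> is
  not a cut vertex.\<close>

lemma noncut_core_exists:
  assumes G: "G \<in> noncut V r" and V: "finite V" "r \<in> V" "V \<noteq> {r}"
  obtains U K H where "r \<in> U" "U \<subseteq> V" "K \<in> bicon U" "H \<in> forest (U - {r}) (V - {r})" "G = gjoin K H"
proof -
  have Gc: "G \<in> conn V" using G by (simp add: noncut_def)
  note G' = connD[OF Gc]
  define \<U> where "\<U> = {U. r \<in> U \<and> U \<subseteq> V \<and> two_connected (induced G U)}"
  have "\<U> \<noteq> {}"
  proof -
    obtain w where w: "w \<in> V" "w \<noteq> r" using V by blast
    have "\<exists>y. {r, y} \<in> edges G"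
    proof (rule ccontr)
      assume no: "\<nexists>y. {r, y} \<in> edges G"
      have "reachable G r w" using connected_reachable[OF G'(2)] G'(3) V w by simp
      then have "w \<in> {r}" by (rule reachable_closed) (use no in auto)
      then show False using w by simp
    qed
    then obtain y where y: "{r, y} \<in> edges G" by blast
    have "{r, y} \<in> \<U>"
      unfolding \<U>_def using two_connected_single_edge[OF G'(4) y] simple_graph_edge[OF G'(4) y] G'(3) by simp
    then show ?thesis by blast
  qed
  moreover have "finite \<U>" unfolding \<U>_def by (rule finite_subset[of _ "Pow V"]) (use V in auto)
  ultimately obtain U where U: "U \<in> \<U>" and max: "\<And>W. W \<in> \<U> \<Longrightarrow> U \<subseteq> W \<Longrightarrow> W = U"
    using finite_has_maximal[of \<U>] by blast
  have rU: "r \<in> U" and UV: "U \<subseteq> V" and bic: "two_connected (induced G U)" using U by (auto simp: \<U>_def)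
  define K where "K = induced G U"
  define H' where "H' = (verts G, edges G - edges K)"
  have H'[simp]: "verts H' = V" "edges H' = edges G - edges K" by (simp_all add: H'_def G'(3))
  have uniq: "u = u'" if uu: "u \<in> U" "u' \<in> U" "reachable H' u u'" for u u'
  proof (rule ccontr)
    assume "u \<noteq> u'"
    then obtain W where "U \<subset> W" "W \<subseteq> V" "two_connected (induced G W)"
      using ear[OF G'(4) _ bic uu(1,2) _ uu(3)[unfolded H'_def K_def]] UV G'(3) by metis
    then show False using max[of W] rU by (auto simp: \<U>_def)
  qed
  have ex: "\<exists>u\<in>U. reachable H' u x" if x: "x \<in> V" for x
  proof -
    have "reachable G r x" using connected_reachable[OF G'(2)] G'(3) V x by simp
    then have "x \<in> {x. \<exists>u\<in>U. reachable H' u x}"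
    proof (rule reachable_closed)
      fix y z assume y: "y \<in> {x. \<exists>u\<in>U. reachable H' u x}" and e: "{y, z} \<in> edges G"
      show "z \<in> {x. \<exists>u\<in>U. reachable H' u x}"
      proof (cases "{y, z} \<in> edges K")
        case True
        then show ?thesis by (auto simp: K_def intro!: bexI[of _ z])
      next
        case False
        then have "{y, z} \<in> edges H'" using e by simp
        then show ?thesis using y reachable_step[of H' _ y z] by blast
      qed
    qed (use rU in \<open>auto intro!: bexI[of _ r]\<close>)
    then show ?thesis by simp
  qed
  have root: "x = r" if x: "reachable H' r x" for x
  proof (rule ccontr)
    assume xr: "x \<noteq> r"
    have "\<not> U \<subseteq> {r}"
    proof
      assume "U \<subseteq> {r}"
      then have "card U \<le> 1" using card_mono[of "{r}" U] by simp
      then show False using bic by (simp add: two_connected_def)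
    qed
    then obtain w where w: "w \<in> U" "w \<noteq> r" by blast
    \<comment> \<open>\<open>S\<close> cannot be left once \<open>r\<close> is deleted: by
      \<open>uniq\<close> it contains no vertex of \<open>U\<close>, so no edge at its vertices
      belongs to the core. Yet without \<open>r\<close> the vertex \<open>x\<close> still reaches
      \<open>w\<close> in \<open>U\<close>.\<close>
    define S where "S = {y. y \<noteq> r \<and> reachable H' r y}"
    have "x \<in> V" by (rule reachable_closed[OF x V(2)]) (use simple_graph_edge[OF G'(4)] G'(3) in auto)
    have "reachable (del_verts G {r}) x w"
      using w UV \<open>x \<in> V\<close> xr by (intro noncut_del[OF G]) auto
    then have "w \<in> S"
    proof (rule reachable_closed)
      show "x \<in> S" using x xr by (simp add: S_def)
      fix y z assume y: "y \<in> S" and e: "{y, z} \<in> edges (del_verts G {r})"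
      have "y \<notin> U" using y uniq[of r y] rU by (auto simp: S_def)
      then have "{y, z} \<in> edges H'" using e by (auto simp: K_def)
      then have "reachable H' r z" using y by (auto simp: S_def intro: reachable_step)
      then show "z \<in> S" using e by (auto simp: S_def)
    qed
    then show False using uniq[of r w] rU w by (auto simp: S_def)
  qed
  define H where "H = (V - {r}, edges G - edges K)"
  have H[simp]: "verts H = V - {r}" "edges H = edges G - edges K" by (simp_all add: H_def)
  have reach_eq: "reachable H x y \<longleftrightarrow> reachable H' x y" for x y by (simp add: reachable_def)
  have no_r: "r \<notin> e" if eGK: "e \<in> edges G - edges K" for e
  proof
    assume "r \<in> e"
    obtain y where y: "e = {r, y}" "y \<noteq> r"
      using \<open>r \<in> e\<close> simple_graph_edgeE[OF G'(4), of e] eGK by (metis DiffD1 insert_commute insertE singletonD)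
    then have "reachable H' r y" using eGK by (intro reachable_edge) auto
    then show False using root y by blast
  qed
  have sH: "simple_graph H"
    unfolding simple_graph_def using V no_r simple_graphD[OF G'(4)] G'(3) by auto
  have sK: "simple_graph K" "verts K = U" using two_connected_simple[OF bic] by (simp_all add: K_def)
  have GKH: "G = gjoin K H" using UV rU G'(3) by (auto simp: prod_eq_iff K_def)
  have forest_prop: "\<exists>!a. a \<in> U - {r} \<and> reachable H a x" if x: "x \<in> V - {r}" for x
  proof -
    obtain u where u: "u \<in> U" "reachable H' u x" using ex x by blast
    have "u \<noteq> r" using root u(2) x by auto
    moreover have "a = u" if "a \<in> U" "reachable H' a x" for a
      using uniq[OF that(1) u(1) reachable_trans[OF that(2) reachable_sym[OF u(2)]]] .
    ultimately show ?thesis unfolding reach_eq using u by blast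
  qed
  have rf: "rooted_forest (U - {r}) (V - {r}) H"
    unfolding rooted_forest_def using sH forest_prop UV by auto
  have "K \<in> \<G> \<and> H \<in> \<G>"
    using core_forest_class(3)[OF sK rf rU] G'(1) unfolding GKH[symmetric] by simp
  then have "K \<in> bicon U" "H \<in> forest (U - {r}) (V - {r})"
    using bic rf by (auto simp: bicon_def K_def forest_iff)
  then show thesis using that rU UV GKH by blast
qed

lemma core_eq:
  assumes "0 \<in> U" "U \<subseteq> V" "K \<in> bicon U" "H \<in> forest (U - {0}) (V - {0})"
  shows "core (gjoin K H) = K"
  unfolding core_def using core_forest_noncut(2)[OF assms] by simp

text \<open>Injective since \<open>K\<close> is the only block of \<open>gjoin K H\<close> that contains \<open>r\<close>.\<close>
lemma bij_core:
  assumes V: "finite V" "r \<in> V" "V \<noteq> {r}"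
  shows "bij_betw (\<lambda>(D, K, H). gjoin K H)
    (SIGMA D:Pow (V - {r}). bicon (insert r D) \<times> forest D (V - {r})) (noncut V r)"
  (is "bij_betw ?f ?X ?Y")
proof (rule bij_betwI')
  have X: "K \<in> bicon (insert r D)" "H \<in> forest (insert r D - {r}) (V - {r})" "insert r D \<subseteq> V" "D = verts K - {r}"
    "verts H = V - {r}" "simple_graph K" "simple_graph H" "verts K = insert r D"
    if "(D, K, H) \<in> ?X" for D K H
  proof -
    have D: "D \<subseteq> V - {r}" and K: "K \<in> bicon (insert r D)" and H: "H \<in> forest D (V - {r})" using that by auto
    have "insert r D - {r} = D" using D by auto
    then show "K \<in> bicon (insert r D)" "H \<in> forest (insert r D - {r}) (V - {r})" "insert r D \<subseteq> V" "D = verts K - {r}"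
      "verts H = V - {r}" "simple_graph K" "simple_graph H" "verts K = insert r D"
      using K H D V biconD[OF K] rooted_forestD(1,3)[of D "V - {r}" H] by (auto simp: forest_iff)
  qed
  show "(?f p = ?f q) = (p = q)" if "p \<in> ?X" "q \<in> ?X" for p q
  proof -
    obtain D K H where p: "p = (D, K, H)" by (cases p) auto
    obtain D' K' H' where q: "q = (D', K', H')" by (cases q) auto
    note Xp = X[OF that(1)[unfolded p]] and Xq = X[OF that(2)[unfolded q]]
    have "p = q" if eq: "gjoin K H = gjoin K' H'"
    proof -
      have K: "K = K'"
        using core_forest_noncut(2)[OF _ Xp(3,1,2), of K] core_forest_noncut(2)[OF _ Xq(3,1,2), of K] eq by simp
      then have D: "D = D'" using Xp(4) Xq(4) by simp
      have "edges K \<inter> edges H = {}" "edges K' \<inter> edges H' = {}"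
        using core_forest_class(1)[OF Xp(6,8)] core_forest_class(1)[OF Xq(6,8)] Xp(2) Xq(2)
        unfolding forest_iff by blast+
      moreover have "edges K \<union> edges H = edges K' \<union> edges H'"
        using arg_cong[OF eq, of snd] by simp
      ultimately have "edges H = edges H'" using K by blast
      then have "H = H'" using Xp(5) Xq(5) by (simp add: prod_eq_iff)
      then show ?thesis using K D p q by simp
    qed
    then show ?thesis unfolding p q by auto
  qed
  show "?f p \<in> ?Y" if "p \<in> ?X" for p
  proof -
    obtain D K H where p: "p = (D, K, H)" by (cases p) auto
    note Xp = X[OF that(1)[unfolded p]]
    show ?thesis unfolding p using core_forest_noncut(1)[OF _ Xp(3,1,2)] by simp
  qed
  show "\<exists>p\<in>?X. G = ?f p" if G: "G \<in> ?Y" for G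
  proof -
    obtain U K H where U: "r \<in> U" "U \<subseteq> V" "K \<in> bicon U" "H \<in> forest (U - {r}) (V - {r})" "G = gjoin K H"
      using noncut_core_exists[OF G V] by blast
    then have "(U - {r}, K, H) \<in> ?X" by (auto simp: insert_absorb)
    moreover have "G = ?f (U - {r}, K, H)" using U(5) by simp
    ultimately show ?thesis by blast
  qed
qed

section \<open>Splitting a rooted connected graph at its root\<close>

lemma noncut_gjoin_reach:
  assumes G1: "G1 \<in> noncut V1 r" and G2: "G2 \<in> conn V2" and V: "V1 \<inter> V2 = {r}" "w \<in> V1 - {r}"
  shows "{x. x \<noteq> r \<and> reachable (del_verts (gjoin G1 G2) {r}) w x} = V1 - {r}"
proof (intro equalityI subsetI)
  fix x
  assume "x \<in> V1 - {r}"
  then have "reachable (del_verts G1 {r}) w x" using noncut_del[OF G1 V(2)] by simp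
  then show "x \<in> {x. x \<noteq> r \<and> reachable (del_verts (gjoin G1 G2) {r}) w x}"
    using \<open>x \<in> V1 - {r}\<close> by (auto elim: reachable_mono)
next
  have G1c: "G1 \<in> conn V1" using G1 by (simp add: noncut_def)
  fix x
  assume "x \<in> {x. x \<noteq> r \<and> reachable (del_verts (gjoin G1 G2) {r}) w x}"
  then have "reachable (del_verts (gjoin G1 G2) {r}) w x" by simp
  then show "x \<in> V1 - {r}"
  proof (rule reachable_closed[OF _ V(2)])
    fix u v assume u: "u \<in> V1 - {r}" and e: "{u, v} \<in> edges (del_verts (gjoin G1 G2) {r})"
    have "{u, v} \<notin> edges G2"
      using simple_graph_edge(1)[OF connD(4)[OF G2], of u v] connD(3)[OF G2] u V by blast
    then show "v \<in> V1 - {r}"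
      using e simple_graph_edge(2)[OF connD(4)[OF G1c], of u v] connD(3)[OF G1c] by auto
  qed
qed

lemma conn_gjoin:
  assumes G1: "G1 \<in> conn V1" and G2: "G2 \<in> conn V2" and V: "V1 \<inter> V2 = {r}"
  shows "gjoin G1 G2 \<in> conn (V1 \<union> V2)"
proof -
  note G1' = connD[OF G1] and G2' = connD[OF G2]
  have "gjoin G1 G2 \<in> \<G>"
    using class_gjoin_one_vertex[OF G1'(4) G2'(4), of r] G1' G2' V by simp
  moreover have "connected_graph (gjoin G1 G2)"
  proof (rule connected_graphI)
    show "simple_graph (gjoin G1 G2)" by (rule simple_gjoin[OF G1'(4) G2'(4)])
    show "r \<in> verts (gjoin G1 G2)" using V G1'(3) by auto
    fix x assume x: "x \<in> verts (gjoin G1 G2)"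
    have "reachable G1 r x \<or> reachable G2 r x"
      using x connected_reachable[OF G1'(2), of r x] connected_reachable[OF G2'(2), of r x] V G1'(3) G2'(3) by auto
    then show "reachable (gjoin G1 G2) r x" by (auto elim: reachable_mono)
  qed
  ultimately show ?thesis using G1'(3) G2'(3) by (simp add: conn_def)
qed

text \<open>On generating functions this is the derivative of \<open>C' = exp (B' \<circ> F)\<close>; working with it
  avoids set partitions.\<close>
lemma bij_split_root:
  assumes V: "finite V" "r \<in> V" "w \<in> V" "r \<noteq> w"
  shows "bij_betw (\<lambda>(S, G1, G2). gjoin G1 G2)
    (SIGMA S:Pow (V - {r, w}). noncut (insert r (insert w S)) r \<times> conn (V - insert w S)) (conn V)"
  (is "bij_betw ?f ?X ?Y")
proof (rule bij_betwI')
  have X: "G1 \<in> noncut (insert r (insert w S)) r" "G1 \<in> conn (insert r (insert w S))" "G2 \<in> conn (V - insert w S)"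
    "insert r (insert w S) \<inter> (V - insert w S) = {r}" "insert r (insert w S) \<union> (V - insert w S) = V"
    "S \<subseteq> V - {r, w}" "w \<in> insert r (insert w S) - {r}"
    if "(S, G1, G2) \<in> ?X" for S G1 G2
    using that V by (auto simp: noncut_def)
  show "(?f p = ?f q) = (p = q)" if "p \<in> ?X" "q \<in> ?X" for p q
  proof -
    obtain S G1 G2 where p: "p = (S, G1, G2)" by (cases p) auto
    obtain S' G1' G2' where q: "q = (S', G1', G2')" by (cases q) auto
    note Xp = X[OF that(1)[unfolded p]] and Xq = X[OF that(2)[unfolded q]]
    have "p = q" if eq: "gjoin G1 G2 = gjoin G1' G2'"
    proof -
      \<comment> \<open>The first part is recovered from the join: apart from \<open>r\<close>, it
        consists of what \<open>w\<close> reaches without passing \<open>r\<close>. The marked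
        vertex \<open>w\<close> thus makes the splitting unique.\<close>
      have "insert r (insert w S) - {r} = insert r (insert w S') - {r}"
        using noncut_gjoin_reach[OF Xp(1,3,4,7)] noncut_gjoin_reach[OF Xq(1,3,4,7)] eq by simp
      then have S: "S = S'" using Xp(6) Xq(6) V by (simp add: insert_Diff_if) blast
      have "verts G1 \<inter> verts G2 \<subseteq> {r}" "verts G1' \<inter> verts G2' \<subseteq> {r}"
        using connD(3)[OF Xp(2)] connD(3)[OF Xp(3)] connD(3)[OF Xq(2)] connD(3)[OF Xq(3)] Xp(4) Xq(4) by auto
      then have "G1 = G1'" "G2 = G2'"
        using gjoin_one_vertex(3,4)[OF connD(4)[OF Xp(2)] connD(4)[OF Xp(3)], of r]
          gjoin_one_vertex(3,4)[OF connD(4)[OF Xq(2)] connD(4)[OF Xq(3)], of r]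
          connD(3)[OF Xp(2)] connD(3)[OF Xp(3)] connD(3)[OF Xq(2)] connD(3)[OF Xq(3)] eq S by simp_all
      then show ?thesis using S p q by simp
    qed
    then show ?thesis unfolding p q by auto
  qed
  show "?f p \<in> ?Y" if "p \<in> ?X" for p
  proof -
    obtain S G1 G2 where p: "p = (S, G1, G2)" by (cases p) auto
    note Xp = X[OF that[unfolded p]]
    show ?thesis unfolding p using conn_gjoin[OF Xp(2,3,4)] Xp(5) by simp
  qed
  show "\<exists>p\<in>?X. G = ?f p" if G: "G \<in> ?Y" for G
  proof -
    note G' = connD[OF G]
    \<comment> \<open>The component of \<open>w\<close> after deletion of the root. Together with
      \<open>r\<close> it forms the first part, in which \<open>r\<close> is not a cut vertex
      because \<open>T\<close> is connected by itself.\<close>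
    define T where "T = {x. x \<noteq> r \<and> reachable (del_verts G {r}) w x}"
    have TV: "T \<subseteq> V"
    proof
      fix x assume "x \<in> T"
      then have "reachable (del_verts G {r}) w x" by (simp add: T_def)
      then show "x \<in> V"
        by (rule reachable_closed[OF _ V(3)]) (use simple_graph_edge[OF G'(4)] G'(3) in auto)
    qed
    have wT: "w \<in> T" and rT: "r \<notin> T" using V by (auto simp: T_def)
    have step: "v \<in> T" if "u \<in> T" "{u, v} \<in> edges G" "v \<noteq> r" for u v
    proof -
      have "{u, v} \<in> edges (del_verts G {r})" using that rT by auto
      then show ?thesis using that reachable_step unfolding T_def by blast
    qed
    define G1 where "G1 = induced G (insert r T)"
    define G2 where "G2 = induced G (V - T)"
    have v12: "verts G1 = insert r T" "verts G2 = V - T" by (simp_all add: G1_def G2_def)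
    have s12: "simple_graph G1" "simple_graph G2"
      using TV V G'(3) G'(4) by (auto simp: G1_def G2_def intro!: simple_induced)
    have side: "e \<subseteq> insert r T \<or> e \<subseteq> V - T" if e: "e \<in> edges G" for e
    proof -
      obtain x y where xy: "e = {x, y}" "x \<in> V" "y \<in> V" using simple_graph_edgeE[OF G'(4) e] G'(3) by metis
      have "{y, x} \<in> edges G" "{x, y} \<in> edges G" using e xy by (auto simp: insert_commute)
      then show ?thesis using step xy by blast
    qed
    have "verts G = verts (gjoin G1 G2)" using TV V G'(3) v12 by auto
    moreover have "edges G = edges (gjoin G1 G2)" using side by (auto simp: G1_def G2_def)
    ultimately have GJ: "G = gjoin G1 G2" by (simp add: prod_eq_iff)
    have meet: "verts G1 \<inter> verts G2 \<subseteq> {r}" using v12 by auto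
    have cl: "G1 \<in> \<G>" "G2 \<in> \<G>"
      using class_gjoin_one_vertex[OF s12 meet] G'(1) unfolding GJ[symmetric] by auto
    have inT: "reachable (del_verts G1 {r}) w x" if "x \<in> T" for x
    proof -
      have "reachable (del_verts G {r}) w x" using that by (simp add: T_def)
      then show ?thesis
      proof (rule reachable_within[OF _ wT])
        fix u v assume "u \<in> T" "{u, v} \<in> edges (del_verts G {r})"
        then show "{u, v} \<in> edges (del_verts G1 {r}) \<and> v \<in> T" using step[of u v] by (auto simp: G1_def)
      qed
    qed
    \<comment> \<open>Some edge joins \<open>T\<close> to the root: \<open>w\<close> reaches
      \<open>r\<close>, and \<open>r\<close> is the only vertex at which a walk can leave
      \<open>T\<close>.\<close>
    obtain s where s: "s \<in> T" "{s, r} \<in> edges G"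
    proof -
      have "\<exists>s\<in>T. {s, r} \<in> edges G"
      proof (rule ccontr)
        assume no: "\<not> ?thesis"
        have "reachable G w r" using connected_reachable[OF G'(2)] V G'(3) by simp
        then have "r \<in> T"
        proof (rule reachable_closed[OF _ wT])
          fix u v assume "u \<in> T" "{u, v} \<in> edges G"
          then show "v \<in> T" using no step[of u v] by blast
        qed
        then show False using rT by simp
      qed
      then show thesis using that by blast
    qed
    have "connected_graph G1"
    proof (rule connected_graphI[OF s12(1)])
      show "w \<in> verts G1" using wT v12 by simp
      have T1: "reachable G1 w x" if "x \<in> T" for x
        using inT[OF that] by (rule reachable_mono) auto
      fix x assume "x \<in> verts G1"
      then consider "x = r" | "x \<in> T" using v12 by auto
      then show "reachable G1 w x"
      proof cases
        case 1
        have "{s, r} \<in> edges G1" using s by (auto simp: G1_def)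
        then show ?thesis unfolding 1 using T1[OF s(1)] reachable_step by blast
      qed (rule T1)
    qed
    moreover have "\<not> cut_vertex G1 r"
    proof -
      have "reachable (del_verts G1 {r}) x y" if "x \<in> T" "y \<in> T" for x y
        using reachable_trans[OF reachable_sym[OF inT[OF that(1)]] inT[OF that(2)]] .
      then show ?thesis using rT by (auto simp: cut_vertex_def v12)
    qed
    ultimately have "G1 \<in> noncut (insert r T) r"
      using cl v12 by (simp add: noncut_def conn_def)
    moreover have "G2 \<in> conn (V - T)"
    proof -
      have "connected_graph G2"
      proof (rule connected_graphI[OF s12(2)])
        show "r \<in> verts G2" using v12 V rT by simp
        fix x assume x: "x \<in> verts G2"
        have "reachable G r x" using connected_reachable[OF G'(2)] V x v12 G'(3) by simp
        \<comment> \<open>A walk from \<open>r\<close> may pass through \<open>T\<close>, but it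
          returns from there only through \<open>r\<close>. So nothing needs to be recorded about
          vertices in \<open>T\<close>, and the walk can be restarted at \<open>r\<close> in the
          second part.\<close>
        then have "x \<in> T \<union> {x \<in> V - T. reachable G2 r x}"
        proof (rule reachable_closed)
          show "r \<in> T \<union> {x \<in> V - T. reachable G2 r x}" using V rT by simp
          fix u v assume u: "u \<in> T \<union> {x \<in> V - T. reachable G2 r x}" and e: "{u, v} \<in> edges G"
          show "v \<in> T \<union> {x \<in> V - T. reachable G2 r x}"
          proof (cases "v \<in> T \<or> v = r")
            case True then show ?thesis using V rT by auto
          next
            case False
            then have "u \<notin> T" using step[of u v] e by blast
            moreover have "v \<in> V" using simple_graph_edge(2)[OF G'(4) e] G'(3) by simp
            ultimately have "{u, v} \<in> edges G2" using u e False by (auto simp: G2_def)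
            then show ?thesis using u \<open>u \<notin> T\<close> \<open>v \<in> V\<close> False reachable_step[of G2 r u v] by auto
          qed
        qed
        then show "reachable G2 r x" using x v12 by auto
      qed
      then show ?thesis using cl v12 by (simp add: conn_def)
    qed
    moreover have "insert w (T - {w}) = T" using wT by auto
    moreover have "T - {w} \<in> Pow (V - {r, w})" using TV rT by auto
    ultimately have "(T - {w}, G1, G2) \<in> ?X" by auto
    moreover have "G = ?f (T - {w}, G1, G2)" using GJ by simp
    ultimately show ?thesis by blast
  qed
qed

end

section \<open>Counting\<close>

lemma sum_Pow_card:
  fixes h :: "nat \<Rightarrow> 'a::comm_semiring_1"
  assumes "finite M"
  shows "(\<Sum>S\<in>Pow M. h (card S)) = (\<Sum>j\<le>card M. of_nat (card M choose j) * h j)"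
proof -
  have "(\<Sum>S\<in>Pow M. h (card S)) = (\<Sum>j\<le>card M. \<Sum>S\<in>{S\<in>Pow M. card S = j}. h (card S))"
    using assms by (intro sum.group[symmetric]) (auto intro: card_mono)
  also have "\<dots> = (\<Sum>j\<le>card M. \<Sum>S\<in>{S. S \<subseteq> M \<and> card S = j}. h j)"
    by (intro sum.cong) auto
  also have "\<dots> = (\<Sum>j\<le>card M. of_nat (card M choose j) * h j)"
    using assms by (simp add: n_subsets)
  finally show ?thesis .
qed

text \<open>The product rule for exponential generating functions: pairs of structures on a subset
  and on its complement.\<close>

lemma sum_Pow_egf:
  fixes f g :: "'a::field_char_0 fps"
  assumes "finite M"
  shows "(\<Sum>S\<in>Pow M. (fact (card S) * f $ card S) * (fact (card M - card S) * g $ (card M - card S))) =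
    fact (card M) * (f * g) $ card M"
proof -
  have "(\<Sum>S\<in>Pow M. (fact (card S) * f $ card S) * (fact (card M - card S) * g $ (card M - card S))) =
    (\<Sum>j\<le>card M. of_nat (card M choose j) * ((fact j * f $ j) * (fact (card M - j) * g $ (card M - j))))"
    by (rule sum_Pow_card[OF assms])
  also have "\<dots> = (\<Sum>j\<le>card M. fact (card M) * (f $ j * g $ (card M - j)))"
  proof (intro sum.cong HOL.refl)
    fix j assume "j \<in> {..card M}"
    then have "of_nat (card M choose j) * (fact j * fact (card M - j)) = (fact (card M) :: 'a)"
      using binomial_fact[of j "card M", where 'a = 'a] by simp
    then show "of_nat (card M choose j) * ((fact j * f $ j) * (fact (card M - j) * g $ (card M - j))) =
        fact (card M) * (f $ j * g $ (card M - j))"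
      by (simp add: mult_ac)
  qed
  also have "\<dots> = fact (card M) * (f * g) $ card M"
    by (simp add: fps_mult_nth sum_distrib_left atMost_atLeast0)
  finally show ?thesis .
qed

context graph_class
begin

section \<open>From bijections to identities between generating functions\<close>

lemma C_fps_nth: "fps_nth (C_fps \<G>) n = of_nat (c n) / (fact n :: 'a::field_char_0)"
  by (simp add: C_fps_def egf_def c_def conn_def conj_assoc)

lemma B_fps_nth: "fps_nth (B_fps \<G>) n = of_nat (b n) / (fact n :: 'a::field_char_0)"
  by (simp add: B_fps_def egf_def b_def bicon_def conj_assoc)

definition C' :: "'a::field_char_0 fps" where "C' = fps_deriv (C_fps \<G>)"
definition B' :: "'a::field_char_0 fps" where "B' = fps_deriv (B_fps \<G>)"
definition F :: "'a::field_char_0 fps" where "F = fps_X * C'"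

lemma C'_nth: "fact n * fps_nth C' n = (of_nat (c (Suc n)) :: 'a::field_char_0)"
  by (simp add: C'_def C_fps_nth field_simps del: of_nat_Suc)

lemma B'_nth: "fact n * fps_nth B' n = (of_nat (b (Suc n)) :: 'a::field_char_0)"
  by (simp add: B'_def B_fps_nth field_simps del: of_nat_Suc)

lemma b_le_1: "n \<le> 1 \<Longrightarrow> b n = 0"
proof -
  assume "n \<le> 1"
  then have "bicon {..<n} = {}" by (auto simp: bicon_def two_connected_def)
  then show ?thesis by (simp add: b_def)
qed

lemma conn_singleton: "conn {v} = {({v}, {})}"
proof -
  have "G = ({v}, {})" if "G \<in> conn {v}" for G
  proof -
    have "edges G = {}"
    proof (rule equals0I)
      fix e assume e: "e \<in> edges G"
      have "card e \<le> card {v}" using simple_graphD(1)[OF connD(4)[OF that] e] connD(3)[OF that] by (intro card_mono) auto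
      then show False using simple_graphD(2)[OF connD(4)[OF that] e] by simp
    qed
    then show ?thesis using connD(3)[OF that] by (simp add: prod_eq_iff)
  qed
  moreover have "({v}, {}) \<in> conn {v}"
    using edgeless_in_class[of "{v}"] by (simp add: conn_def connected_graph_def simple_graph_def)
  ultimately show ?thesis by blast
qed

lemma c_1: "c (Suc 0) = 1"
  using card_conn[of "{0}"] by (simp add: conn_singleton)

text \<open>Tutte parts never gain vertices, so a single edge has no 3-connected component, and
  closure under these components puts it in every closed class. This supplies
  \<open>\<beta> 1 = 1\<close> and with it the aperiodicity of the step.\<close>

lemma b_2: "b 2 = 1"
proof -
  have "G = ({0, 1}, {{0, 1}})" if "G \<in> bicon {0, 1}" for G
  proof -
    note G = biconD[OF that]
    have "e = {0, 1}" if "e \<in> edges G" for e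
      using simple_graphD[OF G(4) that] G(3) by (intro card_subset_eq) auto
    moreover have "edges G \<noteq> {}" by (rule two_connected_edge[OF G(2)])
    ultimately have "edges G = {{0, 1}}" by blast
    then show ?thesis using G(3) by (simp add: prod_eq_iff)
  qed
  moreover have "({0, 1}, {{0, 1}}) \<in> bicon {0, 1}"
  proof -
    let ?G = "({0, 1}, {{0, 1}}) :: graph"
    have s: "simple_graph ?G" by (auto simp: simple_graph_def)
    have "two_connected (induced ?G {0, 1})" by (rule two_connected_single_edge[OF s]) simp
    moreover have "induced ?G {0, 1} = ?G" by (auto simp: induced_def)
    ultimately have two: "two_connected ?G" by simp
    have "\<not> three_component_of H ?G" for H
    proof
      assume "three_component_of H ?G"
      then obtain K where K: "block_of K ?G" "tutte_part K H" "three_connected H"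
        by (auto simp: three_component_of_def)
      have K': "verts K \<subseteq> {0, 1}" using K(1) by (auto simp: maximal_subgraph_def subgraph_def)
      have "verts H \<subseteq> verts K" using K(2)
      proof (induction rule: tutte_part.induct)
        case (split G A B H)
        then show ?case by (auto simp: two_separation_def)
      qed simp
      then have "card (verts H) \<le> card {0, 1 :: nat}" using K' by (intro card_mono) auto
      then show False using K(3) by (simp add: three_connected_def)
    qed
    then have "?G \<in> \<G>" using closed s unfolding closed_class_def by blast
    then show ?thesis using two by (simp add: bicon_def)
  qed
  ultimately have "bicon {0, 1} = {({0, 1}, {{0, 1}})}" by blast
  then show ?thesis using card_bicon[of "{0, 1}"] by (simp add: numeral_2_eq_2)
qed

lemma card_forest:
  assumes "finite A" "finite M" "A \<inter> M = {}"
  shows "of_nat (card (forest A (A \<union> M))) = fact (card M) * (C' ^ card A $ card M :: 'a::field_char_0)"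
  using assms
proof (induction A arbitrary: M rule: finite_induct)
  case empty
  then show ?case by (auto simp: forest_empty)
next
  case (insert a A)
  let ?X = "SIGMA S:Pow M. conn (insert a S) \<times> forest A (A \<union> (M - S))"
  have aM: "a \<notin> M" and AM: "A \<inter> M = {}" using insert.prems by auto
  have "card (forest (insert a A) (insert a A \<union> M)) = card ?X"
    using bij_betw_same_card[OF forest_insert[OF insert.hyps insert.prems]] by simp
  also have "\<dots> = (\<Sum>S\<in>Pow M. card (conn (insert a S) \<times> forest A (A \<union> (M - S))))"
    using insert.prems insert.hyps
    by (intro card_SigmaI) (auto intro!: finite_conn finite_forest finite_cartesian_product dest: finite_subset)
  also have "of_nat \<dots> = (\<Sum>S\<in>Pow M. of_nat (card (conn (insert a S))) * of_nat (card (forest A (A \<union> (M - S)))) :: 'a)"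
    by (simp add: card_cartesian_product)
  also have "\<dots> = (\<Sum>S\<in>Pow M. (fact (card S) * C' $ card S) *
      (fact (card M - card S) * C' ^ card A $ (card M - card S)))"
  proof (intro sum.cong HOL.refl)
    fix S assume S: "S \<in> Pow M"
    then have fS: "finite S" "a \<notin> S" using insert.prems aM by (auto dest: finite_subset)
    have "of_nat (card (forest A (A \<union> (M - S)))) = fact (card (M - S)) * (C' ^ card A $ card (M - S) :: 'a)"
      using insert.prems AM by (intro insert.IH) auto
    moreover have "card (M - S) = card M - card S" using S fS by (intro card_Diff_subset) auto
    moreover have "card (conn (insert a S)) = c (Suc (card S))"
      using fS by (simp add: card_conn)
    ultimately show "of_nat (card (conn (insert a S))) * of_nat (card (forest A (A \<union> (M - S)))) =
        (fact (card S) * C' $ card S) * (fact (card M - card S) * C' ^ card A $ (card M - card S) :: 'a)"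
      by (simp add: C'_nth)
  qed
  also have "\<dots> = fact (card M) * (C' * C' ^ card A) $ card M"
    by (rule sum_Pow_egf) (use insert.prems in simp)
  finally show ?case using insert.hyps by simp
qed

text \<open>The predicate \<open>P\<close> lets one count serve both for all graphs with a core and
  for those with a core of given size. For a core with \<open>k\<close> non-root vertices, the
  \<open>m - k\<close> others are distributed over \<open>k\<close> trees, giving C'^k in degree
  \<open>m - k\<close>; absorbing x^k turns this into F^k in degree \<open>m\<close>.\<close>

lemma core_sum:
  assumes "finite V" "0 \<in> V" "V \<noteq> {0}"
  defines "m \<equiv> card (V - {0})"
  shows "of_nat (card {G \<in> noncut V 0. P (core_size G)}) =
    (\<Sum>k\<le>m. if P k then fact m * (B' $ k * (F ^ k $ m)) else 0 :: 'a::field_char_0)"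
proof -
  let ?X = "\<lambda>D. bicon (insert 0 D) \<times> forest D (V - {0})"
  let ?f = "\<lambda>(D, K, H). gjoin K H"
  have size: "core_size (gjoin K H) = card D" if "D \<subseteq> V - {0}" "K \<in> bicon (insert 0 D)" "H \<in> forest D (V - {0})" for D K H
  proof -
    have "insert 0 D - {0} = D" using that by auto
    then have "core (gjoin K H) = K" using that assms(2) by (intro core_eq[of "insert 0 D" V]) auto
    then show ?thesis using \<open>insert 0 D - {0} = D\<close> biconD(3)[OF that(2)] by (simp add: core_size_def)
  qed
  have "bij_betw ?f (SIGMA D:{D \<in> Pow (V - {0}). P (card D)}. ?X D) {G \<in> noncut V 0. P (core_size G)}"
  proof (rule bij_betw_subset[OF bij_core[OF assms(1-3)]])
    have "(SIGMA D:{D \<in> Pow (V - {0}). P (card D)}. ?X D) =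
        {p \<in> SIGMA D:Pow (V - {0}). ?X D. P (core_size (?f p))}"
      using size by auto
    moreover have "noncut V 0 = ?f ` (SIGMA D:Pow (V - {0}). ?X D)"
      using bij_core[OF assms(1-3)] by (simp add: bij_betw_def)
    moreover have "g ` {p \<in> A. Q (g p)} = {G \<in> g ` A. Q G}" for g :: "nat set \<times> graph \<times> graph \<Rightarrow> graph" and A Q
      by blast
    ultimately show "?f ` (SIGMA D:{D \<in> Pow (V - {0}). P (card D)}. ?X D) = {G \<in> noncut V 0. P (core_size G)}"
      by simp
  qed auto
  then have "card {G \<in> noncut V 0. P (core_size G)} = card (SIGMA D:{D \<in> Pow (V - {0}). P (card D)}. ?X D)"
    by (simp add: bij_betw_same_card)
  also have "\<dots> = (\<Sum>D\<in>{D \<in> Pow (V - {0}). P (card D)}. card (?X D))"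
    using assms(1) by (intro card_SigmaI) (auto intro!: finite_bicon finite_forest finite_cartesian_product dest: finite_subset)
  also have "\<dots> = (\<Sum>D\<in>Pow (V - {0}). if P (card D) then card (?X D) else 0)"
    using assms(1) by (intro sum.inter_filter) auto
  also have "of_nat \<dots> = (\<Sum>D\<in>Pow (V - {0}). of_nat (if P (card D) then card (?X D) else 0) :: 'a)"
    by simp
  also have "\<dots> = (\<Sum>D\<in>Pow (V - {0}). if P (card D) then fact (card D) * B' $ card D *
      (fact (m - card D) * C' ^ card D $ (m - card D)) else 0)"
  proof (intro sum.cong HOL.refl)
    fix D assume D: "D \<in> Pow (V - {0})"
    then have fD: "finite D" "0 \<notin> D" using assms(1) by (auto dest: finite_subset)
    have "card (bicon (insert 0 D)) = b (Suc (card D))" using fD by (simp add: card_bicon)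
    moreover have "of_nat (card (forest D (D \<union> (V - {0} - D)))) =
        fact (card (V - {0} - D)) * (C' ^ card D $ card (V - {0} - D) :: 'a)"
      using fD assms(1) by (intro card_forest) auto
    moreover have "D \<union> (V - {0} - D) = V - {0}" using D by auto
    moreover have "card (V - {0} - D) = m - card D" unfolding m_def using D fD by (intro card_Diff_subset) auto
    ultimately show "of_nat (if P (card D) then card (?X D) else 0) =
       (if P (card D) then fact (card D) * B' $ card D * (fact (m - card D) * C' ^ card D $ (m - card D)) else 0 :: 'a)"
      by (simp add: B'_nth card_cartesian_product)
  qed
  also have "\<dots> = (\<Sum>k\<le>m. of_nat (m choose k) * (if P k then fact k * B' $ k *
      (fact (m - k) * C' ^ k $ (m - k)) else 0))"
    unfolding m_def using assms(1) by (intro sum_Pow_card) simp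
  also have "\<dots> = (\<Sum>k\<le>m. if P k then fact m * (B' $ k * (F ^ k $ m)) else 0)"
  proof (intro sum.cong HOL.refl)
    fix k assume k: "k \<in> {..m}"
    then have "of_nat (m choose k) * (fact k * fact (m - k)) = (fact m :: 'a)"
      using binomial_fact[of k m, where 'a = 'a] by simp
    moreover have "F ^ k $ m = (C' ^ k $ (m - k) :: 'a)"
      using k by (simp add: F_def power_mult_distrib fps_X_power_mult_nth)
    ultimately show "of_nat (m choose k) * (if P k then fact k * B' $ k * (fact (m - k) * C' ^ k $ (m - k)) else 0) =
       (if P k then fact m * (B' $ k * (F ^ k $ m)) else 0 :: 'a)"
      by (simp add: mult_ac)
  qed
  finally show ?thesis .
qed

lemma card_noncut:
  assumes "finite V" "0 \<in> V" "V \<noteq> {0}"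
  shows "of_nat (card (noncut V 0)) = fact (card (V - {0})) * ((B' oo F) $ card (V - {0}) :: 'a::field_char_0)"
  using core_sum[OF assms, of "\<lambda>_. True", where 'a = 'a]
  by (simp add: fps_compose_nth sum_distrib_left atMost_atLeast0)

lemma card_noncut_core_size:
  assumes "finite V" "0 \<in> V" "V \<noteq> {0}"
  shows "of_nat (card {G \<in> noncut V 0. core_size G = k}) =
    fact (card (V - {0})) * (B' $ k * (F ^ k $ card (V - {0})) :: 'a::field_char_0)"
proof (cases "k \<le> card (V - {0})")
  case True
  then show ?thesis using core_sum[OF assms, of "\<lambda>j. j = k", where 'a = 'a] by simp
next
  case False
  then have "F ^ k $ card (V - {0}) = (0 :: 'a)"
    by (simp add: F_def power_mult_distrib fps_X_power_mult_nth)
  moreover have "(\<Sum>j\<le>card (V - {0}). if j = k then fact (card (V - {0})) * (B' $ j * (F ^ j $ card (V - {0}))) else 0) = (0 :: 'a)"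
    using False by (intro sum.neutral) auto
  ultimately show ?thesis using core_sum[OF assms, of "\<lambda>j. j = k", where 'a = 'a] by simp
qed

text \<open>Take root 0 and mark vertex 1. Marking a vertex is differentiation, so the part at the
  root containing 1 is counted by the derivative of \<open>B' oo F\<close>, and the rest, again a
  connected graph at the same root, by \<open>C'\<close>.\<close>

lemma deriv_C': "fps_deriv C' = (fps_deriv (B' oo F) * C' :: 'a::field_char_0 fps)"
proof (rule fps_ext)
  fix n
  define V :: "nat set" where "V = {..<n + 2}"
  define M where "M = V - {0, 1}"
  have M: "finite M" "card M = n" "0 \<notin> M" "1 \<notin> M" by (auto simp: M_def V_def card_Diff_subset)
  have "card (conn V) = card (SIGMA S:Pow M. noncut (insert 0 (insert 1 S)) 0 \<times> conn (V - insert 1 S))"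
    using bij_betw_same_card[OF bij_split_root[of V 0 1]] by (simp add: V_def M_def)
  also have "\<dots> = (\<Sum>S\<in>Pow M. card (noncut (insert 0 (insert 1 S)) 0 \<times> conn (V - insert 1 S)))"
    using M by (intro card_SigmaI) (auto intro!: finite_noncut finite_conn finite_cartesian_product
        dest: finite_subset simp: V_def)
  also have "of_nat \<dots> = (\<Sum>S\<in>Pow M. of_nat (card (noncut (insert 0 (insert 1 S)) 0)) * of_nat (card (conn (V - insert 1 S))) :: 'a)"
    by (simp add: card_cartesian_product)
  also have "\<dots> = (\<Sum>S\<in>Pow M. (fact (card S) * fps_deriv (B' oo F) $ card S) * (fact (card M - card S) * C' $ (card M - card S)))"
  proof (intro sum.cong HOL.refl)
    fix S assume S: "S \<in> Pow M"
    then have fS: "finite S" "0 \<notin> S" "1 \<notin> S" using M by (auto dest: finite_subset)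
    have "insert 0 (insert 1 S) - {0} = insert 1 S" using fS by auto
    then have "of_nat (card (noncut (insert 0 (insert 1 S)) 0)) = fact (Suc (card S)) * ((B' oo F) $ Suc (card S) :: 'a)"
      using card_noncut[of "insert 0 (insert 1 S)", where 'a = 'a] fS by auto
    moreover have "card (V - insert 1 S) = Suc (card M - card S)"
    proof -
      have "V - insert 1 S = insert 0 (M - S)" using fS by (auto simp: M_def V_def)
      then show ?thesis using M S fS by (simp add: card_Diff_subset)
    qed
    moreover have "finite (V - insert 1 S)" by (simp add: V_def)
    ultimately show "of_nat (card (noncut (insert 0 (insert 1 S)) 0)) * of_nat (card (conn (V - insert 1 S))) =
        (fact (card S) * fps_deriv (B' oo F) $ card S) * (fact (card M - card S) * C' $ (card M - card S) :: 'a)"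
      by (simp add: C'_nth card_conn mult_ac)
  qed
  also have "\<dots> = fact (card M) * (fps_deriv (B' oo F) * C') $ card M"
    by (rule sum_Pow_egf) (use M in simp)
  also have "card (conn V) = c (n + 2)" using card_conn[of V] by (simp add: V_def)
  also have "of_nat (c (n + 2)) = fact (Suc n) * (C' $ Suc n :: 'a)" by (simp only: C'_nth) simp
  finally have "fact n * fps_deriv C' $ n = fact n * ((fps_deriv (B' oo F) * C') $ n :: 'a)"
    using M by (simp add: mult_ac)
  then show "fps_deriv C' $ n = (fps_deriv (B' oo F) * C' :: 'a fps) $ n" by simp
qed

text \<open>\<open>\<phi>\<close> stands for exp(B') and is specified by its differential equation.
  Composed with \<open>F\<close>, it satisfies the same linear equation as \<open>C'\<close>, and
  both start with 1.\<close>

theorem C'_functional_equation: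
  fixes \<phi> :: "'a::field_char_0 fps"
  assumes "fps_deriv \<phi> = fps_deriv B' * \<phi>" "\<phi> $ 0 = 1"
  shows "C' = \<phi> oo F"
proof (rule fps_linear_ode_unique)
  have F0: "F $ 0 = (0 :: 'a)" by (simp add: F_def)
  show "fps_deriv C' = (fps_deriv (B' oo F) * C' :: 'a fps)" by (rule deriv_C')
  show "fps_deriv (\<phi> oo F) = fps_deriv (B' oo F) * (\<phi> oo F)"
    using F0 by (simp add: fps_compose_deriv assms(1) fps_compose_mult_distrib mult_ac)
  have "C' $ 0 = (1 :: 'a)" using C'_nth[of 0, where 'a = 'a] by (simp add: c_1)
  then show "C' $ 0 = (\<phi> oo F) $ 0" "(\<phi> oo F) $ 0 \<noteq> 0" using assms(2) by simp_all
qed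

end

section \<open>Series-parallel-like classes\<close>

lemma fps_conv_radius_of_real:
  assumes "\<And>n. g $ n = complex_of_real (f $ n)"
  shows "fps_conv_radius g = fps_conv_radius f"
  unfolding fps_conv_radius_def conv_radius_def using assms by simp

lemma eval_fps_of_real:
  fixes f :: "real fps"
  assumes "\<And>n. g $ n = complex_of_real (f $ n)" "ereal \<bar>x\<bar> < fps_conv_radius f"
  shows "eval_fps g (of_real x) = of_real (eval_fps f x)"
proof -
  have "(\<lambda>n. complex_of_real (f $ n * x ^ n)) sums of_real (eval_fps f x)"
    using assms(2) by (intro sums_of_real sums_eval_fps) simp
  moreover have "(\<lambda>n. g $ n * of_real x ^ n) sums eval_fps g (of_real x)"
    using assms by (intro sums_eval_fps) (simp add: fps_conv_radius_of_real)
  ultimately show ?thesis using sums_unique2 by (simp add: assms(1))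
qed

lemma less_radius: "x < r \<Longrightarrow> ereal r \<le> y \<Longrightarrow> ereal x < y"
  using less_le_trans[of "ereal x" "ereal r" y] by simp

locale series_parallel_class = graph_class +
  assumes sp: "series_parallel_like \<G>"
begin

section \<open>The radius of convergence and the critical point\<close>

abbreviation R :: real where "R \<equiv> R_of \<G>"

text \<open>\<open>real_of_ereal\<close> sends infinity to 0, so \<open>R \<noteq> 0\<close>
  excludes an infinite radius as well as a vanishing one.\<close>

lemma radius_B: "fps_conv_radius (B_fps \<G> :: real fps) = ereal R" and R_pos: "R > 0"
proof -
  have nn: "0 \<le> fps_conv_radius (B_fps \<G> :: real fps)"
    by (simp add: fps_conv_radius_def conv_radius_nonneg)
  have "R \<noteq> 0" using sp by (auto simp: series_parallel_like_def zero_ereal_def[symmetric])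
  then have "\<bar>fps_conv_radius (B_fps \<G> :: real fps)\<bar> \<noteq> \<infinity>"
    by (auto simp: R_of_def)
  then show eq: "fps_conv_radius (B_fps \<G> :: real fps) = ereal R"
    by (simp add: R_of_def ereal_real')
  then show "R > 0" using nn \<open>R \<noteq> 0\<close> by simp
qed

definition \<beta> :: "nat \<Rightarrow> real" where "\<beta> k = B' $ k"

lemma \<beta>_eq: "\<beta> k = real (b (Suc k)) / fact k"
  using B'_nth[of k, where 'a = real] by (simp add: \<beta>_def field_simps)

lemma \<beta>_nonneg: "\<beta> k \<ge> 0" by (simp add: \<beta>_eq)
lemma \<beta>_0: "\<beta> 0 = 0" using b_le_1[of 1] by (simp add: \<beta>_eq)
lemma \<beta>_1: "\<beta> 1 = 1" using b_2 by (simp add: \<beta>_eq numeral_2_eq_2)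

lemma B''_eq: "B'' \<G> = fps_deriv B'"
  by (simp add: B''_def B'_def)

lemma B''_nth: "B'' \<G> $ k = real (Suc k) * \<beta> (Suc k)"
  by (simp add: B''_eq \<beta>_def)

lemma B''_nonneg: "0 \<le> (B'' \<G> $ k :: real)"
  unfolding B''_nth using \<beta>_nonneg[of "Suc k"] by simp

lemma radius_B': "ereal R \<le> fps_conv_radius (B' :: real fps)"
  unfolding B'_def using fps_conv_radius_deriv[of "B_fps \<G> :: real fps"] radius_B by simp

lemma radius_B'': "ereal R \<le> fps_conv_radius (B'' \<G> :: real fps)"
  unfolding B''_eq using fps_conv_radius_deriv[of "B' :: real fps"] radius_B' by (rule order.trans[rotated])

lemma B'_complex_nth: "B' $ k = complex_of_real (\<beta> k)"
proof -
  have "fact k * (B' $ k :: complex) = fact k * complex_of_real (\<beta> k)"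
    unfolding B'_nth \<beta>_eq by simp
  then show ?thesis by simp
qed

lemma radius_B'_complex: "ereal R \<le> fps_conv_radius (B' :: complex fps)"
  using radius_B' fps_conv_radius_of_real[of "B'" "B'"] by (simp add: B'_complex_nth \<beta>_def)

lemma radius_B''_complex: "ereal R \<le> fps_conv_radius (B'' \<G> :: complex fps)"
  unfolding B''_eq using fps_conv_radius_deriv[of "B' :: complex fps"] radius_B'_complex by (rule order.trans[rotated])

lemma B''_sums:
  fixes t :: real
  assumes "\<bar>t\<bar> < R"
  shows "(\<lambda>k. B'' \<G> $ k * t ^ k) sums eval_fps (B'' \<G>) t"
  using assms radius_B'' by (intro sums_eval_fps) (auto intro: less_radius)

lemma eval_B''_mono:
  assumes "0 \<le> s" "s \<le> t" "t < R"
  shows "eval_fps (B'' \<G>) s \<le> (eval_fps (B'' \<G>) t :: real)"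
  using assms B''_nonneg
  by (intro sums_le[OF _ B''_sums B''_sums] mult_left_mono power_mono) auto

lemma eval_B''_ge_partial:
  assumes "0 \<le> t" "t < R"
  shows "(\<Sum>k<N. B'' \<G> $ k * t ^ k) \<le> (eval_fps (B'' \<G>) t :: real)"
  using B''_sums[of t] assms B''_nonneg
  by (auto simp: sums_iff intro!: sum_le_suminf[where I = "{..<N}", THEN order.trans])

lemma eval_B''_pos: "0 \<le> t \<Longrightarrow> t < R \<Longrightarrow> 0 < (eval_fps (B'' \<G>) t :: real)"
  using eval_B''_ge_partial[of t 1] B''_nth[of 0] \<beta>_1 by simp

text \<open>B''(R) may be infinite. A partial sum is a polynomial, continuous at R in any case, so
  that the inequality can be carried to points below R.\<close>

lemma ex_partial_sum_gt: "\<exists>N. R * (\<Sum>k<N. B'' \<G> $ k * R ^ k) > 1"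
proof (rule ccontr)
  assume "\<not> ?thesis"
  then have le: "(\<Sum>k<N. B'' \<G> $ k * R ^ k) \<le> 1 / R" for N
    using R_pos by (auto simp: not_less field_simps)
  have "(\<Sum>k. ereal (B'' \<G> $ k * R ^ k)) \<le> ereal (1 / R)"
    using le B''_nonneg R_pos by (intro suminf_bound) auto
  then have "ereal R * (\<Sum>k. ereal (B'' \<G> $ k * R ^ k)) \<le> ereal R * ereal (1 / R)"
    using R_pos by (intro ereal_mult_left_mono) auto
  also have "ereal R * ereal (1 / R) = 1" using R_pos by (simp add: one_ereal_def)
  finally show False using sp by (simp add: series_parallel_like_def not_less[symmetric])
qed

definition \<tau> :: real where "\<tau> = tau_of \<G>"

text \<open>A partial sum already exceeds 1 slightly to the left of R, and the intermediate value
  theorem gives a solution below that point. Strict monotonicity of t B''(t) provides the uniqueness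
  that the description operator in \<open>tau_of\<close> demands.\<close>

lemma \<tau>: "0 < \<tau>" "\<tau> < R" "\<tau> * eval_fps (B'' \<G>) \<tau> = 1"
proof -
  let ?f = "\<lambda>t. t * (eval_fps (B'' \<G>) t :: real)"
  obtain N where N: "R * (\<Sum>k<N. B'' \<G> $ k * R ^ k) > 1" using ex_partial_sum_gt by blast
  have "isCont (\<lambda>t::real. t * (\<Sum>k<N. B'' \<G> $ k * t ^ k)) R" by (intro continuous_intros)
  then have "((\<lambda>t. t * (\<Sum>k<N. B'' \<G> $ k * t ^ k)) \<longlongrightarrow> R * (\<Sum>k<N. B'' \<G> $ k * R ^ k)) (at_left R)"
    unfolding isCont_def by (rule filterlim_mono) (auto simp: at_le)
  then have "\<forall>\<^sub>F t in at_left R. 1 < t * (\<Sum>k<N. B'' \<G> $ k * t ^ k)"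
    using N by (rule order_tendstoD(1))
  moreover have "\<forall>\<^sub>F t in at_left R. t \<in> {0<..<R}" by (intro eventually_at_leftI[of 0] R_pos)
  ultimately have "\<forall>\<^sub>F t in at_left R. 1 < t * (\<Sum>k<N. B'' \<G> $ k * t ^ k) \<and> t \<in> {0<..<R}"
    by eventually_elim auto
  then obtain t where t: "1 < t * (\<Sum>k<N. B'' \<G> $ k * t ^ k)" "0 < t" "t < R"
    using eventually_happens'[OF trivial_limit_at_left_real] by auto
  have "t * (\<Sum>k<N. B'' \<G> $ k * t ^ k) \<le> ?f t"
    using t by (intro mult_left_mono eval_B''_ge_partial) auto
  then have ft: "1 < ?f t" using t by linarith
  have "ereal x < fps_conv_radius (B'' \<G> :: real fps)" if "x \<le> t" for x
    by (rule less_radius[OF le_less_trans[OF that t(3)] radius_B''])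
  then have "continuous_on {0..t} ?f"
    by (intro continuous_intros) auto
  then obtain s where s: "0 \<le> s" "s \<le> t" "?f s = 1"
    using IVT'[of ?f 0 1 t] t ft by auto
  have s': "0 < s \<and> s < R \<and> s * eval_fps (B'' \<G>) s = 1" using s t by (cases "s = 0") auto
  have less: "?f x < ?f y" if "0 < x" "x < y" "y < R" for x y
  proof -
    have "?f x \<le> x * eval_fps (B'' \<G>) y" using that by (intro mult_left_mono eval_B''_mono) auto
    also have "\<dots> < ?f y" using that eval_B''_pos[of y] by simp
    finally show ?thesis .
  qed
  have "tau_of \<G> = s"
    unfolding tau_of_def
  proof (rule the_equality[of _ s])
    show "0 < s \<and> s < R_of \<G> \<and> s * eval_fps (B'' \<G>) s = 1" by (rule s')
    fix t assume "0 < t \<and> t < R_of \<G> \<and> t * eval_fps (B'' \<G>) t = 1"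
    then show "t = s" using less[of s t] less[of t s] s' by (cases s t rule: linorder_cases) auto
  qed
  then show "0 < \<tau>" "\<tau> < R" "\<tau> * eval_fps (B'' \<G>) \<tau> = 1" using s' by (auto simp: \<tau>_def)
qed

lemma critical: "(\<lambda>k. real k * \<beta> k * \<tau> ^ k) sums 1"
proof -
  have "(\<lambda>k. \<tau> * (B'' \<G> $ k * \<tau> ^ k)) sums (\<tau> * eval_fps (B'' \<G>) \<tau>)"
    using \<tau> by (intro sums_mult B''_sums) simp
  then have "(\<lambda>k. real (Suc k) * \<beta> (Suc k) * \<tau> ^ Suc k) sums 1"
    unfolding \<tau>(3) by (simp add: B''_nth mult_ac)
  then show ?thesis using sums_Suc_iff[of "\<lambda>k. real k * \<beta> k * \<tau> ^ k" 1] by simp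
qed

sublocale critical_series \<beta> \<tau>
  rewrites "critical_series.step_series \<beta> = B'"
proof -
  show "critical_series \<beta> \<tau>"
  proof
    have "conv_radius \<beta> = fps_conv_radius (B' :: real fps)"
      by (simp add: fps_conv_radius_def \<beta>_def[abs_def])
    then show "ereal \<tau> < conv_radius \<beta>"
      using radius_B' \<tau> by (metis less_le_trans ereal_less(2) less_ereal.simps(1))
  qed (use \<beta>_nonneg \<beta>_1 \<tau> critical in auto)
  then show "critical_series.step_series \<beta> = B'"
    by (intro fps_ext) (simp add: critical_series.step_series_def B'_complex_nth)
qed

text \<open>The Taylor series of exp(B'(z)) as an analytic function, rather than a formal
  composition: this gives radius of convergence at least R and the values at once, and the formal
  differential equation is then read off near 0.\<close>

definition \<phi> :: "complex fps" where "\<phi> = fps_expansion (\<lambda>z. exp (eval_fps B' z)) 0"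

lemma holomorphic_exp_B': "(\<lambda>z. exp (eval_fps (B' :: complex fps) z)) holomorphic_on eball 0 (ereal R)"
  using radius_B'_complex by (intro holomorphic_intros) (auto intro: less_radius)

lemma radius_\<phi>: "ereal R \<le> fps_conv_radius \<phi>"
  unfolding \<phi>_def by (rule conv_radius_fps_expansion[OF holomorphic_exp_B'])

lemma eval_\<phi>: "norm z < R \<Longrightarrow> eval_fps \<phi> z = exp (eval_fps B' z)"
  unfolding \<phi>_def by (subst eval_fps_expansion'[OF holomorphic_exp_B']) auto

lemma \<phi>_0: "\<phi> $ 0 = 1"
  using eval_\<phi>[of 0] R_pos \<beta>_0 by (simp add: eval_fps_at_0 B'_complex_nth)

lemma \<phi>_ode: "fps_deriv \<phi> = fps_deriv B' * \<phi>"
proof (rule eval_fps_eqD)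
  have r1: "ereal R \<le> fps_conv_radius (fps_deriv \<phi>)"
    using fps_conv_radius_deriv radius_\<phi> order.trans by blast
  have r2: "ereal R \<le> fps_conv_radius (fps_deriv B' :: complex fps)"
    using radius_B''_complex by (simp add: B''_eq)
  have r3: "ereal R \<le> fps_conv_radius (fps_deriv B' * \<phi>)"
    by (rule order.trans[OF _ fps_conv_radius_mult]) (use r2 radius_\<phi> in auto)
  have R0: "0 < ereal R" using R_pos by simp
  show "0 < fps_conv_radius (fps_deriv \<phi>)" by (rule less_le_trans[OF R0 r1])
  show "0 < fps_conv_radius (fps_deriv B' * \<phi>)" by (rule less_le_trans[OF R0 r3])
  have "\<forall>\<^sub>F z in nhds (0::complex). z \<in> ball 0 R"
    using R_pos by (intro eventually_nhds_in_open) auto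
  then show "\<forall>\<^sub>F z in nhds 0. eval_fps (fps_deriv \<phi>) z = eval_fps (fps_deriv B' * \<phi>) z"
  proof eventually_elim
    case (elim z)
    then have z: "norm z < R" by simp
    have zr: "ereal (norm z) < fps_conv_radius \<phi>" "ereal (norm z) < fps_conv_radius (B' :: complex fps)"
      "ereal (norm z) < fps_conv_radius (fps_deriv B' :: complex fps)"
      using z radius_\<phi> radius_B'_complex r2 by (auto intro: less_radius)
    have "\<forall>\<^sub>F w in nhds z. w \<in> ball 0 R" using z by (intro eventually_nhds_in_open) auto
    then have "\<forall>\<^sub>F w in nhds z. eval_fps \<phi> w = exp (eval_fps B' w)"
      by eventually_elim (simp add: eval_\<phi>)
    then have "deriv (eval_fps \<phi>) z = deriv (\<lambda>w. exp (eval_fps B' w)) z"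
      by (intro deriv_cong_ev) auto
    also have "((\<lambda>w. exp (eval_fps B' w)) has_field_derivative exp (eval_fps B' z) * eval_fps (fps_deriv B') z) (at z)"
      using zr by (auto intro!: derivative_eq_intros has_field_derivative_eval_fps)
    then have "deriv (\<lambda>w. exp (eval_fps B' w)) z = exp (eval_fps B' z) * eval_fps (fps_deriv B') z"
      by (rule DERIV_imp_deriv)
    finally show "eval_fps (fps_deriv \<phi>) z = eval_fps (fps_deriv B' * \<phi>) z"
      using zr z by (simp add: eval_fps_deriv eval_fps_mult eval_\<phi>)
  qed
qed

lemma F_equation: "F = fps_X * (\<phi> oo F)"
  using C'_functional_equation[OF \<phi>_ode \<phi>_0] by (simp add: F_def)

section \<open>Coefficient asymptotics for compositions with the rooted series\<close>

definition E :: real where "E = exp (eval_fps B' \<tau>)"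

lemma eval_B'_real: "eval_fps B' (complex_of_real \<tau>) = of_real (eval_fps B' \<tau>)"
  by (rule eval_fps_of_real) (use \<tau> radius_B' in \<open>auto simp: B'_complex_nth \<beta>_def intro: less_radius\<close>)

text \<open>The common normalisation of the n-th coefficients of all \<open>H oo F\<close>: the
  factor n from Lagrange inversion, its square root from the local limit theorem, and \<tau>^(n-1)
  E^(-n), where E is \<phi>(\<tau>).\<close>

definition scale :: "nat \<Rightarrow> real" where
  "scale n = sqrt (real n) * (\<tau> ^ (n - 1) / E ^ n) * real n"

lemma E_pos: "E > 0" by (simp add: E_def)

lemma compose_F_asymptotics:
  fixes H :: "complex fps"
  assumes "ereal \<tau> < fps_conv_radius (fps_deriv H)"
  shows "(\<lambda>n. of_real (scale n) * (H oo F) $ n) \<longlonglongrightarrow> eval_fps (fps_deriv H) (of_real \<tau>) * of_real gauss_const"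
proof -
  define a where "a n = of_real (sqrt (real n)) * ((fps_deriv H * \<phi> ^ n) $ (n - 1) * of_real \<tau> ^ (n - 1) / exp (eval_fps B' (of_real \<tau>)) ^ n)" for n
  have "a
           \<longlonglongrightarrow> eval_fps (fps_deriv H) (of_real \<tau>) * of_real gauss_const"
    unfolding a_def
  proof (rule power_coeff_asymptotics[OF _ _ assms])
    show "ereal \<tau> < fps_conv_radius \<phi>"
      using \<tau> radius_\<phi> by (auto intro: less_radius)
    show "eval_fps \<phi> z = exp (eval_fps B' z)" if "norm z \<le> \<tau>" for z
      using that \<tau> by (intro eval_\<phi>) simp
  qed
  moreover have "\<forall>\<^sub>F n in sequentially. a n
      = of_real (scale n) * (H oo F) $ n"
    using eventually_gt_at_top[of 0]
  proof eventually_elim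
    case (elim n)
    have "of_nat n * (H oo F) $ n = (fps_deriv H * \<phi> ^ n) $ (n - 1)"
      using \<phi>_0 by (intro lagrange_inversion[OF F_equation _ elim]) simp
    moreover have "exp (eval_fps B' (complex_of_real \<tau>)) = of_real E"
      by (simp add: eval_B'_real E_def exp_of_real)
    ultimately show ?case by (simp add: scale_def a_def mult_ac)
  qed
  ultimately show ?thesis by (rule Lim_transform_eventually)
qed

lemma F_asymptotics: "(\<lambda>n. of_real (scale n) * F $ n) \<longlonglongrightarrow> complex_of_real gauss_const"
  using compose_F_asymptotics[of fps_X] by (simp add: F_def)

lemma scale_pos: "n > 0 \<Longrightarrow> scale n > 0"
  using \<tau> E_pos by (simp add: scale_def)

lemma ratio_asymptotics:
  fixes H :: "complex fps"
  assumes "ereal \<tau> < fps_conv_radius (fps_deriv H)"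
  shows "(\<lambda>n. (H oo F) $ n / F $ n) \<longlonglongrightarrow> eval_fps (fps_deriv H) (of_real \<tau>)"
proof -
  have "(\<lambda>n. (of_real (scale n) * (H oo F) $ n) / (of_real (scale n) * F $ n)) \<longlonglongrightarrow>
      eval_fps (fps_deriv H) (of_real \<tau>) * of_real gauss_const / of_real gauss_const"
    using gauss_const_pos by (intro tendsto_divide compose_F_asymptotics F_asymptotics assms) auto
  moreover have "\<forall>\<^sub>F n in sequentially. (of_real (scale n) * (H oo F) $ n) / (of_real (scale n) * F $ n) = (H oo F) $ n / F $ n"
    using eventually_gt_at_top[of 0] by eventually_elim (use scale_pos in \<open>auto simp: less_imp_neq[symmetric]\<close>)
  ultimately show ?thesis
    using gauss_const_pos by (subst (asm) tendsto_cong) auto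
qed

lemma F_nth: "F $ n = complex_of_real (real n * (real (c n) / fact n))"
proof (cases n)
  case (Suc m)
  have "fact m * (C' $ m :: complex) = of_nat (c n)" unfolding Suc by (rule C'_nth)
  then have "C' $ m = complex_of_real (real (c n) / fact m)" by (simp add: field_simps)
  then show ?thesis unfolding Suc F_def by (simp del: of_nat_Suc)
qed (simp add: F_def)

lemma F_ratio: "(\<lambda>n. F $ n / F $ Suc n) \<longlonglongrightarrow> complex_of_real (\<tau> / E)"
proof -
  \<comment> \<open>For positive \<open>n\<close> this is
    \<open>scale (Suc n) / scale n\<close>.\<close>
  define w where "w n = sqrt (real (Suc n) / real n) * (real (Suc n) / real n) * (\<tau> / E)" for n
  have "(\<lambda>n. (of_real (scale n) * F $ n) / (of_real (scale (Suc n)) * F $ Suc n)) \<longlonglongrightarrow>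
      complex_of_real gauss_const / of_real gauss_const"
    using gauss_const_pos
    by (intro tendsto_divide F_asymptotics LIMSEQ_Suc[OF F_asymptotics]) auto
  moreover have "(\<lambda>n. complex_of_real (w n)) \<longlonglongrightarrow>
      of_real (sqrt 1 * 1 * (\<tau> / E))"
    unfolding w_def by (intro tendsto_of_real tendsto_mult tendsto_real_sqrt tendsto_const LIMSEQ_Suc_n_over_n)
  ultimately have "(\<lambda>n. (of_real (scale n) * F $ n) / (of_real (scale (Suc n)) * F $ Suc n) *
      complex_of_real (w n)) \<longlonglongrightarrow>
      complex_of_real gauss_const / of_real gauss_const * of_real (sqrt 1 * 1 * (\<tau> / E))"
    by (rule tendsto_mult)
  moreover have "\<forall>\<^sub>F n in sequentially. (of_real (scale n) * F $ n) / (of_real (scale (Suc n)) * F $ Suc n) *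
      complex_of_real (w n) = F $ n / F $ Suc n"
    using eventually_gt_at_top[of 0]
  proof eventually_elim
    case (elim n)
    have "scale n / scale (Suc n) * w n = 1"
    proof -
      have "\<tau> ^ n = \<tau> * \<tau> ^ (n - 1)" using elim by (cases n) auto
      then show ?thesis using elim \<tau> E_pos
        by (simp add: scale_def w_def real_sqrt_divide field_simps del: of_nat_Suc)
    qed
    then have one: "complex_of_real (scale n / scale (Suc n) * w n) = 1"
      by (simp only: of_real_1)
    have "(x * f) / (y * g) * k = (x / y * k) * (f / g)" for x f y g k :: complex
      by (simp add: divide_inverse mult_ac)
    then show ?case using one by (simp only: of_real_mult of_real_divide mult_1)
  qed
  ultimately show ?thesis
    using gauss_const_pos by (subst (asm) tendsto_cong) auto
qed

lemma rho_eq: "rho_of \<G> = \<tau> / E"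
proof -
  define f where "f n = real (c n) / fact n" for n
  have "(\<lambda>n. F $ n / F $ Suc n * of_real (real (Suc n) / real n)) \<longlonglongrightarrow> complex_of_real (\<tau> / E) * of_real 1"
    by (intro tendsto_mult F_ratio tendsto_of_real LIMSEQ_Suc_n_over_n)
  moreover have "\<forall>\<^sub>F n in sequentially. F $ n / F $ Suc n * of_real (real (Suc n) / real n) =
      complex_of_real (f n / f (Suc n))"
    using eventually_gt_at_top[of 0]
    by eventually_elim (simp add: F_nth f_def del: of_nat_Suc fact_Suc)
  ultimately have "(\<lambda>n. complex_of_real (f n / f (Suc n))) \<longlonglongrightarrow> complex_of_real (\<tau> / E)"
    by (subst (asm) tendsto_cong) auto
  then have "(\<lambda>n. f n / f (Suc n)) \<longlonglongrightarrow> \<tau> / E"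
    by (simp only: tendsto_of_real_iff)
  moreover have "norm (f n) = f n" for n by (simp add: f_def)
  ultimately have lim: "(\<lambda>n. norm (f n) / norm (f (Suc n))) \<longlonglongrightarrow> \<tau> / E" by simp
  have "conv_radius f = ereal (\<tau> / E)"
    by (rule conv_radius_ratio_limit_nonzero[OF HOL.refl _ lim]) (use \<tau> E_pos in auto)
  moreover have "fps_nth (C_fps \<G> :: real fps) = f"
    by (simp add: C_fps_nth f_def fun_eq_iff)
  ultimately show ?thesis by (simp add: rho_of_def fps_conv_radius_def)
qed

section \<open>The limit law of the core size and the coreless fraction\<close>

definition q :: "nat \<Rightarrow> real" where "q k = real k * \<beta> k * \<tau> ^ k"

lemma B'F_ratio: "(\<lambda>n. (B' oo F) $ n / F $ n) \<longlonglongrightarrow> complex_of_real (1 / \<tau>)"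
proof -
  have "eval_fps (B'' \<G>) (complex_of_real \<tau>) = of_real (eval_fps (B'' \<G>) \<tau>)"
    by (rule eval_fps_of_real)
      (use \<tau> radius_B'' in \<open>auto simp: B''_eq B'_complex_nth \<beta>_def intro: less_radius\<close>)
  also have "eval_fps (B'' \<G>) \<tau> = 1 / \<tau>" using \<tau> by (simp add: field_simps)
  finally have eval: "eval_fps (fps_deriv B') (complex_of_real \<tau>) = of_real (1 / \<tau>)" by (simp only: B''_eq)
  have "(\<lambda>n. (B' oo F) $ n / F $ n) \<longlonglongrightarrow> eval_fps (fps_deriv B') (complex_of_real \<tau>)"
    by (rule ratio_asymptotics) (use less_radius[OF \<tau>(2) radius_B''_complex] in \<open>simp add: B''_eq\<close>)
  then show ?thesis by (simp only: eval)
qed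

lemma F_power_ratio: "(\<lambda>n. (F ^ k) $ n / F $ n) \<longlonglongrightarrow> complex_of_real (real k * \<tau> ^ (k - 1))"
proof -
  have F0: "F $ 0 = (0 :: complex)" by (simp add: F_def)
  have d: "fps_deriv (fps_X ^ k) = fps_const (of_nat k) * (fps_X ^ (k - 1) :: complex fps)"
    by (simp add: fps_deriv_power)
  have rad: "fps_conv_radius (fps_const (of_nat k) * (fps_X ^ (k - 1) :: complex fps)) = \<infinity>"
    using fps_conv_radius_mult[of "fps_const (of_nat k)" "fps_X ^ (k - 1) :: complex fps"] by simp
  have "(\<lambda>n. ((fps_X ^ k) oo F) $ n / F $ n) \<longlonglongrightarrow> eval_fps (fps_deriv (fps_X ^ k)) (complex_of_real \<tau>)"
    by (rule ratio_asymptotics) (simp only: d rad less_ereal.simps)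
  also have "(fps_X ^ k) oo F = (F ^ k :: complex fps)"
    using F0 by (simp add: fps_compose_power[symmetric])
  also have "eval_fps (fps_deriv (fps_X ^ k)) (complex_of_real \<tau>) = of_real (real k * \<tau> ^ (k - 1))"
    by (simp add: d eval_fps_mult eval_fps_power)
  finally show ?thesis .
qed

lemma rooted_graphs_eq: "rooted_graphs \<G> n = conn {..<n}"
  by (auto simp: rooted_graphs_def conn_def)

lemma conn_coreless: "{G \<in> rooted_graphs \<G> n. \<not> coreless G} = noncut {..<n} 0"
  by (simp add: rooted_graphs_eq coreless_def noncut_def)

lemma card_conn_complex: "of_nat (card (conn {..<Suc m})) = fact m * (F $ Suc m :: complex)"
  using C'_nth[of m, where 'a = complex] card_conn[of "{..<Suc m}"] by (simp add: F_def)

lemma nonroot_interval: "m > 0 \<Longrightarrow> {..<Suc m} \<noteq> {0} \<and> card ({..<Suc m} - {0}) = m"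
  by (auto simp: card_Diff_subset)

lemma card_noncut_complex:
  "m > 0 \<Longrightarrow> of_nat (card (noncut {..<Suc m} 0)) = fact m * ((B' oo F) $ m :: complex)"
  using card_noncut[of "{..<Suc m}", where 'a = complex] nonroot_interval[of m] by simp

lemma card_noncut_core_size_complex:
  "m > 0 \<Longrightarrow> of_nat (card {G \<in> noncut {..<Suc m} 0. core_size G = k}) = fact m * (B' $ k * (F ^ k $ m) :: complex)"
  using card_noncut_core_size[of "{..<Suc m}" k, where 'a = complex] nonroot_interval[of m] by simp

lemma F_nonzero: "\<forall>\<^sub>F m in sequentially. F $ m \<noteq> (0 :: complex)"
  using tendsto_imp_eventually_ne[OF F_asymptotics, of 0] gauss_const_pos by (auto elim: eventually_mono)

text \<open>Graphs on \<open>Suc m\<close> vertices have \<open>m\<close> non-root vertices. Those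
  with a core are counted by \<open>B' oo F\<close> in degree \<open>m\<close>, all of them by
  \<open>C'\<close> in degree \<open>m\<close>, which is \<open>F\<close> in degree
  \<open>Suc m\<close>. This shift contributes the factor \<rho>, and criticality B''(\<tau>) =
  1/\<tau> the other one.\<close>

lemma noncut_fraction: "(\<lambda>m. real (card (noncut {..<Suc m} 0)) / real (card (conn {..<Suc m}))) \<longlonglongrightarrow> rho_of \<G> / \<tau>"
proof -
  have "(\<lambda>m. ((B' oo F) $ m / F $ m) * (F $ m / F $ Suc m)) \<longlonglongrightarrow> complex_of_real (1 / \<tau>) * of_real (\<tau> / E)"
    by (intro tendsto_mult B'F_ratio F_ratio)
  moreover have "\<forall>\<^sub>F m in sequentially. ((B' oo F) $ m / F $ m) * (F $ m / F $ Suc m) =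
      complex_of_real (real (card (noncut {..<Suc m} 0)) / real (card (conn {..<Suc m})))"
    using F_nonzero eventually_gt_at_top[of 0]
    by eventually_elim (simp add: card_noncut_complex card_conn_complex)
  ultimately have "(\<lambda>m. complex_of_real (real (card (noncut {..<Suc m} 0)) / real (card (conn {..<Suc m})))) \<longlonglongrightarrow>
      complex_of_real (1 / \<tau>) * of_real (\<tau> / E)"
    by (subst (asm) tendsto_cong) auto
  also have "complex_of_real (1 / \<tau>) * of_real (\<tau> / E) = of_real (rho_of \<G> / \<tau>)"
    by (simp add: rho_eq)
  finally show ?thesis by (simp only: tendsto_of_real_iff)
qed

text \<open>Numerator and denominator are both compared with the m-th coefficient of
  \<open>F\<close>. The limit 1/\<tau> of the denominator turns \<tau>^(k-1) into \<tau>^k.\<close>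

lemma core_size_fraction:
  "(\<lambda>m. real (card {G \<in> noncut {..<Suc m} 0. core_size G = k}) / real (card (noncut {..<Suc m} 0))) \<longlonglongrightarrow> q k"
proof -
  have "(\<lambda>m. B' $ k * (((F ^ k) $ m / F $ m) / ((B' oo F) $ m / F $ m))) \<longlonglongrightarrow>
      B' $ k * (complex_of_real (real k * \<tau> ^ (k - 1)) / of_real (1 / \<tau>))"
    using \<tau> by (intro tendsto_mult tendsto_divide tendsto_const F_power_ratio B'F_ratio) auto
  moreover have "\<forall>\<^sub>F m in sequentially. B' $ k * (((F ^ k) $ m / F $ m) / ((B' oo F) $ m / F $ m)) =
      complex_of_real (real (card {G \<in> noncut {..<Suc m} 0. core_size G = k}) / real (card (noncut {..<Suc m} 0)))"
    using F_nonzero eventually_gt_at_top[of 0]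
    by eventually_elim (simp add: card_noncut_complex card_noncut_core_size_complex)
  ultimately have "(\<lambda>m. complex_of_real (real (card {G \<in> noncut {..<Suc m} 0. core_size G = k}) / real (card (noncut {..<Suc m} 0)))) \<longlonglongrightarrow>
      B' $ k * (complex_of_real (real k * \<tau> ^ (k - 1)) / of_real (1 / \<tau>))"
    by (subst (asm) tendsto_cong) auto
  also have "B' $ k * (complex_of_real (real k * \<tau> ^ (k - 1)) / of_real (1 / \<tau>)) = of_real (q k)"
    by (cases k) (simp_all add: B'_complex_nth q_def mult_ac)
  finally show ?thesis by (simp only: tendsto_of_real_iff)
qed

text \<open>\<open>pmf_of_set\<close> is meaningful only for nonempty finite sets. The positive
  limit of the fraction of graphs with a core shows that both sample spaces are eventually
  nonempty.\<close>

lemma card_positive: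
  "\<forall>\<^sub>F m in sequentially. card (conn {..<Suc m}) > 0 \<and> card (noncut {..<Suc m} 0) > 0"
proof -
  have "rho_of \<G> / \<tau> > 0" using \<tau> E_pos by (simp add: rho_eq)
  then have "\<forall>\<^sub>F m in sequentially. real (card (noncut {..<Suc m} 0)) / real (card (conn {..<Suc m})) > 0"
    by (intro order_tendstoD(1)[OF noncut_fraction])
  then show ?thesis by eventually_elim (auto simp: zero_less_divide_iff)
qed

theorem coreless_limit:
  "(\<lambda>n. measure_pmf.prob (random_rooted \<G> n) {G. coreless G}) \<longlonglongrightarrow> 1 - rho_of \<G> / \<tau>"
proof (rule LIMSEQ_imp_Suc)
  have "\<forall>\<^sub>F m in sequentially. 1 - real (card (noncut {..<Suc m} 0)) / real (card (conn {..<Suc m})) =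
      measure_pmf.prob (random_rooted \<G> (Suc m)) {G. coreless G}"
    using card_positive
  proof eventually_elim
    case (elim m)
    let ?S = "conn {..<Suc m}"
    have fin: "finite ?S" by (intro finite_conn) simp
    have ne: "?S \<noteq> {}" using elim by auto
    have sub: "noncut {..<Suc m} 0 \<subseteq> ?S" by (auto simp: noncut_def)
    have "?S \<inter> {G. coreless G} = ?S - noncut {..<Suc m} 0"
      by (auto simp: noncut_def coreless_def)
    then have "card (?S \<inter> {G. coreless G}) = card ?S - card (noncut {..<Suc m} 0)"
      using sub fin by (simp add: card_Diff_subset finite_subset)
    moreover have "card (noncut {..<Suc m} 0) \<le> card ?S" using sub fin by (rule card_mono[rotated])
    ultimately show ?case
      using elim by (simp add: random_rooted_def rooted_graphs_eq measure_pmf_of_set[OF ne fin] of_nat_diff diff_divide_distrib)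
  qed
  then show "(\<lambda>m. measure_pmf.prob (random_rooted \<G> (Suc m)) {G. coreless G}) \<longlonglongrightarrow> 1 - rho_of \<G> / \<tau>"
    by (rule Lim_transform_eventually[rotated]) (intro tendsto_diff tendsto_const noncut_fraction)
qed

theorem core_size_limit:
  "(\<lambda>n. measure_pmf.prob (random_rooted_with_core \<G> n) {G. core_size G = k}) \<longlonglongrightarrow> q k"
proof (rule LIMSEQ_imp_Suc)
  have "\<forall>\<^sub>F m in sequentially. real (card {G \<in> noncut {..<Suc m} 0. core_size G = k}) / real (card (noncut {..<Suc m} 0)) =
      measure_pmf.prob (random_rooted_with_core \<G> (Suc m)) {G. core_size G = k}"
    using card_positive
  proof eventually_elim
    case (elim m)
    let ?S = "noncut {..<Suc m} 0"
    have fin: "finite ?S" by (intro finite_noncut) simp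
    have ne: "?S \<noteq> {}" using elim by auto
    have "?S \<inter> {G. core_size G = k} = {G \<in> ?S. core_size G = k}" by auto
    then show ?case
      by (simp add: random_rooted_with_core_def conn_coreless measure_pmf_of_set[OF ne fin])
  qed
  then show "(\<lambda>m. measure_pmf.prob (random_rooted_with_core \<G> (Suc m)) {G. core_size G = k}) \<longlonglongrightarrow> q k"
    by (rule Lim_transform_eventually[rotated]) (rule core_size_fraction)
qed

section \<open>Generating function and tail of the limit law\<close>

lemma q_nonneg: "0 \<le> q k"
  using \<beta>_nonneg[of k] \<tau> by (simp add: q_def)

lemma q_sums: "q sums 1"
  using critical by (simp add: q_def[abs_def])

lemma q_generating_function:
  fixes u :: complex
  assumes "norm (u * of_real \<tau>) < R"
  shows "(\<lambda>k. of_real (q k) * u ^ k) sums (of_real \<tau> * u * eval_fps (B'' \<G>) (u * of_real \<tau>))"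
proof -
  have "ereal (norm (u * of_real \<tau>)) < fps_conv_radius (B'' \<G> :: complex fps)"
    using assms radius_B''_complex by (rule less_radius)
  then have "(\<lambda>k. of_real \<tau> * u * (B'' \<G> $ k * (u * of_real \<tau>) ^ k)) sums
      (of_real \<tau> * u * eval_fps (B'' \<G>) (u * of_real \<tau>))"
    by (intro sums_mult sums_eval_fps)
  also have "(\<lambda>k. of_real \<tau> * u * (B'' \<G> $ k * (u * of_real \<tau>) ^ k)) = (\<lambda>k. of_real (q (Suc k)) * u ^ Suc k)"
    by (simp add: B''_eq B'_complex_nth q_def power_mult_distrib mult_ac)
  finally show ?thesis by (subst (asm) sums_Suc_iff) (simp add: q_def)
qed

text \<open>With f_n the coefficients of B, q_k = k (k+1) f_(k+1) \<tau>^k. The factor of order k^2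
  raises the exponent -M - 1/2 to 3/2 - M, and the index shift leaves 1/R.\<close>

lemma q_asymptotics:
  fixes cs :: "nat \<Rightarrow> complex"
  assumes M: "M > 0" and exp: "singular_expansion (B_fps \<G>) R (\<lambda>X. \<Sum>k<2 * M. cs k * X ^ k) (2 * M)"
    and odd: "\<And>k. odd k \<Longrightarrow> k < 2 * M - 1 \<Longrightarrow> cs k = 0"
    and a: "cs (2 * M - 1) * inverse (Gamma (1 / 2 - of_nat M)) = of_real a" "a \<noteq> 0"
  shows "q \<sim>[at_top] (\<lambda>k. a / R * real k powr (3 / 2 - real M) * (\<tau> / R) ^ k)"
proof -
  define f where "f n = real (b n) / fact n" for n
  have rad: "ereal R \<le> fps_conv_radius (B_fps \<G> :: complex fps)"
    using radius_B fps_conv_radius_of_real[of "B_fps \<G>" "B_fps \<G>"] by (simp add: B_fps_nth)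
  have "(\<lambda>n. complex_of_real (f n * (R ^ n * real n powr (real M + 1 / 2)))) \<longlonglongrightarrow> of_real a"
    using singular_expansion_coeff[OF R_pos rad M exp odd] unfolding a(1) by (simp add: B_fps_nth f_def)
  then have lim: "(\<lambda>n. f n * (R ^ n * real n powr (real M + 1 / 2))) \<longlonglongrightarrow> a"
    by (simp only: tendsto_of_real_iff)
  have "(\<lambda>k. f (Suc k) * (R ^ Suc k * real (Suc k) powr (real M + 1 / 2)) / a) \<longlonglongrightarrow> a / a"
    using a by (intro tendsto_divide LIMSEQ_Suc[OF lim] tendsto_const)
  \<comment> \<open>This factor tends to 1 and turns the powers of k + 1, in which the expansion of
    B is phrased, into powers of k.\<close>
  moreover have "(\<lambda>k. (real k / real (Suc k)) powr (real M - 1 / 2)) \<longlonglongrightarrow> 1 powr (real M - 1 / 2)"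
    by (intro tendsto_powr LIMSEQ_n_over_Suc_n tendsto_const) simp
  ultimately have "(\<lambda>k. f (Suc k) * (R ^ Suc k * real (Suc k) powr (real M + 1 / 2)) / a *
      (real k / real (Suc k)) powr (real M - 1 / 2)) \<longlonglongrightarrow> a / a * 1 powr (real M - 1 / 2)"
    by (rule tendsto_mult)
  moreover have "\<forall>\<^sub>F k in sequentially. f (Suc k) * (R ^ Suc k * real (Suc k) powr (real M + 1 / 2)) / a *
      (real k / real (Suc k)) powr (real M - 1 / 2) = q k / (a / R * real k powr (3 / 2 - real M) * (\<tau> / R) ^ k)"
    using eventually_gt_at_top[of 0]
  proof eventually_elim
    case (elim k)
    define s where "s = real M - 1 / 2"
    have "q k = real k * real (Suc k) * f (Suc k) * \<tau> ^ k"
    proof -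
      have "\<beta> k = real (Suc k) * f (Suc k)" by (simp add: \<beta>_eq f_def del: of_nat_Suc)
      then show ?thesis by (simp add: q_def del: of_nat_Suc)
    qed
    moreover have "real (Suc k) powr (real M + 1 / 2) = real (Suc k) * real (Suc k) powr s"
      by (simp add: s_def powr_mult_base add.commute)
    moreover have "real k powr (3 / 2 - real M) = real k / real k powr s"
      using elim powr_diff[of "real k" 1 s] by (simp add: s_def)
    moreover have "(real k / real (Suc k)) powr s = real k powr s / real (Suc k) powr s"
      by (rule powr_divide)
    moreover have "real k powr s > 0" "real (Suc k) powr s > 0" using elim by auto
    ultimately show ?case
      unfolding s_def[symmetric] using elim \<tau> R_pos a(2)
      by (simp add: power_divide field_simps del: of_nat_Suc)
  qed
  ultimately have "(\<lambda>k. q k / (a / R * real k powr (3 / 2 - real M) * (\<tau> / R) ^ k)) \<longlonglongrightarrow> 1"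
    using a by (subst (asm) tendsto_cong) auto
  then show ?thesis by (rule asymp_equivI')
qed

text \<open>The case M = 2; the constant is 1 / Gamma(-3/2) = 3 / (4 sqrt \<pi>).\<close>

lemma q_asymptotics_3:
  fixes B0 B2 B3 :: real
  assumes "B3 \<noteq> 0 \<and> singular_expansion (B_fps \<G>) R
      (\<lambda>X. of_real B0 + of_real B2 * X ^ 2 + of_real B3 * X ^ 3) 4"
  shows "q \<sim>[at_top] (\<lambda>k. 3 * B3 / (4 * R * sqrt pi) * real k powr (- 1 / 2) * (\<tau> / R) ^ k)"
proof -
  define cs :: "nat \<Rightarrow> complex" where "cs = (\<lambda>_. 0 :: complex)(0 := of_real B0, 2 := of_real B2, 3 := of_real B3)"
  have P: "(\<lambda>X. \<Sum>k<2 * 2. cs k * X ^ k) = (\<lambda>X::complex. of_real B0 + of_real B2 * X ^ 2 + of_real B3 * X ^ 3)"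
    by (simp add: cs_def eval_nat_numeral)
  have "q \<sim>[at_top] (\<lambda>k. (3 * B3 / (4 * sqrt pi)) / R * real k powr (3 / 2 - real 2) * (\<tau> / R) ^ k)"
  proof (rule q_asymptotics)
    show "singular_expansion (B_fps \<G>) R (\<lambda>X. \<Sum>k<2 * 2. cs k * X ^ k) (2 * 2)"
      using assms unfolding P by simp
    show "cs k = 0" if "odd k" "k < 2 * 2 - 1" for k
      using that by (auto simp: cs_def)
    show "cs (2 * 2 - 1) * inverse (Gamma (1 / 2 - of_nat 2)) = of_real (3 * B3 / (4 * sqrt pi))"
    proof -
      have "1 / 2 - of_nat 2 = (- 3 / 2 :: complex)" by simp
      then show ?thesis by (simp only: Gamma_neg_half(2)) (simp add: cs_def)
    qed
  qed (use assms in auto)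
  then show ?thesis by (simp add: mult_ac)
qed

text \<open>The case M = 3, with 1 / Gamma(-5/2) = -15 / (8 sqrt \<pi>). The constant is therefore
  -15/8; the -5/2 of the informal statement differs from it by the factor 4/3.\<close>

lemma q_asymptotics_5:
  fixes B0 B2 B4 B5 :: real
  assumes "B5 \<noteq> 0 \<and> singular_expansion (B_fps \<G>) R
      (\<lambda>X. of_real B0 + of_real B2 * X ^ 2 + of_real B4 * X ^ 4 + of_real B5 * X ^ 5) 6"
  shows "q \<sim>[at_top] (\<lambda>k. - 15 * B5 / (8 * R * sqrt pi) * real k powr (- 3 / 2) * (\<tau> / R) ^ k)"
proof -
  define cs :: "nat \<Rightarrow> complex" where "cs = (\<lambda>_. 0 :: complex)(0 := of_real B0, 2 := of_real B2, 4 := of_real B4, 5 := of_real B5)"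
  have P: "(\<lambda>X. \<Sum>k<2 * 3. cs k * X ^ k) = (\<lambda>X::complex. of_real B0 + of_real B2 * X ^ 2 + of_real B4 * X ^ 4 + of_real B5 * X ^ 5)"
    by (simp add: cs_def eval_nat_numeral)
  have "q \<sim>[at_top] (\<lambda>k. (- 15 * B5 / (8 * sqrt pi)) / R * real k powr (3 / 2 - real 3) * (\<tau> / R) ^ k)"
  proof (rule q_asymptotics)
    show "singular_expansion (B_fps \<G>) R (\<lambda>X. \<Sum>k<2 * 3. cs k * X ^ k) (2 * 3)"
      using assms unfolding P by simp
    show "cs k = 0" if "odd k" "k < 2 * 3 - 1" for k
      using that by (auto simp: cs_def)
    show "cs (2 * 3 - 1) * inverse (Gamma (1 / 2 - of_nat 3)) = of_real (- 15 * B5 / (8 * sqrt pi))"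
    proof -
      have "1 / 2 - of_nat 3 = (- 5 / 2 :: complex)" by simp
      then show ?thesis by (simp only: Gamma_neg_half(3)) (simp add: cs_def)
    qed
  qed (use assms in auto)
  then show ?thesis by (simp add: mult_ac)
qed

end

text \<open>That \<open>q\<close> sums to 1 says that no mass escapes to infinity. The generating
  function is given on a disc of radius R/\<tau> > 1. The conditions \<open>B3 \<noteq> 0\<close>
  and \<open>B5 \<noteq> 0\<close> exclude a comparison with the zero function, to which only
  eventually vanishing sequences are asymptotically equivalent.\<close>

theorem theorem10:
  fixes \<G> :: "graph set" and R \<tau> \<rho> :: real
  defines "R \<equiv> R_of \<G>" and "\<tau> \<equiv> tau_of \<G>" and "\<rho> \<equiv> rho_of \<G>"
  assumes "closed_class \<G>"
    and "regular_three_connected \<G>"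
    and "series_parallel_like \<G>"
  shows "(\<exists>q :: nat \<Rightarrow> real.
      (\<forall>k. (\<lambda>n. measure_pmf.prob (random_rooted_with_core \<G> n) {G. core_size G = k})
             \<longlonglongrightarrow> q k) \<and>
      (\<forall>k. 0 \<le> q k) \<and> q sums 1 \<and>
      (\<forall>u :: complex. norm (u * of_real \<tau>) < R \<longrightarrow>
         (\<lambda>k. of_real (q k) * u ^ k) sums
           (of_real \<tau> * u * eval_fps (B'' \<G>) (u * of_real \<tau>))) \<and>
      (\<forall>B0 B2 B3 :: real. B3 \<noteq> 0 \<and>
         singular_expansion (B_fps \<G>) R
           (\<lambda>X. of_real B0 + of_real B2 * X ^ 2 + of_real B3 * X ^ 3) 4 \<longrightarrow>
         q \<sim>[at_top] (\<lambda>k. 3 * B3 / (4 * R * sqrt pi) *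
           real k powr (- 1 / 2) * (\<tau> / R) ^ k)) \<and>
      (\<forall>B0 B2 B4 B5 :: real. B5 \<noteq> 0 \<and>
         singular_expansion (B_fps \<G>) R
           (\<lambda>X. of_real B0 + of_real B2 * X ^ 2 + of_real B4 * X ^ 4 + of_real B5 * X ^ 5) 6 \<longrightarrow>
         q \<sim>[at_top] (\<lambda>k. - 15 * B5 / (8 * R * sqrt pi) *
           real k powr (- 3 / 2) * (\<tau> / R) ^ k)))
    \<and> (\<lambda>n. measure_pmf.prob (random_rooted \<G> n) {G. coreless G}) \<longlonglongrightarrow> 1 - \<rho> / \<tau>"
proof -
  interpret S: series_parallel_class \<G>
    by unfold_locales (fact assms)+
  have \<tau>: "\<tau> = S.\<tau>" by (simp add: \<tau>_def S.\<tau>_def)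
  show ?thesis
    unfolding R_def \<tau> \<rho>_def
    by (intro conjI exI[of _ S.q]; (intro allI impI)?;
        (rule S.core_size_limit S.q_nonneg S.q_sums S.q_generating_function
          S.q_asymptotics_3 S.q_asymptotics_5 S.coreless_limit; assumption?))
qed

end
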